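(* Let $\mathcal C$ be a rigid (semisimple, balanced, braided) tensor category over $\mathbb C$ and let $A$ be a rigid $\mathcal C$-algebra. Then $A$ is semisimple, i.e. the category $\mathrm{Rep}\,A$ is semisimple.
   Context: $\mathcal C$ is a semisimple abelian category over $\mathbb C$ with finite-dimensional Hom spaces, which is a rigid balanced braided tensor category with braiding $R_{V,W}:V\otimes W\to W\otimes V$ and simple unit object $\mathbf 1$. A $\mathcal C$-algebra is an object $A\in\mathcal C$ with morphisms $\mu:A\otimes A\to A$ and $\iota_A:\mathbf 1\hookrightarrow A$ such that $\mu(\mu\otimes \mathrm{id})=\mu(\mathrm{id}\otimes\mu)$, $\mu R_{A,A}=\mu$, $\mu(\iota_A\otimes\mathrm{id}_A)=\mathrm{id}_A$, and $\dim\mathrm{Hom}_{\mathcal C}(\mathbf 1,A)=1$. Let $\varepsilon_A:A\to\mathbf 1$ be the unique morphism with $\varepsilon_A\iota_A=\mathrm{id}$. $A$ is rigid if $e_A=\varepsilon_A\mu:A\otimes A\to\mathbf 1$ is a non-degenerate pairing (there is $i_A:\mathbf 1\to A\otimes A$ such that $e_A,i_A$ satisfy the rigidity axioms) and $\dim_{\mathcal C}A\ne0$ (dimension with respect to the balancing of $\mathcal C$). $\mathrm{Rep}\,A$ has objects $(V,\mu_V)$ with $V\in\mathcal C$ and $\mu_V:A\otimes V\to V$ satisfying $\mu_V(\mu\otimes\mathrm{id})=\mu_V(\mathrm{id}\otimes\mu_V)$ and $\mu_V(\iota_A\otimes\mathrm{id})=\mathrm{id}$; morphisms are the $\mathcal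 C$-morphisms commuting with the action of $A$. *)

theory Defs
  imports "Jordan_Normal_Form.VS_Connect"
begin

section \<open>Linear, abelian and semisimple categories over the complex numbers\<close>

text \<open>
  A linear category is given by a set of objects and, for each pair of objects, a complex
  vector space of morphisms, represented as a \<open>HOL-Algebra\<close> module record over
  \<open>class_ring :: complex ring\<close> (its \<open>mult\<close> and \<open>one\<close> fields are irrelevant).
  The Hom sets need not be disjoint; this is what allows the morphisms of \<open>Rep A\<close> to be
  literally morphisms of the underlying category.
\<close>

record ('o, 'm) lincat =
  Ob :: "'o set"
  Hom :: "'o \<Rightarrow> 'o \<Rightarrow> (complex, 'm) module"
  Ident :: "'o \<Rightarrow> 'm"
  Comp :: "'m \<Rightarrow> 'm \<Rightarrow> 'm"  (infixl \<open>\<cdot>\<index>\<close> 70)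

abbreviation arr :: "('o, 'm, 'e) lincat_scheme \<Rightarrow> 'o \<Rightarrow> 'o \<Rightarrow> 'm set" where
  "arr C X Y \<equiv> carrier (Hom C X Y)"

locale linear_category =
  fixes C :: "('o, 'm, 'e) lincat_scheme" (structure)
  assumes Hom_vectorspace:
      "\<lbrakk>X \<in> Ob C; Y \<in> Ob C\<rbrakk> \<Longrightarrow> vectorspace class_ring (Hom C X Y)"
    and Ident_closed: "X \<in> Ob C \<Longrightarrow> Ident C X \<in> arr C X X"
    and Comp_closed:
      "\<lbrakk>X \<in> Ob C; Y \<in> Ob C; Z \<in> Ob C; f \<in> arr C X Y; g \<in> arr C Y Z\<rbrakk>
        \<Longrightarrow> g \<cdot> f \<in> arr C X Z"
    and Comp_Ident_left:
      "\<lbrakk>X \<in> Ob C; Y \<in> Ob C; f \<in> arr C X Y\<rbrakk> \<Longrightarrow> Ident C Y \<cdot> f = f"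
    and Comp_Ident_right:
      "\<lbrakk>X \<in> Ob C; Y \<in> Ob C; f \<in> arr C X Y\<rbrakk> \<Longrightarrow> f \<cdot> Ident C X = f"
    and Comp_assoc:
      "\<lbrakk>W \<in> Ob C; X \<in> Ob C; Y \<in> Ob C; Z \<in> Ob C;
        f \<in> arr C W X; g \<in> arr C X Y; h \<in> arr C Y Z\<rbrakk>
        \<Longrightarrow> (h \<cdot> g) \<cdot> f = h \<cdot> (g \<cdot> f)"
    and Comp_add_left:
      "\<lbrakk>X \<in> Ob C; Y \<in> Ob C; Z \<in> Ob C; f \<in> arr C X Y; g \<in> arr C Y Z; h \<in> arr C Y Z\<rbrakk>
        \<Longrightarrow> (g \<oplus>\<^bsub>Hom C Y Z\<^esub> h) \<cdot> f = (g \<cdot> f) \<oplus>\<^bsub>Hom C X Z\<^esub> (h \<cdot> f)"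
    and Comp_add_right:
      "\<lbrakk>X \<in> Ob C; Y \<in> Ob C; Z \<in> Ob C; f \<in> arr C X Y; g \<in> arr C X Y; h \<in> arr C Y Z\<rbrakk>
        \<Longrightarrow> h \<cdot> (f \<oplus>\<^bsub>Hom C X Y\<^esub> g) = (h \<cdot> f) \<oplus>\<^bsub>Hom C X Z\<^esub> (h \<cdot> g)"
    and Comp_smult_left:
      "\<lbrakk>X \<in> Ob C; Y \<in> Ob C; Z \<in> Ob C; f \<in> arr C X Y; g \<in> arr C Y Z\<rbrakk>
        \<Longrightarrow> (c \<odot>\<^bsub>Hom C Y Z\<^esub> g) \<cdot> f = c \<odot>\<^bsub>Hom C X Z\<^esub> (g \<cdot> f)"
    and Comp_smult_right:
      "\<lbrakk>X \<in> Ob C; Y \<in> Ob C; Z \<in> Ob C; f \<in> arr C X Y; g \<in> arr C Y Z\<rbrakk>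
        \<Longrightarrow> g \<cdot> (c \<odot>\<^bsub>Hom C X Y\<^esub> f) = c \<odot>\<^bsub>Hom C X Z\<^esub> (g \<cdot> f)"

definition is_mono :: "('o, 'm, 'e) lincat_scheme \<Rightarrow> 'o \<Rightarrow> 'o \<Rightarrow> 'm \<Rightarrow> bool" where
  "is_mono C X Y f \<longleftrightarrow> f \<in> arr C X Y \<and>
    (\<forall>W\<in>Ob C. \<forall>g\<in>arr C W X. \<forall>h\<in>arr C W X. f \<cdot>\<^bsub>C\<^esub> g = f \<cdot>\<^bsub>C\<^esub> h \<longrightarrow> g = h)"

definition is_epi :: "('o, 'm, 'e) lincat_scheme \<Rightarrow> 'o \<Rightarrow> 'o \<Rightarrow> 'm \<Rightarrow> bool" where
  "is_epi C X Y f \<longleftrightarrow> f \<in> arr C X Y \<and>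
    (\<forall>Z\<in>Ob C. \<forall>g\<in>arr C Y Z. \<forall>h\<in>arr C Y Z. g \<cdot>\<^bsub>C\<^esub> f = h \<cdot>\<^bsub>C\<^esub> f \<longrightarrow> g = h)"

definition inverse_arr ::
    "('o, 'm, 'e) lincat_scheme \<Rightarrow> 'o \<Rightarrow> 'o \<Rightarrow> 'm \<Rightarrow> 'm \<Rightarrow> bool" where
  "inverse_arr C X Y f g \<longleftrightarrow> f \<in> arr C X Y \<and> g \<in> arr C Y X \<and>
    g \<cdot>\<^bsub>C\<^esub> f = Ident C X \<and> f \<cdot>\<^bsub>C\<^esub> g = Ident C Y"

definition is_iso :: "('o, 'm, 'e) lincat_scheme \<Rightarrow> 'o \<Rightarrow> 'o \<Rightarrow> 'm \<Rightarrow> bool" where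
  "is_iso C X Y f \<longleftrightarrow> (\<exists>g. inverse_arr C X Y f g)"

definition arr_inv :: "('o, 'm, 'e) lincat_scheme \<Rightarrow> 'o \<Rightarrow> 'o \<Rightarrow> 'm \<Rightarrow> 'm" where
  "arr_inv C X Y f = (THE g. inverse_arr C X Y f g)"

definition zero_object :: "('o, 'm, 'e) lincat_scheme \<Rightarrow> 'o \<Rightarrow> bool" where
  "zero_object C Z \<longleftrightarrow> Z \<in> Ob C \<and>
    (\<forall>X\<in>Ob C. (\<exists>!f. f \<in> arr C X Z) \<and> (\<exists>!f. f \<in> arr C Z X))"

definition is_kernel ::
    "('o, 'm, 'e) lincat_scheme \<Rightarrow> 'o \<Rightarrow> 'o \<Rightarrow> 'm \<Rightarrow> 'o \<Rightarrow> 'm \<Rightarrow> bool" where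
  "is_kernel C X Y f K k \<longleftrightarrow> K \<in> Ob C \<and> k \<in> arr C K X \<and>
    f \<cdot>\<^bsub>C\<^esub> k = \<zero>\<^bsub>Hom C K Y\<^esub> \<and>
    (\<forall>W\<in>Ob C. \<forall>g\<in>arr C W X. f \<cdot>\<^bsub>C\<^esub> g = \<zero>\<^bsub>Hom C W Y\<^esub> \<longrightarrow>
      (\<exists>!h. h \<in> arr C W K \<and> k \<cdot>\<^bsub>C\<^esub> h = g))"

definition is_cokernel ::
    "('o, 'm, 'e) lincat_scheme \<Rightarrow> 'o \<Rightarrow> 'o \<Rightarrow> 'm \<Rightarrow> 'o \<Rightarrow> 'm \<Rightarrow> bool" where
  "is_cokernel C X Y f Q q \<longleftrightarrow> Q \<in> Ob C \<and> q \<in> arr C Y Q \<and>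
    q \<cdot>\<^bsub>C\<^esub> f = \<zero>\<^bsub>Hom C X Q\<^esub> \<and>
    (\<forall>Z\<in>Ob C. \<forall>g\<in>arr C Y Z. g \<cdot>\<^bsub>C\<^esub> f = \<zero>\<^bsub>Hom C X Z\<^esub> \<longrightarrow>
      (\<exists>!h. h \<in> arr C Q Z \<and> h \<cdot>\<^bsub>C\<^esub> q = g))"

text \<open>Direct sum of a finite list of objects; for the empty list this says that \<open>S\<close> has zero
  identity morphism.\<close>

definition direct_sum :: "('o, 'm, 'e) lincat_scheme \<Rightarrow> 'o list \<Rightarrow> 'o \<Rightarrow> bool" where
  "direct_sum C Xs S \<longleftrightarrow> set Xs \<subseteq> Ob C \<and> S \<in> Ob C \<and>
    (\<exists>i p.
      (\<forall>k<length Xs. i k \<in> arr C (Xs ! k) S \<and> p k \<in> arr C S (Xs ! k)) \<and>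
      (\<forall>k<length Xs. \<forall>l<length Xs. p k \<cdot>\<^bsub>C\<^esub> i l =
        (if k = l then Ident C (Xs ! k) else \<zero>\<^bsub>Hom C (Xs ! l) (Xs ! k)\<^esub>)) \<and>
      Ident C S = finsum (Hom C S S) (\<lambda>k. i k \<cdot>\<^bsub>C\<^esub> p k) {..<length Xs})"

definition simple_object :: "('o, 'm, 'e) lincat_scheme \<Rightarrow> 'o \<Rightarrow> bool" where
  "simple_object C X \<longleftrightarrow> X \<in> Ob C \<and> \<not> zero_object C X \<and>
    (\<forall>Y\<in>Ob C. \<forall>f. is_mono C Y X f \<longrightarrow> zero_object C Y \<or> is_iso C Y X f)"

locale abelian_category = linear_category +
  assumes ex_zero_object: "\<exists>Z. zero_object C Z"
    and ex_direct_sum: "\<lbrakk>X \<in> Ob C; Y \<in> Ob C\<rbrakk> \<Longrightarrow> \<exists>S. direct_sum C [X, Y] S"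
    and ex_kernel:
      "\<lbrakk>X \<in> Ob C; Y \<in> Ob C; f \<in> arr C X Y\<rbrakk> \<Longrightarrow> \<exists>K k. is_kernel C X Y f K k"
    and ex_cokernel:
      "\<lbrakk>X \<in> Ob C; Y \<in> Ob C; f \<in> arr C X Y\<rbrakk> \<Longrightarrow> \<exists>Q q. is_cokernel C X Y f Q q"
    and mono_is_kernel:
      "\<lbrakk>X \<in> Ob C; Y \<in> Ob C; is_mono C X Y f\<rbrakk>
        \<Longrightarrow> \<exists>Z\<in>Ob C. \<exists>g\<in>arr C Y Z. is_kernel C Y Z g X f"
    and epi_is_cokernel:
      "\<lbrakk>X \<in> Ob C; Y \<in> Ob C; is_epi C X Y f\<rbrakk>
        \<Longrightarrow> \<exists>W\<in>Ob C. \<exists>g\<in>arr C W X. is_cokernel C W X g Y f"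

locale semisimple_category = abelian_category +
  assumes semisimple:
    "X \<in> Ob C \<Longrightarrow> \<exists>Xs. (\<forall>S\<in>set Xs. simple_object C S) \<and> direct_sum C Xs X"

section \<open>Rigid balanced braided tensor categories\<close>

text \<open>
  Tensor categories are not assumed strict. The structure isomorphisms are
  \<open>Assoc X Y Z : (X \<otimes> Y) \<otimes> Z \<rightarrow> X \<otimes> (Y \<otimes> Z)\<close>, \<open>LUnit X : 1 \<otimes> X \<rightarrow> X\<close>,
  \<open>RUnit X : X \<otimes> 1 \<rightarrow> X\<close>, \<open>Braid X Y : X \<otimes> Y \<rightarrow> Y \<otimes> X\<close> and \<open>Twist X : X \<rightarrow> X\<close>.
\<close>

record ('o, 'm) tensorcat = "('o, 'm) lincat" +
  TObj :: "'o \<Rightarrow> 'o \<Rightarrow> 'o"  (infixl \<open>\<otimes>\<^sub>o\<index>\<close> 75)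
  TMor :: "'m \<Rightarrow> 'm \<Rightarrow> 'm"  (infixl \<open>\<otimes>\<^sub>m\<index>\<close> 75)
  TUnit :: 'o
  Assoc :: "'o \<Rightarrow> 'o \<Rightarrow> 'o \<Rightarrow> 'm"
  LUnit :: "'o \<Rightarrow> 'm"
  RUnit :: "'o \<Rightarrow> 'm"
  Braid :: "'o \<Rightarrow> 'o \<Rightarrow> 'm"
  Twist :: "'o \<Rightarrow> 'm"

locale tensor_category = linear_category C
  for C :: "('o, 'm, 'e) tensorcat_scheme" (structure) +
  assumes TObj_closed: "\<lbrakk>X \<in> Ob C; Y \<in> Ob C\<rbrakk> \<Longrightarrow> X \<otimes>\<^sub>o Y \<in> Ob C"
    and TMor_closed:
      "\<lbrakk>X \<in> Ob C; X' \<in> Ob C; Y \<in> Ob C; Y' \<in> Ob C; f \<in> arr C X X'; g \<in> arr C Y Y'\<rbrakk>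
        \<Longrightarrow> f \<otimes>\<^sub>m g \<in> arr C (X \<otimes>\<^sub>o Y) (X' \<otimes>\<^sub>o Y')"
    and TMor_Ident:
      "\<lbrakk>X \<in> Ob C; Y \<in> Ob C\<rbrakk> \<Longrightarrow> Ident C X \<otimes>\<^sub>m Ident C Y = Ident C (X \<otimes>\<^sub>o Y)"
    and TMor_Comp:
      "\<lbrakk>X \<in> Ob C; X' \<in> Ob C; X'' \<in> Ob C; Y \<in> Ob C; Y' \<in> Ob C; Y'' \<in> Ob C;
        f \<in> arr C X X'; f' \<in> arr C X' X''; g \<in> arr C Y Y'; g' \<in> arr C Y' Y''\<rbrakk>
        \<Longrightarrow> (f' \<cdot> f) \<otimes>\<^sub>m (g' \<cdot> g) = (f' \<otimes>\<^sub>m g') \<cdot> (f \<otimes>\<^sub>m g)"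
    and TMor_add_left:
      "\<lbrakk>X \<in> Ob C; X' \<in> Ob C; Y \<in> Ob C; Y' \<in> Ob C;
        f \<in> arr C X X'; f' \<in> arr C X X'; g \<in> arr C Y Y'\<rbrakk>
        \<Longrightarrow> (f \<oplus>\<^bsub>Hom C X X'\<^esub> f') \<otimes>\<^sub>m g =
          (f \<otimes>\<^sub>m g) \<oplus>\<^bsub>Hom C (X \<otimes>\<^sub>o Y) (X' \<otimes>\<^sub>o Y')\<^esub> (f' \<otimes>\<^sub>m g)"
    and TMor_add_right:
      "\<lbrakk>X \<in> Ob C; X' \<in> Ob C; Y \<in> Ob C; Y' \<in> Ob C;
        f \<in> arr C X X'; g \<in> arr C Y Y'; g' \<in> arr C Y Y'\<rbrakk>
        \<Longrightarrow> f \<otimes>\<^sub>m (g \<oplus>\<^bsub>Hom C Y Y'\<^esub> g') =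
          (f \<otimes>\<^sub>m g) \<oplus>\<^bsub>Hom C (X \<otimes>\<^sub>o Y) (X' \<otimes>\<^sub>o Y')\<^esub> (f \<otimes>\<^sub>m g')"
    and TMor_smult_left:
      "\<lbrakk>X \<in> Ob C; X' \<in> Ob C; Y \<in> Ob C; Y' \<in> Ob C; f \<in> arr C X X'; g \<in> arr C Y Y'\<rbrakk>
        \<Longrightarrow> (c \<odot>\<^bsub>Hom C X X'\<^esub> f) \<otimes>\<^sub>m g =
          c \<odot>\<^bsub>Hom C (X \<otimes>\<^sub>o Y) (X' \<otimes>\<^sub>o Y')\<^esub> (f \<otimes>\<^sub>m g)"
    and TMor_smult_right:
      "\<lbrakk>X \<in> Ob C; X' \<in> Ob C; Y \<in> Ob C; Y' \<in> Ob C; f \<in> arr C X X'; g \<in> arr C Y Y'\<rbrakk>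
        \<Longrightarrow> f \<otimes>\<^sub>m (c \<odot>\<^bsub>Hom C Y Y'\<^esub> g) =
          c \<odot>\<^bsub>Hom C (X \<otimes>\<^sub>o Y) (X' \<otimes>\<^sub>o Y')\<^esub> (f \<otimes>\<^sub>m g)"
    and TUnit_closed: "TUnit C \<in> Ob C"
    and Assoc_iso:
      "\<lbrakk>X \<in> Ob C; Y \<in> Ob C; Z \<in> Ob C\<rbrakk>
        \<Longrightarrow> is_iso C ((X \<otimes>\<^sub>o Y) \<otimes>\<^sub>o Z) (X \<otimes>\<^sub>o (Y \<otimes>\<^sub>o Z)) (Assoc C X Y Z)"
    and LUnit_iso: "X \<in> Ob C \<Longrightarrow> is_iso C (TUnit C \<otimes>\<^sub>o X) X (LUnit C X)"
    and RUnit_iso: "X \<in> Ob C \<Longrightarrow> is_iso C (X \<otimes>\<^sub>o TUnit C) X (RUnit C X)"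
    and Assoc_natural:
      "\<lbrakk>X \<in> Ob C; X' \<in> Ob C; Y \<in> Ob C; Y' \<in> Ob C; Z \<in> Ob C; Z' \<in> Ob C;
        f \<in> arr C X X'; g \<in> arr C Y Y'; h \<in> arr C Z Z'\<rbrakk>
        \<Longrightarrow> Assoc C X' Y' Z' \<cdot> ((f \<otimes>\<^sub>m g) \<otimes>\<^sub>m h) = (f \<otimes>\<^sub>m (g \<otimes>\<^sub>m h)) \<cdot> Assoc C X Y Z"
    and LUnit_natural:
      "\<lbrakk>X \<in> Ob C; Y \<in> Ob C; f \<in> arr C X Y\<rbrakk>
        \<Longrightarrow> LUnit C Y \<cdot> (Ident C (TUnit C) \<otimes>\<^sub>m f) = f \<cdot> LUnit C X"
    and RUnit_natural:
      "\<lbrakk>X \<in> Ob C; Y \<in> Ob C; f \<in> arr C X Y\<rbrakk>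
        \<Longrightarrow> RUnit C Y \<cdot> (f \<otimes>\<^sub>m Ident C (TUnit C)) = f \<cdot> RUnit C X"
    and pentagon:
      "\<lbrakk>W \<in> Ob C; X \<in> Ob C; Y \<in> Ob C; Z \<in> Ob C\<rbrakk>
        \<Longrightarrow> (Ident C W \<otimes>\<^sub>m Assoc C X Y Z) \<cdot> Assoc C W (X \<otimes>\<^sub>o Y) Z
              \<cdot> (Assoc C W X Y \<otimes>\<^sub>m Ident C Z)
            = Assoc C W X (Y \<otimes>\<^sub>o Z) \<cdot> Assoc C (W \<otimes>\<^sub>o X) Y Z"
    and triangle:
      "\<lbrakk>X \<in> Ob C; Y \<in> Ob C\<rbrakk>
        \<Longrightarrow> (Ident C X \<otimes>\<^sub>m LUnit C Y) \<cdot> Assoc C X (TUnit C) Y = RUnit C X \<otimes>\<^sub>m Ident C Y"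

locale braided_tensor_category = tensor_category +
  assumes Braid_iso:
      "\<lbrakk>X \<in> Ob C; Y \<in> Ob C\<rbrakk> \<Longrightarrow> is_iso C (X \<otimes>\<^sub>o Y) (Y \<otimes>\<^sub>o X) (Braid C X Y)"
    and Braid_natural:
      "\<lbrakk>X \<in> Ob C; X' \<in> Ob C; Y \<in> Ob C; Y' \<in> Ob C; f \<in> arr C X X'; g \<in> arr C Y Y'\<rbrakk>
        \<Longrightarrow> Braid C X' Y' \<cdot> (f \<otimes>\<^sub>m g) = (g \<otimes>\<^sub>m f) \<cdot> Braid C X Y"
    and hexagon1:
      "\<lbrakk>X \<in> Ob C; Y \<in> Ob C; Z \<in> Ob C\<rbrakk>
        \<Longrightarrow> Assoc C Y Z X \<cdot> Braid C X (Y \<otimes>\<^sub>o Z) \<cdot> Assoc C X Y Z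
            = (Ident C Y \<otimes>\<^sub>m Braid C X Z) \<cdot> Assoc C Y X Z \<cdot> (Braid C X Y \<otimes>\<^sub>m Ident C Z)"
    and hexagon2:
      "\<lbrakk>X \<in> Ob C; Y \<in> Ob C; Z \<in> Ob C\<rbrakk>
        \<Longrightarrow> arr_inv C ((Z \<otimes>\<^sub>o X) \<otimes>\<^sub>o Y) (Z \<otimes>\<^sub>o (X \<otimes>\<^sub>o Y)) (Assoc C Z X Y)
              \<cdot> Braid C (X \<otimes>\<^sub>o Y) Z
              \<cdot> arr_inv C ((X \<otimes>\<^sub>o Y) \<otimes>\<^sub>o Z) (X \<otimes>\<^sub>o (Y \<otimes>\<^sub>o Z)) (Assoc C X Y Z)
            = (Braid C X Z \<otimes>\<^sub>m Ident C Y)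
              \<cdot> arr_inv C ((X \<otimes>\<^sub>o Z) \<otimes>\<^sub>o Y) (X \<otimes>\<^sub>o (Z \<otimes>\<^sub>o Y)) (Assoc C X Z Y)
              \<cdot> (Ident C X \<otimes>\<^sub>m Braid C Y Z)"

locale balanced_tensor_category = braided_tensor_category +
  assumes Twist_iso: "X \<in> Ob C \<Longrightarrow> is_iso C X X (Twist C X)"
    and Twist_natural:
      "\<lbrakk>X \<in> Ob C; Y \<in> Ob C; f \<in> arr C X Y\<rbrakk> \<Longrightarrow> Twist C Y \<cdot> f = f \<cdot> Twist C X"
    and Twist_TUnit: "Twist C (TUnit C) = Ident C (TUnit C)"
    and Twist_TObj:
      "\<lbrakk>X \<in> Ob C; Y \<in> Ob C\<rbrakk>
        \<Longrightarrow> Twist C (X \<otimes>\<^sub>o Y) = Braid C Y X \<cdot> Braid C X Y \<cdot> (Twist C X \<otimes>\<^sub>m Twist C Y)"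

text \<open>\<open>dual_pair C V D e i\<close>: the morphisms \<open>e : D \<otimes> V \<rightarrow> 1\<close> and \<open>i : 1 \<rightarrow> V \<otimes> D\<close> satisfy the
  rigidity axioms, so that \<open>D\<close> is a dual \<open>V*\<close> of \<open>V\<close> (and \<open>V\<close> a dual \<open>*D\<close> of \<open>D\<close> on the
  other side).\<close>

definition dual_pair ::
    "('o, 'm, 'e) tensorcat_scheme \<Rightarrow> 'o \<Rightarrow> 'o \<Rightarrow> 'm \<Rightarrow> 'm \<Rightarrow> bool" where
  "dual_pair C V D e i \<longleftrightarrow> V \<in> Ob C \<and> D \<in> Ob C \<and>
    e \<in> arr C (D \<otimes>\<^sub>o\<^bsub>C\<^esub> V) (TUnit C) \<and> i \<in> arr C (TUnit C) (V \<otimes>\<^sub>o\<^bsub>C\<^esub> D) \<and>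
    RUnit C V \<cdot>\<^bsub>C\<^esub> (Ident C V \<otimes>\<^sub>m\<^bsub>C\<^esub> e) \<cdot>\<^bsub>C\<^esub> Assoc C V D V
      \<cdot>\<^bsub>C\<^esub> (i \<otimes>\<^sub>m\<^bsub>C\<^esub> Ident C V) \<cdot>\<^bsub>C\<^esub> arr_inv C (TUnit C \<otimes>\<^sub>o\<^bsub>C\<^esub> V) V (LUnit C V)
      = Ident C V \<and>
    LUnit C D \<cdot>\<^bsub>C\<^esub> (e \<otimes>\<^sub>m\<^bsub>C\<^esub> Ident C D)
      \<cdot>\<^bsub>C\<^esub> arr_inv C ((D \<otimes>\<^sub>o\<^bsub>C\<^esub> V) \<otimes>\<^sub>o\<^bsub>C\<^esub> D) (D \<otimes>\<^sub>o\<^bsub>C\<^esub> (V \<otimes>\<^sub>o\<^bsub>C\<^esub> D)) (Assoc C D V D)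
      \<cdot>\<^bsub>C\<^esub> (Ident C D \<otimes>\<^sub>m\<^bsub>C\<^esub> i) \<cdot>\<^bsub>C\<^esub> arr_inv C (D \<otimes>\<^sub>o\<^bsub>C\<^esub> TUnit C) D (RUnit C D)
      = Ident C D"

text \<open>The standing assumptions on the base category. The inherited axioms \<open>Twist_*\<close> are the
  balancing in the sense of Joyal and Street; compatibility of the twist with duals is not
  required.\<close>

locale rigid_semisimple_tensor_category =
  semisimple_category C + balanced_tensor_category C
  for C :: "('o, 'm, 'e) tensorcat_scheme" (structure) +
  assumes Hom_fin_dim:
      "\<lbrakk>X \<in> Ob C; Y \<in> Ob C\<rbrakk> \<Longrightarrow> vectorspace.fin_dim class_ring (Hom C X Y)"
    and TUnit_simple: "simple_object C (TUnit C)"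
    and ex_right_dual: "V \<in> Ob C \<Longrightarrow> \<exists>D e i. dual_pair C V D e i"
    and ex_left_dual: "V \<in> Ob C \<Longrightarrow> \<exists>D e i. dual_pair C D V e i"

text \<open>The dimension of \<open>V\<close> with respect to the balancing, as an element of \<open>End(1)\<close>: the
  quantum trace \<open>1 \<rightarrow> V \<otimes> V* \<rightarrow> V \<otimes> V* \<rightarrow> V* \<otimes> V \<rightarrow> 1\<close> of the identity, where the second
  map is \<open>Twist \<otimes> id\<close> and the third is the braiding. It does not depend on the choice of the
  dual.\<close>

definition cat_dim :: "('o, 'm, 'e) tensorcat_scheme \<Rightarrow> 'o \<Rightarrow> 'm" where
  "cat_dim C V = (THE d. \<exists>D e i. dual_pair C V D e i \<and>
    d = e \<cdot>\<^bsub>C\<^esub> Braid C V D \<cdot>\<^bsub>C\<^esub> (Twist C V \<otimes>\<^sub>m\<^bsub>C\<^esub> Ident C D) \<cdot>\<^bsub>C\<^esub> i)"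

section \<open>Algebras in a tensor category and their modules\<close>

record ('o, 'm) calgebra =
  AObj :: 'o
  AMult :: 'm
  AUnit :: 'm

definition C_algebra ::
    "('o, 'm, 'e) tensorcat_scheme \<Rightarrow> ('o, 'm) calgebra \<Rightarrow> bool" where
  "C_algebra C A \<longleftrightarrow> AObj A \<in> Ob C \<and>
    AMult A \<in> arr C (AObj A \<otimes>\<^sub>o\<^bsub>C\<^esub> AObj A) (AObj A) \<and>
    is_mono C (TUnit C) (AObj A) (AUnit A) \<and>
    AMult A \<cdot>\<^bsub>C\<^esub> (AMult A \<otimes>\<^sub>m\<^bsub>C\<^esub> Ident C (AObj A))
      = AMult A \<cdot>\<^bsub>C\<^esub> (Ident C (AObj A) \<otimes>\<^sub>m\<^bsub>C\<^esub> AMult A)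
        \<cdot>\<^bsub>C\<^esub> Assoc C (AObj A) (AObj A) (AObj A) \<and>
    AMult A \<cdot>\<^bsub>C\<^esub> Braid C (AObj A) (AObj A) = AMult A \<and>
    AMult A \<cdot>\<^bsub>C\<^esub> (AUnit A \<otimes>\<^sub>m\<^bsub>C\<^esub> Ident C (AObj A)) = LUnit C (AObj A) \<and>
    vectorspace.dim class_ring (Hom C (TUnit C) (AObj A)) = 1"

definition counit :: "('o, 'm, 'e) tensorcat_scheme \<Rightarrow> ('o, 'm) calgebra \<Rightarrow> 'm" where
  "counit C A = (THE \<epsilon>. \<epsilon> \<in> arr C (AObj A) (TUnit C) \<and>
    \<epsilon> \<cdot>\<^bsub>C\<^esub> AUnit A = Ident C (TUnit C))"

definition rigid_C_algebra ::
    "('o, 'm, 'e) tensorcat_scheme \<Rightarrow> ('o, 'm) calgebra \<Rightarrow> bool" where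
  "rigid_C_algebra C A \<longleftrightarrow> C_algebra C A \<and>
    (\<exists>i. dual_pair C (AObj A) (AObj A) (counit C A \<cdot>\<^bsub>C\<^esub> AMult A) i) \<and>
    cat_dim C (AObj A) \<noteq> \<zero>\<^bsub>Hom C (TUnit C) (TUnit C)\<^esub>"

definition Rep ::
    "('o, 'm, 'e) tensorcat_scheme \<Rightarrow> ('o, 'm) calgebra \<Rightarrow> ('o \<times> 'm, 'm) lincat" where
  "Rep C A =
    \<lparr>Ob = {(V, \<rho>). V \<in> Ob C \<and> \<rho> \<in> arr C (AObj A \<otimes>\<^sub>o\<^bsub>C\<^esub> V) V \<and>
        \<rho> \<cdot>\<^bsub>C\<^esub> (AMult A \<otimes>\<^sub>m\<^bsub>C\<^esub> Ident C V)
          = \<rho> \<cdot>\<^bsub>C\<^esub> (Ident C (AObj A) \<otimes>\<^sub>m\<^bsub>C\<^esub> \<rho>) \<cdot>\<^bsub>C\<^esub> Assoc C (AObj A) (AObj A) V \<and>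
        \<rho> \<cdot>\<^bsub>C\<^esub> (AUnit A \<otimes>\<^sub>m\<^bsub>C\<^esub> Ident C V) = LUnit C V},
     Hom = (\<lambda>(V, \<rho>) (W, \<sigma>). (Hom C V W)
        \<lparr>carrier := {f \<in> arr C V W.
          f \<cdot>\<^bsub>C\<^esub> \<rho> = \<sigma> \<cdot>\<^bsub>C\<^esub> (Ident C (AObj A) \<otimes>\<^sub>m\<^bsub>C\<^esub> f)}\<rparr>),
     Ident = (\<lambda>(V, \<rho>). Ident C V),
     Comp = Comp C\<rparr>"

definition semisimple_algebra ::
    "('o, 'm, 'e) tensorcat_scheme \<Rightarrow> ('o, 'm) calgebra \<Rightarrow> bool" where
  "semisimple_algebra C A \<longleftrightarrow> semisimple_category (Rep C A)"

end

theory Submission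
  imports Defs
begin

text \<open>
  Everything rests on quasi-inverses: \<open>g\<close> is a quasi-inverse of \<open>f\<close> if \<open>f g f = f\<close>. Then \<open>g f\<close> and
  \<open>f g\<close> are idempotents whose complements cut out the kernel and the cokernel of \<open>f\<close>, and every
  monomorphism and every epimorphism splits. Hence a linear category with a zero object and
  biproducts, in which idempotents split and every morphism has a quasi-inverse, is abelian; if
  moreover some natural number attached to the objects drops on proper retracts, then splitting
  off subobjects terminates and every object is a finite sum of simple ones
  (\<open>regular_linear_category.semisimple_category\<close>). In the base category quasi-inverses exist by
  Schur's lemma and Gaussian elimination (\<open>regular_semisimple\<close>), and the dimension of the
  endomorphism space is a size. Zero objects, biproducts and split idempotents lift from the
  base category to \<open>Rep A\<close>. The heart of the matter is that a map \<open>f : V \<rightarrow> W\<close> of \<open>A\<close>-modules has a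
  quasi-inverse that is again \<open>A\<close>-linear.

  Take a quasi-inverse \<open>g : W \<rightarrow> V\<close> in the base category and average it as for finite groups.
  Write the copairing dual to the trace form \<open>e\<^sub>A\<close> as \<open>\<Sum> x\<^sub>j \<otimes> x\<^sup>j\<close>. Because \<open>e\<^sub>A\<close> is
  associative and nondegenerate, \<open>\<Sum> a x\<^sub>j \<otimes> x\<^sup>j = \<Sum> x\<^sub>j \<otimes> x\<^sup>j a\<close> (\<open>frobenius_law\<close>), so
  \<open>h(w) = \<Sum> x\<^sub>j g(x\<^sup>j w)\<close> is \<open>A\<close>-linear, and linearity of \<open>f\<close> gives
  \<open>f h f (v) = \<Sum> x\<^sub>j f(x\<^sup>j v) = f((\<Sum> x\<^sub>j x\<^sup>j) v)\<close>. As \<open>Hom(1, A)\<close> is one-dimensional,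
  \<open>\<Sum> x\<^sub>j x\<^sup>j\<close> is a multiple of the unit; if the factor is not \<open>0\<close>, rescaling \<open>h\<close> finishes the
  proof (\<open>averaging\<close>).

  The dimension of \<open>A\<close> does not compute this factor directly, since it involves the twist \<open>\<theta>\<close>:
  commutativity of \<open>A\<close> turns it into the factor \<open>\<kappa>\<close> in \<open>\<Sum> \<theta>(x\<^sub>j) x\<^sup>j = \<kappa> 1\<close>. But \<open>\<theta>\<close> is an
  algebra automorphism of \<open>A\<close>, again by commutativity, so
  \<open>\<kappa> a = \<Sum> \<theta>(x\<^sub>j) x\<^sup>j a = \<Sum> \<theta>(a x\<^sub>j) x\<^sup>j = \<kappa> \<theta>(a)\<close>. Hence \<open>\<kappa> \<noteq> 0\<close> forces \<open>\<theta>\<close> to be trivial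
  on \<open>A\<close> (\<open>twist_trivial\<close>), and \<open>\<kappa>\<close> is the factor that was wanted.

  These computations use the functor \<open>T = A \<otimes> -\<close> only. Multiplication, unit, counit and
  copairing of \<open>A\<close> induce natural transformations between powers of \<open>T\<close>, and those compose
  without associativity constraints; the constraints enter only when the laws of \<open>A\<close> are
  translated into laws of the monad \<open>T\<close>, through Kelly's unit lemmas and the pentagon.
\<close>

section \<open>Vector spaces\<close>

text \<open>The image of a basis together with a vector outside the image is linearly independent.\<close>

lemma (in linear_map) dim_less_if_inj_not_surj:
  assumes inj: "inj_on T (carrier V)" and w: "w \<in> carrier W" "w \<notin> T ` carrier V"
    and fin: "V.fin_dim" "W.fin_dim"
  shows "V.dim < W.dim"
proof -
  obtain B where B: "finite B" "V.basis B"
    using V.finite_basis_exists[OF fin(1)] by auto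
  have BV: "B \<subseteq> carrier V" and li: "V.module.lin_indpt B"
    using B(2) by (auto simp: V.basis_def)
  have TB: "T ` B \<subseteq> carrier W" using BV by auto
  have injB: "inj_on T B" using inj BV by (rule inj_on_subset)
  have liT: "W.module.lin_indpt (T ` B)"
  proof (rule W.module.finite_lin_indpt2)
    fix a assume a: "a \<in> T ` B \<rightarrow> carrier K" and 0: "W.module.lincomb a (T ` B) = \<zero>\<^bsub>W\<^esub>"
    have aT: "a \<circ> T \<in> B \<rightarrow> carrier K" using a by auto
    have "T (V.module.lincomb (a \<circ> T) B) = T \<zero>\<^bsub>V\<^esub>"
      using lincomb_linear_image[OF inj BV a B(1)] 0 by simp
    then have "V.module.lincomb (a \<circ> T) B = \<zero>\<^bsub>V\<^esub>"
      by (rule inj_onD[OF inj]) (use V.module.lincomb_closed[OF BV aT] in auto)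
    then have "(a \<circ> T) \<in> B \<rightarrow> {\<zero>\<^bsub>K\<^esub>}"
      using V.not_lindepD[OF li B(1) _ aT] by simp
    then show "\<forall>v\<in>T ` B. a v = \<zero>\<^bsub>K\<^esub>" by auto
  qed (use B TB in auto)
  have "W.module.span (T ` B) \<subseteq> imT"
    using imT_is_subspace BV by (intro W.module.span_is_subset) (auto simp: subspace_def im_def)
  then have "w \<notin> W.module.span (T ` B)"
    using w by (auto simp: im_def)
  moreover have wB: "w \<notin> T ` B" using w BV by auto
  ultimately have "W.module.lin_indpt (T ` B \<union> {w})"
    using W.lin_dep_iff_in_span[OF TB liT w(1)] by simp
  then have "card (T ` B \<union> {w}) \<le> W.dim"
    using TB w by (intro W.li_le_dim[OF fin(2)]) auto
  moreover have "card (T ` B \<union> {w}) = Suc (card B)"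
    using wB B by (simp add: card_image[OF injB])
  moreover have "V.dim = card B"
    using B by (intro V.dim_basis) (auto simp: V.basis_def)
  ultimately show ?thesis by simp
qed

lemma (in vectorspace) dim_one_multiple:
  assumes "fin_dim" "dim = 1" and v: "v \<in> carrier V" "v \<noteq> \<zero>\<^bsub>V\<^esub>" and w: "w \<in> carrier V"
  obtains c where "c \<in> carrier K" "w = c \<odot>\<^bsub>V\<^esub> v"
proof -
  have "lin_indpt {}" by (auto simp: lin_dep_def)
  then have li: "lin_indpt {v}"
    using lin_dep_iff_in_span[of "{}" v] v by (auto simp: span_empty)
  have "w \<in> span {v}"
  proof (rule ccontr)
    assume n: "w \<notin> span {v}"
    then have wv: "w \<noteq> v" using span_mem[of "{v}" v] v by auto
    then have "lin_indpt ({v} \<union> {w})"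
      using lin_dep_iff_in_span[of "{v}" w] li v w n by auto
    then have "card ({v} \<union> {w}) \<le> dim"
      using v w by (intro li_le_dim assms) auto
    then show False using wv assms(2) by simp
  qed
  then obtain a B where B: "B \<subseteq> {v}" "a \<in> B \<rightarrow> carrier K" and wB: "w = lincomb a B"
    unfolding span_def by auto
  show thesis
  proof (cases "B = {}")
    case True
    then have "w = \<zero>\<^bsub>K\<^esub> \<odot>\<^bsub>V\<^esub> v" using wB v by simp
    then show thesis by (rule that[rotated]) simp
  next
    case False
    then have B: "B = {v}" "a v \<in> carrier K" using B by auto
    have "w = a v \<odot>\<^bsub>V\<^esub> v" using wB v B by (simp add: lincomb_def)
    then show thesis by (rule that[rotated]) (rule B)
  qed
qed

section \<open>Linear categories\<close>

context linear_category
begin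

lemma Hom_module: "X \<in> Ob C \<Longrightarrow> Y \<in> Ob C \<Longrightarrow> module class_ring (Hom C X Y)"
  using Hom_vectorspace by (simp add: vectorspace_def)

lemma Hom_group: "X \<in> Ob C \<Longrightarrow> Y \<in> Ob C \<Longrightarrow> abelian_group (Hom C X Y)"
  using Hom_module by (simp add: Module.module_def)

lemma zero_arr: "X \<in> Ob C \<Longrightarrow> Y \<in> Ob C \<Longrightarrow> \<zero>\<^bsub>Hom C X Y\<^esub> \<in> arr C X Y"
  by (rule abelian_monoid.zero_closed[OF abelian_group.axioms(1)[OF Hom_group]])

lemma add_arr: "X \<in> Ob C \<Longrightarrow> Y \<in> Ob C \<Longrightarrow> f \<in> arr C X Y \<Longrightarrow> g \<in> arr C X Y
    \<Longrightarrow> f \<oplus>\<^bsub>Hom C X Y\<^esub> g \<in> arr C X Y"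
  by (rule abelian_monoid.a_closed[OF abelian_group.axioms(1)[OF Hom_group]])

lemma smult_arr: "X \<in> Ob C \<Longrightarrow> Y \<in> Ob C \<Longrightarrow> f \<in> arr C X Y \<Longrightarrow> c \<odot>\<^bsub>Hom C X Y\<^esub> f \<in> arr C X Y"
  using module.smult_closed[OF Hom_module, of X Y c f] by simp

lemma minus_arr: "X \<in> Ob C \<Longrightarrow> Y \<in> Ob C \<Longrightarrow> f \<in> arr C X Y \<Longrightarrow> g \<in> arr C X Y
    \<Longrightarrow> f \<ominus>\<^bsub>Hom C X Y\<^esub> g \<in> arr C X Y"
  by (rule abelian_group.minus_closed[OF Hom_group])

lemma smult_zero: "X \<in> Ob C \<Longrightarrow> Y \<in> Ob C \<Longrightarrow> f \<in> arr C X Y \<Longrightarrow> 0 \<odot>\<^bsub>Hom C X Y\<^esub> f = \<zero>\<^bsub>Hom C X Y\<^esub>"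
  using module.smult_l_null[OF Hom_module, of X Y f] by simp

lemma uminus_eq_smult:
  assumes "X \<in> Ob C" "Y \<in> Ob C" "f \<in> arr C X Y"
  shows "\<ominus>\<^bsub>Hom C X Y\<^esub> f = (-1) \<odot>\<^bsub>Hom C X Y\<^esub> f"
proof -
  interpret abelian_group "Hom C X Y" by (rule Hom_group[OF assms(1,2)])
  have "(-1) \<odot>\<^bsub>Hom C X Y\<^esub> f \<oplus>\<^bsub>Hom C X Y\<^esub> 1 \<odot>\<^bsub>Hom C X Y\<^esub> f = (-1 + 1) \<odot>\<^bsub>Hom C X Y\<^esub> f"
    using module.smult_l_distr[OF Hom_module[OF assms(1,2)], of "-1" 1 f] assms(3) by simp
  then show ?thesis
    using module.smult_one[OF Hom_module[OF assms(1,2)], of f] smult_zero[OF assms] smult_arr[OF assms]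
      assms(3)
    by (intro minus_equality) simp_all
qed

lemma Comp_zero_right: "X \<in> Ob C \<Longrightarrow> Y \<in> Ob C \<Longrightarrow> Z \<in> Ob C \<Longrightarrow> g \<in> arr C Y Z
    \<Longrightarrow> g \<cdot> \<zero>\<^bsub>Hom C X Y\<^esub> = \<zero>\<^bsub>Hom C X Z\<^esub>"
  using Comp_smult_right[of X Y Z "\<zero>\<^bsub>Hom C X Y\<^esub>" g 0]
  by (simp add: zero_arr smult_zero Comp_closed[of X Y Z])

lemma Comp_zero_left: "X \<in> Ob C \<Longrightarrow> Y \<in> Ob C \<Longrightarrow> Z \<in> Ob C \<Longrightarrow> f \<in> arr C X Y
    \<Longrightarrow> \<zero>\<^bsub>Hom C Y Z\<^esub> \<cdot> f = \<zero>\<^bsub>Hom C X Z\<^esub>"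
  using Comp_smult_left[of X Y Z f "\<zero>\<^bsub>Hom C Y Z\<^esub>" 0]
  by (simp add: zero_arr smult_zero Comp_closed[of X Y Z])

lemma Comp_minus_right:
  assumes "X \<in> Ob C" "Y \<in> Ob C" "Z \<in> Ob C" "f \<in> arr C X Y" "g \<in> arr C X Y" "h \<in> arr C Y Z"
  shows "h \<cdot> (f \<ominus>\<^bsub>Hom C X Y\<^esub> g) = (h \<cdot> f) \<ominus>\<^bsub>Hom C X Z\<^esub> (h \<cdot> g)"
  using assms Comp_closed[of X Y Z]
  by (simp add: a_minus_def uminus_eq_smult Comp_add_right smult_arr Comp_smult_right)

lemma Comp_minus_left:
  assumes "X \<in> Ob C" "Y \<in> Ob C" "Z \<in> Ob C" "f \<in> arr C X Y" "g \<in> arr C Y Z" "h \<in> arr C Y Z"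
  shows "(g \<ominus>\<^bsub>Hom C Y Z\<^esub> h) \<cdot> f = (g \<cdot> f) \<ominus>\<^bsub>Hom C X Z\<^esub> (h \<cdot> f)"
  using assms Comp_closed[of X Y Z]
  by (simp add: a_minus_def uminus_eq_smult Comp_add_left smult_arr Comp_smult_left)

lemma minus_self: "X \<in> Ob C \<Longrightarrow> Y \<in> Ob C \<Longrightarrow> f \<in> arr C X Y \<Longrightarrow> f \<ominus>\<^bsub>Hom C X Y\<^esub> f = \<zero>\<^bsub>Hom C X Y\<^esub>"
  using abelian_group.r_neg[OF Hom_group] by (simp add: a_minus_def)

lemma minus_zero:
  assumes "X \<in> Ob C" "Y \<in> Ob C" "f \<in> arr C X Y"
  shows "f \<ominus>\<^bsub>Hom C X Y\<^esub> \<zero>\<^bsub>Hom C X Y\<^esub> = f"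
proof -
  interpret abelian_group "Hom C X Y" by (rule Hom_group[OF assms(1,2)])
  show ?thesis using assms(3) by (simp add: a_minus_def)
qed

lemma add_minus:
  assumes "X \<in> Ob C" "Y \<in> Ob C" "f \<in> arr C X Y" "g \<in> arr C X Y"
  shows "g \<oplus>\<^bsub>Hom C X Y\<^esub> (f \<ominus>\<^bsub>Hom C X Y\<^esub> g) = f"
proof -
  interpret abelian_group "Hom C X Y" by (rule Hom_group[OF assms(1,2)])
  show ?thesis using assms(3,4)
    by (metis a_minus_def a_comm a_assoc a_inv_closed l_neg r_zero minus_closed)
qed

lemma zero_object_iff:
  assumes X: "X \<in> Ob C"
  shows "zero_object C X \<longleftrightarrow> Ident C X = \<zero>\<^bsub>Hom C X X\<^esub>"
proof
  assume "zero_object C X"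
  then show "Ident C X = \<zero>\<^bsub>Hom C X X\<^esub>"
    using Ident_closed[OF X] zero_arr[OF X X] X unfolding zero_object_def by metis
next
  assume I: "Ident C X = \<zero>\<^bsub>Hom C X X\<^esub>"
  have "f = \<zero>\<^bsub>Hom C W X\<^esub>" if "W \<in> Ob C" "f \<in> arr C W X" for W f
    using Comp_Ident_left[of W X f] Comp_zero_left[of W X X f] that X I by simp
  moreover have "f = \<zero>\<^bsub>Hom C X W\<^esub>" if "W \<in> Ob C" "f \<in> arr C X W" for W f
    using Comp_Ident_right[of X W f] Comp_zero_right[of X X W f] that X I by simp
  ultimately show "zero_object C X"
    unfolding zero_object_def using X zero_arr by metis
qed

definition idem_splits :: "'o \<Rightarrow> 'm \<Rightarrow> bool" where
  "idem_splits X e \<longleftrightarrow> (\<exists>K\<in>Ob C. \<exists>i\<in>arr C K X. \<exists>p\<in>arr C X K. p \<cdot> i = Ident C K \<and> i \<cdot> p = e)"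

definition regular :: "'o \<Rightarrow> 'o \<Rightarrow> 'm \<Rightarrow> bool" where
  "regular X Y f \<longleftrightarrow> (\<exists>g\<in>arr C Y X. f \<cdot> (g \<cdot> f) = f)"

lemma complement_idem:
  assumes X: "X \<in> Ob C" and e: "e \<in> arr C X X" "e \<cdot> e = e"
  defines "d \<equiv> Ident C X \<ominus>\<^bsub>Hom C X X\<^esub> e"
  shows "d \<in> arr C X X" "d \<cdot> d = d" "d \<cdot> e = \<zero>\<^bsub>Hom C X X\<^esub>" "e \<cdot> d = \<zero>\<^bsub>Hom C X X\<^esub>"
proof -
  note I = Ident_closed[OF X]
  show d: "d \<in> arr C X X" unfolding d_def using X I e(1) by (intro minus_arr)
  show ed: "e \<cdot> d = \<zero>\<^bsub>Hom C X X\<^esub>" and de: "d \<cdot> e = \<zero>\<^bsub>Hom C X X\<^esub>"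
    unfolding d_def using X I e
    by (simp_all add: Comp_minus_left Comp_minus_right Comp_Ident_left[of X X] Comp_Ident_right[of X X] minus_self)
  have "d \<cdot> d = d \<cdot> Ident C X \<ominus>\<^bsub>Hom C X X\<^esub> d \<cdot> e"
    using Comp_minus_right[OF X X X I e(1) d] by (simp add: d_def)
  then show "d \<cdot> d = d"
    using X d by (simp add: de minus_zero Comp_Ident_right[of X X])
qed

lemma regular_mono_retract:
  assumes X: "X \<in> Ob C" and Y: "Y \<in> Ob C" and f: "is_mono C X Y f"
    and g: "g \<in> arr C Y X" "f \<cdot> (g \<cdot> f) = f"
  shows "g \<cdot> f = Ident C X"
proof -
  have fa: "f \<in> arr C X Y" using f by (simp add: is_mono_def)
  have "f \<cdot> (g \<cdot> f) = f \<cdot> Ident C X" using g fa X Y by (simp add: Comp_Ident_right)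
  then show ?thesis
    using f X Y g fa Ident_closed[OF X] Comp_closed[OF X Y X fa g(1)] by (auto simp: is_mono_def)
qed

lemma regular_epi_section:
  assumes X: "X \<in> Ob C" and Y: "Y \<in> Ob C" and f: "is_epi C X Y f"
    and g: "g \<in> arr C Y X" "f \<cdot> (g \<cdot> f) = f"
  shows "f \<cdot> g = Ident C Y"
proof -
  have fa: "f \<in> arr C X Y" using f by (simp add: is_epi_def)
  have "(f \<cdot> g) \<cdot> f = Ident C Y \<cdot> f"
    using g fa X Y by (simp add: Comp_Ident_left Comp_assoc[of X Y X Y])
  then show ?thesis
    using f X Y g fa Ident_closed[OF Y] Comp_closed[OF Y X Y g(1) fa] by (auto simp: is_epi_def)
qed

lemma retract_is_mono:
  assumes X: "X \<in> Ob C" and Y: "Y \<in> Ob C" and f: "f \<in> arr C X Y" and g: "g \<in> arr C Y X"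
    and gf: "g \<cdot> f = Ident C X" and W: "W \<in> Ob C" and h: "h \<in> arr C W X" "k \<in> arr C W X"
    and eq: "f \<cdot> h = f \<cdot> k"
  shows "h = k"
proof -
  have "g \<cdot> (f \<cdot> l) = l" if "l \<in> arr C W X" for l
    unfolding Comp_assoc[OF W X Y X that f g, symmetric] gf using W X that by (rule Comp_Ident_left)
  from this[OF h(1)] this[OF h(2)] show ?thesis unfolding eq by (rule trans[OF sym])
qed

lemma section_is_epi:
  assumes X: "X \<in> Ob C" and Y: "Y \<in> Ob C" and f: "f \<in> arr C X Y" and g: "g \<in> arr C Y X"
    and fg: "f \<cdot> g = Ident C Y" and W: "W \<in> Ob C" and h: "h \<in> arr C Y W" "k \<in> arr C Y W"
    and eq: "h \<cdot> f = k \<cdot> f"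
  shows "h = k"
proof -
  have "(l \<cdot> f) \<cdot> g = l" if "l \<in> arr C Y W" for l
    unfolding Comp_assoc[OF Y X Y W g f that] fg using Y W that by (rule Comp_Ident_right)
  from this[OF h(1)] this[OF h(2)] show ?thesis unfolding eq by (rule trans[OF sym])
qed

text \<open>If \<open>f g f = f\<close> then \<open>f h = 0\<close> is equivalent to \<open>(1 - g f) h = h\<close>, so the image of the idempotent
  \<open>1 - g f\<close> is the kernel of \<open>f\<close>. The next lemma is the dual statement.\<close>

lemma kernel_of_split_idem:
  assumes X: "X \<in> Ob C" and Y: "Y \<in> Ob C" and f: "f \<in> arr C X Y" and g: "g \<in> arr C Y X"
    and fgf: "f \<cdot> (g \<cdot> f) = f"
    and K: "K \<in> Ob C" and i: "i \<in> arr C K X" and p: "p \<in> arr C X K" and pi: "p \<cdot> i = Ident C K"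
    and ip: "i \<cdot> p = Ident C X \<ominus>\<^bsub>Hom C X X\<^esub> (g \<cdot> f)"
  shows "is_kernel C X Y f K i"
  unfolding is_kernel_def
proof (intro conjI ballI impI)
  have gf: "g \<cdot> f \<in> arr C X X" using X Y X f g by (rule Comp_closed)
  have I: "Ident C X \<in> arr C X X" using X by (rule Ident_closed)
  have "f \<cdot> (i \<cdot> p) = \<zero>\<^bsub>Hom C X Y\<^esub>"
    unfolding ip using X Y f gf I fgf by (simp add: Comp_minus_right Comp_Ident_right minus_self)
  then have "f \<cdot> (i \<cdot> p) \<cdot> i = \<zero>\<^bsub>Hom C X Y\<^esub> \<cdot> i" by simp
  moreover have "f \<cdot> (i \<cdot> p) \<cdot> i = f \<cdot> i"
    using Comp_assoc[of K X X Y i "i \<cdot> p" f] Comp_assoc[of K X K X i p i] Comp_closed[of X K X p i]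
      X Y K f i p pi by (simp add: Comp_Ident_right)
  ultimately show "f \<cdot> i = \<zero>\<^bsub>Hom C K Y\<^esub>"
    using Comp_zero_left[of K X Y i] X Y K i by simp
  fix W h assume W: "W \<in> Ob C" and h: "h \<in> arr C W X" and fh: "f \<cdot> h = \<zero>\<^bsub>Hom C W Y\<^esub>"
  have "(g \<cdot> f) \<cdot> h = \<zero>\<^bsub>Hom C W X\<^esub>"
    using Comp_assoc[OF W X Y X h f g] fh Comp_zero_right[OF W Y X g] by simp
  then have "(i \<cdot> p) \<cdot> h = h"
    unfolding ip using X W h gf I by (simp add: Comp_minus_left[of W X X] Comp_Ident_left[of W X] minus_zero)
  then have e: "i \<cdot> (p \<cdot> h) = h" using Comp_assoc[OF W X K X h p i] by simp
  show "\<exists>!k. k \<in> arr C W K \<and> i \<cdot> k = h"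
  proof (rule ex1I[of _ "p \<cdot> h"])
    show "p \<cdot> h \<in> arr C W K \<and> i \<cdot> (p \<cdot> h) = h"
      using Comp_closed[OF W X K h p] e by simp
    fix k assume "k \<in> arr C W K \<and> i \<cdot> k = h"
    then show "k = p \<cdot> h"
      using retract_is_mono[OF K X i p pi W, of k "p \<cdot> h"] Comp_closed[OF W X K h p] e by simp
  qed
qed (rule K, rule i)

lemma cokernel_of_split_idem:
  assumes X: "X \<in> Ob C" and Y: "Y \<in> Ob C" and f: "f \<in> arr C X Y" and g: "g \<in> arr C Y X"
    and fgf: "f \<cdot> (g \<cdot> f) = f"
    and Q: "Q \<in> Ob C" and i: "i \<in> arr C Q Y" and p: "p \<in> arr C Y Q" and pi: "p \<cdot> i = Ident C Q"
    and ip: "i \<cdot> p = Ident C Y \<ominus>\<^bsub>Hom C Y Y\<^esub> (f \<cdot> g)"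
  shows "is_cokernel C X Y f Q p"
  unfolding is_cokernel_def
proof (intro conjI ballI impI)
  have fg: "f \<cdot> g \<in> arr C Y Y" using Y X Y g f by (rule Comp_closed)
  have I: "Ident C Y \<in> arr C Y Y" using Y by (rule Ident_closed)
  have "(f \<cdot> g) \<cdot> f = f" using Comp_assoc[OF X Y X Y f g f] fgf by simp
  then have "(i \<cdot> p) \<cdot> f = \<zero>\<^bsub>Hom C X Y\<^esub>"
    unfolding ip using X Y f fg I by (simp add: Comp_minus_left Comp_Ident_left minus_self)
  then have "p \<cdot> ((i \<cdot> p) \<cdot> f) = p \<cdot> \<zero>\<^bsub>Hom C X Y\<^esub>" by simp
  moreover have "p \<cdot> ((i \<cdot> p) \<cdot> f) = p \<cdot> f"
    using Comp_assoc[of X Y Q Y f p i] Comp_assoc[of X Q Y Q "p \<cdot> f" i p] Comp_closed[of X Y Q f p]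
      X Y Q f i p pi by (simp add: Comp_Ident_left)
  ultimately show "p \<cdot> f = \<zero>\<^bsub>Hom C X Q\<^esub>"
    using Comp_zero_right[of X Y Q p] X Y Q p by simp
  fix W h assume W: "W \<in> Ob C" and h: "h \<in> arr C Y W" and hf: "h \<cdot> f = \<zero>\<^bsub>Hom C X W\<^esub>"
  have "h \<cdot> (f \<cdot> g) = \<zero>\<^bsub>Hom C Y W\<^esub>"
    using Comp_assoc[OF Y X Y W g f h] hf Comp_zero_left[OF Y X W g] by simp
  then have "h \<cdot> (i \<cdot> p) = h"
    unfolding ip using Y W h fg I by (simp add: Comp_minus_right[of Y Y W] Comp_Ident_right[of Y W] minus_zero)
  then have e: "(h \<cdot> i) \<cdot> p = h" using Comp_assoc[OF Y Q Y W p i h] by simp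
  show "\<exists>!k. k \<in> arr C Q W \<and> k \<cdot> p = h"
  proof (rule ex1I[of _ "h \<cdot> i"])
    show "h \<cdot> i \<in> arr C Q W \<and> (h \<cdot> i) \<cdot> p = h"
      using Comp_closed[OF Q Y W i h] e by simp
    fix k assume "k \<in> arr C Q W \<and> k \<cdot> p = h"
    then show "k = h \<cdot> i"
      using section_is_epi[OF Y Q p i pi W, of k "h \<cdot> i"] Comp_closed[OF Q Y W i h] e by simp
  qed
qed (rule Q, rule p)

lemma minus_minus_self:
  assumes "X \<in> Ob C" "Y \<in> Ob C" "f \<in> arr C X Y" "g \<in> arr C X Y"
  shows "f \<ominus>\<^bsub>Hom C X Y\<^esub> (f \<ominus>\<^bsub>Hom C X Y\<^esub> g) = g"
proof -
  interpret abelian_group "Hom C X Y" by (rule Hom_group[OF assms(1,2)])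
  show ?thesis using assms(3,4)
    by (simp add: a_minus_def minus_add a_assoc[symmetric] r_neg)
qed

lemma minus_eq_zero:
  assumes "X \<in> Ob C" "Y \<in> Ob C" "f \<in> arr C X Y" "g \<in> arr C X Y"
    "f \<ominus>\<^bsub>Hom C X Y\<^esub> g = \<zero>\<^bsub>Hom C X Y\<^esub>"
  shows "f = g"
  using add_minus[OF assms(1-4)] assms(5) assms(4)
    abelian_monoid.r_zero[OF abelian_group.axioms(1)[OF Hom_group[OF assms(1,2)]]] by simp

lemma finsum_zero:
  assumes "X \<in> Ob C" "Y \<in> Ob C" "\<And>k. k \<in> A \<Longrightarrow> f k = \<zero>\<^bsub>Hom C X Y\<^esub>"
  shows "finsum (Hom C X Y) f A = \<zero>\<^bsub>Hom C X Y\<^esub>"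
proof -
  interpret abelian_group "Hom C X Y" by (rule Hom_group[OF assms(1,2)])
  have "finsum (Hom C X Y) f A = finsum (Hom C X Y) (\<lambda>_. \<zero>\<^bsub>Hom C X Y\<^esub>) A"
    using assms(3) by (intro finsum_cong') auto
  then show ?thesis by simp
qed

lemma Comp_finsum_right:
  assumes X: "X \<in> Ob C" and Y: "Y \<in> Ob C" and Z: "Z \<in> Ob C" and h: "h \<in> arr C Y Z"
    and "finite A" "\<And>k. k \<in> A \<Longrightarrow> f k \<in> arr C X Y"
  shows "h \<cdot> finsum (Hom C X Y) f A = finsum (Hom C X Z) (\<lambda>k. h \<cdot> f k) A"
  using assms(5,6)
proof (induction A rule: finite_induct)
  case empty
  then show ?case
    using Comp_zero_right[OF X Y Z h] Hom_group[OF X Y] Hom_group[OF X Z]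
    by (simp add: abelian_group_def abelian_monoid.finsum_empty)
next
  case (insert k A)
  interpret XY: abelian_group "Hom C X Y" by (rule Hom_group[OF X Y])
  interpret XZ: abelian_group "Hom C X Z" by (rule Hom_group[OF X Z])
  have fk: "f \<in> A \<rightarrow> arr C X Y" "f k \<in> arr C X Y" using insert by auto
  have hf: "(\<lambda>k. h \<cdot> f k) \<in> A \<rightarrow> arr C X Z" "h \<cdot> f k \<in> arr C X Z"
    using fk Comp_closed[OF X Y Z _ h] by auto
  show ?case
    using insert fk hf XY.finsum_closed[OF fk(1)] Comp_add_right[OF X Y Z fk(2) XY.finsum_closed[OF fk(1)] h]
    by (simp add: XY.finsum_insert XZ.finsum_insert)
qed

lemma Comp_finsum_left:
  assumes X: "X \<in> Ob C" and Y: "Y \<in> Ob C" and Z: "Z \<in> Ob C" and h: "h \<in> arr C X Y"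
    and "finite A" "\<And>k. k \<in> A \<Longrightarrow> f k \<in> arr C Y Z"
  shows "finsum (Hom C Y Z) f A \<cdot> h = finsum (Hom C X Z) (\<lambda>k. f k \<cdot> h) A"
  using assms(5,6)
proof (induction A rule: finite_induct)
  case empty
  then show ?case
    using Comp_zero_left[OF X Y Z h] Hom_group[OF Y Z] Hom_group[OF X Z]
    by (simp add: abelian_group_def abelian_monoid.finsum_empty)
next
  case (insert k A)
  interpret YZ: abelian_group "Hom C Y Z" by (rule Hom_group[OF Y Z])
  interpret XZ: abelian_group "Hom C X Z" by (rule Hom_group[OF X Z])
  have fk: "f \<in> A \<rightarrow> arr C Y Z" "f k \<in> arr C Y Z" using insert by auto
  have hf: "(\<lambda>k. f k \<cdot> h) \<in> A \<rightarrow> arr C X Z" "f k \<cdot> h \<in> arr C X Z"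
    using fk Comp_closed[OF X Y Z h] by auto
  show ?case
    using insert fk hf YZ.finsum_closed[OF fk(1)] Comp_add_left[OF X Y Z h fk(2) YZ.finsum_closed[OF fk(1)]]
    by (simp add: YZ.finsum_insert XZ.finsum_insert)
qed

lemma Comp_finsum_both:
  assumes Y: "Y \<in> Ob C" and X: "X \<in> Ob C" and a: "a \<in> arr C Y X" and b: "b \<in> arr C X Y"
    and A: "finite A" and f: "\<And>k. k \<in> A \<Longrightarrow> f k \<in> arr C Y Y"
  shows "(a \<cdot> finsum (Hom C Y Y) f A) \<cdot> b = finsum (Hom C X X) (\<lambda>k. (a \<cdot> f k) \<cdot> b) A"
proof -
  have "(a \<cdot> finsum (Hom C Y Y) f A) \<cdot> b = finsum (Hom C Y X) (\<lambda>k. a \<cdot> f k) A \<cdot> b"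
    by (subst Comp_finsum_right[OF Y Y X a A]) (use f in auto)
  also have "\<dots> = finsum (Hom C X X) (\<lambda>k. (a \<cdot> f k) \<cdot> b) A"
    by (rule Comp_finsum_left[OF X Y X b A]) (rule Comp_closed[OF Y Y X f a])
  finally show ?thesis .
qed

lemma direct_sum_Nil: "X \<in> Ob C \<Longrightarrow> zero_object C X \<Longrightarrow> direct_sum C [] X"
  by (simp add: direct_sum_def zero_object_iff
      abelian_monoid.finsum_empty[OF abelian_group.axioms(1)[OF Hom_group]])

lemma direct_sum_single:
  assumes X: "X \<in> Ob C"
  shows "direct_sum C [X] X"
proof -
  interpret abelian_group "Hom C X X" by (rule Hom_group[OF X X])
  note I = Ident_closed[OF X]
  have "Ident C X = finsum (Hom C X X) (\<lambda>k. Ident C X \<cdot> Ident C X) {..<Suc 0}"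
    using I X by (simp add: lessThan_Suc Comp_Ident_left[of X X] finsum_insert)
  then show ?thesis
    unfolding direct_sum_def using X I
    by (intro conjI exI[of _ "\<lambda>_. Ident C X"]) (auto simp: Comp_Ident_left[of X X])
qed

lemma Comp_assoc4:
  assumes "V \<in> Ob C" "W \<in> Ob C" "X \<in> Ob C" "Y \<in> Ob C" "Z \<in> Ob C"
    "f \<in> arr C V W" "g \<in> arr C W X" "h \<in> arr C X Y" "k \<in> arr C Y Z"
  shows "(k \<cdot> h) \<cdot> (g \<cdot> f) = k \<cdot> ((h \<cdot> g) \<cdot> f)"
  using Comp_assoc[of V X Y Z "g \<cdot> f" h k] Comp_assoc[of V W X Y f g h] Comp_closed[of V W X f g] assms
  by simp

text \<open>Splitting an object into two summands and these further into lists refines to one list; the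
  work is the bookkeeping of indices in the orthogonality relations and in the finite sum.\<close>

lemma direct_sum_append:
  assumes DY: "direct_sum C Ys Y" and DZ: "direct_sum C Zs Z" and X: "X \<in> Ob C"
    and a: "a \<in> arr C Y X" and b: "b \<in> arr C X Y" and c: "c \<in> arr C Z X" and d: "d \<in> arr C X Z"
    and ba: "b \<cdot> a = Ident C Y" and dc: "d \<cdot> c = Ident C Z"
    and bc: "b \<cdot> c = \<zero>\<^bsub>Hom C Z Y\<^esub>" and da: "d \<cdot> a = \<zero>\<^bsub>Hom C Y Z\<^esub>"
    and sum: "(a \<cdot> b) \<oplus>\<^bsub>Hom C X X\<^esub> (c \<cdot> d) = Ident C X"
  shows "direct_sum C (Ys @ Zs) X"
proof -
  let ?n = "length Ys" and ?m = "length Zs"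
  have Y: "Y \<in> Ob C" and Z: "Z \<in> Ob C" using DY DZ by (auto simp: direct_sum_def)
  have Ys: "Ys ! k \<in> Ob C" if "k < ?n" for k using DY that by (auto simp: direct_sum_def)
  have Zs: "Zs ! k \<in> Ob C" if "k < ?m" for k using DZ that by (auto simp: direct_sum_def)
  obtain i p where i: "\<And>k. k < ?n \<Longrightarrow> i k \<in> arr C (Ys ! k) Y" and p: "\<And>k. k < ?n \<Longrightarrow> p k \<in> arr C Y (Ys ! k)"
    and pi: "\<And>k l. k < ?n \<Longrightarrow> l < ?n \<Longrightarrow> p k \<cdot> i l =
        (if k = l then Ident C (Ys ! k) else \<zero>\<^bsub>Hom C (Ys ! l) (Ys ! k)\<^esub>)"
    and ip: "Ident C Y = finsum (Hom C Y Y) (\<lambda>k. i k \<cdot> p k) {..<?n}"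
    using DY unfolding direct_sum_def by blast
  obtain j q where j: "\<And>k. k < ?m \<Longrightarrow> j k \<in> arr C (Zs ! k) Z" and q: "\<And>k. k < ?m \<Longrightarrow> q k \<in> arr C Z (Zs ! k)"
    and qj: "\<And>k l. k < ?m \<Longrightarrow> l < ?m \<Longrightarrow> q k \<cdot> j l =
        (if k = l then Ident C (Zs ! k) else \<zero>\<^bsub>Hom C (Zs ! l) (Zs ! k)\<^esub>)"
    and jq: "Ident C Z = finsum (Hom C Z Z) (\<lambda>k. j k \<cdot> q k) {..<?m}"
    using DZ unfolding direct_sum_def by blast
  define I where "I k = (if k < ?n then a \<cdot> i k else c \<cdot> j (k - ?n))" for k
  define P where "P k = (if k < ?n then p k \<cdot> b else q (k - ?n) \<cdot> d)" for k
  have ai: "a \<cdot> i k \<in> arr C (Ys ! k) X" and pb: "p k \<cdot> b \<in> arr C X (Ys ! k)" if "k < ?n" for k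
    using Comp_closed[OF Ys[OF that] Y X i[OF that] a] Comp_closed[OF X Y Ys[OF that] b p[OF that]] by auto
  have cj: "c \<cdot> j k \<in> arr C (Zs ! k) X" and qd: "q k \<cdot> d \<in> arr C X (Zs ! k)" if "k < ?m" for k
    using Comp_closed[OF Zs[OF that] Z X j[OF that] c] Comp_closed[OF X Z Zs[OF that] d q[OF that]] by auto
  have types: "I k \<in> arr C ((Ys @ Zs) ! k) X \<and> P k \<in> arr C X ((Ys @ Zs) ! k)"
    if "k < length (Ys @ Zs)" for k
    using that ai cj pb qd by (auto simp: I_def P_def nth_append)
  have orth: "P k \<cdot> I l =
        (if k = l then Ident C ((Ys @ Zs) ! k) else \<zero>\<^bsub>Hom C ((Ys @ Zs) ! l) ((Ys @ Zs) ! k)\<^esub>)"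
    if k: "k < length (Ys @ Zs)" and l: "l < length (Ys @ Zs)" for k l
  proof -
    consider "k < ?n" "l < ?n" | "k < ?n" "\<not> l < ?n" | "\<not> k < ?n" "l < ?n" | "\<not> k < ?n" "\<not> l < ?n" by blast
    then show ?thesis
    proof cases
      case 1
      then show ?thesis
        using Comp_assoc4[OF Ys[OF 1(2)] Y X Y Ys[OF 1(1)] i[OF 1(2)] a b p[OF 1(1)]] pi[OF 1]
          Comp_Ident_left[OF Ys[OF 1(2)] Y i[OF 1(2)]]
        by (simp add: I_def P_def nth_append ba)
    next
      case 2
      then have l': "l - ?n < ?m" using l by simp
      show ?thesis
        using 2 Comp_assoc4[OF Zs[OF l'] Z X Y Ys[OF 2(1)] j[OF l'] c b p[OF 2(1)]]
          Comp_zero_left[OF Zs[OF l'] Z Y j[OF l']] Comp_zero_right[OF Zs[OF l'] Y Ys[OF 2(1)] p[OF 2(1)]]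
        by (auto simp add: I_def P_def nth_append bc)
    next
      case 3
      then have k': "k - ?n < ?m" using k by simp
      show ?thesis
        using 3 Comp_assoc4[OF Ys[OF 3(2)] Y X Z Zs[OF k'] i[OF 3(2)] a d q[OF k']]
          Comp_zero_left[OF Ys[OF 3(2)] Y Z i[OF 3(2)]] Comp_zero_right[OF Ys[OF 3(2)] Z Zs[OF k'] q[OF k']]
        by (auto simp add: I_def P_def nth_append da)
    next
      case 4
      then have k': "k - ?n < ?m" and l': "l - ?n < ?m" using k l by simp_all
      have "k - ?n = l - ?n \<longleftrightarrow> k = l" using 4 by auto
      then show ?thesis
        using 4 Comp_assoc4[OF Zs[OF l'] Z X Z Zs[OF k'] j[OF l'] c d q[OF k']] qj[OF k' l']
          Comp_Ident_left[OF Zs[OF l'] Z j[OF l']]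
        by (simp add: I_def P_def nth_append dc)
    qed
  qed
  interpret XX: abelian_group "Hom C X X" by (rule Hom_group[OF X X])
  have IP: "I k \<cdot> P k \<in> arr C X X" if "k < ?n + ?m" for k
    using types[of k] that Comp_closed[of X "(Ys @ Zs) ! k" X "P k" "I k"] X Ys Zs
    by (auto simp: nth_append)
  have ab: "a \<cdot> b = finsum (Hom C X X) (\<lambda>k. I k \<cdot> P k) {..<?n}"
  proof -
    have "a \<cdot> b = (a \<cdot> Ident C Y) \<cdot> b" using Comp_Ident_right[OF Y X a] by simp
    also have "\<dots> = finsum (Hom C X X) (\<lambda>k. (a \<cdot> (i k \<cdot> p k)) \<cdot> b) {..<?n}"
      unfolding ip by (rule Comp_finsum_both[OF Y X a b]) (use Comp_closed[OF Y Ys Y p i] in auto)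
    also have "\<dots> = finsum (Hom C X X) (\<lambda>k. I k \<cdot> P k) {..<?n}"
    proof (rule XX.finsum_cong')
      fix k assume "k \<in> {..<?n}"
      then have k: "k < ?n" by simp
      show "(a \<cdot> (i k \<cdot> p k)) \<cdot> b = I k \<cdot> P k"
        using Comp_assoc[OF Y Ys[OF k] Y X p[OF k] i[OF k] a]
          Comp_assoc[OF X Y Ys[OF k] X b p[OF k] ai[OF k]] k by (simp add: I_def P_def)
    qed (use IP in auto)
    finally show ?thesis .
  qed
  have cd: "c \<cdot> d = finsum (Hom C X X) (\<lambda>k. I (?n + k) \<cdot> P (?n + k)) {..<?m}"
  proof -
    have "c \<cdot> d = (c \<cdot> Ident C Z) \<cdot> d" using Comp_Ident_right[OF Z X c] by simp
    also have "\<dots> = finsum (Hom C X X) (\<lambda>k. (c \<cdot> (j k \<cdot> q k)) \<cdot> d) {..<?m}"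
      unfolding jq by (rule Comp_finsum_both[OF Z X c d]) (use Comp_closed[OF Z Zs Z q j] in auto)
    also have "\<dots> = finsum (Hom C X X) (\<lambda>k. I (?n + k) \<cdot> P (?n + k)) {..<?m}"
    proof (rule XX.finsum_cong')
      fix k assume "k \<in> {..<?m}"
      then have k: "k < ?m" by simp
      show "(c \<cdot> (j k \<cdot> q k)) \<cdot> d = I (?n + k) \<cdot> P (?n + k)"
        using Comp_assoc[OF Z Zs[OF k] Z X q[OF k] j[OF k] c]
          Comp_assoc[OF X Z Zs[OF k] X d q[OF k] cj[OF k]] k by (simp add: I_def P_def)
    qed (use IP in auto)
    finally show ?thesis .
  qed
  have "finsum (Hom C X X) (\<lambda>k. I k \<cdot> P k) ({..<?n} \<union> (\<lambda>k. ?n + k) ` {..<?m})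
      = finsum (Hom C X X) (\<lambda>k. I k \<cdot> P k) {..<?n} \<oplus>\<^bsub>Hom C X X\<^esub> finsum (Hom C X X) (\<lambda>k. I k \<cdot> P k) ((\<lambda>k. ?n + k) ` {..<?m})"
    by (rule XX.finsum_Un_disjoint) (use IP in auto)
  also have "finsum (Hom C X X) (\<lambda>k. I k \<cdot> P k) ((\<lambda>k. ?n + k) ` {..<?m}) = c \<cdot> d"
    unfolding cd by (rule XX.finsum_reindex) (use IP in \<open>auto simp: inj_on_def\<close>)
  also have "{..<?n} \<union> (\<lambda>k. ?n + k) ` {..<?m} = {..<length (Ys @ Zs)}"
    by (auto simp: image_iff) (metis add_diff_inverse_nat add_less_cancel_left lessThan_iff)
  finally have "Ident C X = finsum (Hom C X X) (\<lambda>k. I k \<cdot> P k) {..<length (Ys @ Zs)}"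
    using sum ab by simp
  moreover have "set (Ys @ Zs) \<subseteq> Ob C" using DY DZ by (auto simp: direct_sum_def)
  ultimately show ?thesis
    unfolding direct_sum_def using X types orth by blast
qed

end

lemma (in linear_category) direct_sum_pairE:
  assumes "direct_sum C [X, Y] S"
  obtains a b c d where "X \<in> Ob C" "Y \<in> Ob C" "S \<in> Ob C"
    "a \<in> arr C X S" "b \<in> arr C S X" "c \<in> arr C Y S" "d \<in> arr C S Y"
    "b \<cdot> a = Ident C X" "d \<cdot> c = Ident C Y" "b \<cdot> c = \<zero>\<^bsub>Hom C Y X\<^esub>" "d \<cdot> a = \<zero>\<^bsub>Hom C X Y\<^esub>"
    "(a \<cdot> b) \<oplus>\<^bsub>Hom C S S\<^esub> (c \<cdot> d) = Ident C S"
proof -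
  have len: "length [X, Y] = 2" by simp
  have o: "X \<in> Ob C" "Y \<in> Ob C" "S \<in> Ob C" using assms by (auto simp: direct_sum_def)
  obtain i p where i: "\<And>k. k < 2 \<Longrightarrow> i k \<in> arr C ([X, Y] ! k) S" and p: "\<And>k. k < 2 \<Longrightarrow> p k \<in> arr C S ([X, Y] ! k)"
    and pi: "\<And>k l. k < 2 \<Longrightarrow> l < 2 \<Longrightarrow> p k \<cdot> i l =
        (if k = l then Ident C ([X, Y] ! k) else \<zero>\<^bsub>Hom C ([X, Y] ! l) ([X, Y] ! k)\<^esub>)"
    and ip: "Ident C S = finsum (Hom C S S) (\<lambda>k. i k \<cdot> p k) {..<2}"
    using assms unfolding direct_sum_def len by blast
  have t: "i 0 \<in> arr C X S" "p 0 \<in> arr C S X" "i (Suc 0) \<in> arr C Y S" "p (Suc 0) \<in> arr C S Y"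
    using i[of 0] i[of 1] p[of 0] p[of 1] by simp_all
  interpret abelian_group "Hom C S S" by (rule Hom_group[OF o(3,3)])
  have ips: "i 0 \<cdot> p 0 \<in> arr C S S" "i (Suc 0) \<cdot> p (Suc 0) \<in> arr C S S"
    using Comp_closed[OF o(3) o(1) o(3) t(2) t(1)] Comp_closed[OF o(3) o(2) o(3) t(4) t(3)] by simp_all
  have two: "{..<2} = {Suc 0, 0}" by auto
  have "Ident C S = i 0 \<cdot> p 0 \<oplus>\<^bsub>Hom C S S\<^esub> i (Suc 0) \<cdot> p (Suc 0)"
    unfolding ip two using ips a_comm by (subst finsum_insert) (auto simp: finsum_insert)
  then show thesis
    using that[OF o t] pi[of 0 0] pi[of 1 1] pi[of 0 1] pi[of 1 0] by simp
qed

lemma (in linear_category) inverse_arr_arr_inv: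
  assumes X: "X \<in> Ob C" and Y: "Y \<in> Ob C" and f: "is_iso C X Y f"
  shows "inverse_arr C X Y f (arr_inv C X Y f)"
proof -
  obtain g where g: "inverse_arr C X Y f g" using f by (auto simp: is_iso_def)
  have "h = g" if h: "inverse_arr C X Y f h" for h
  proof -
    have fa: "f \<in> arr C X Y" and ga: "g \<in> arr C Y X" and ha: "h \<in> arr C Y X" and gf: "g \<cdot> f = Ident C X"
      and fh: "f \<cdot> h = Ident C Y"
      using g h by (auto simp: inverse_arr_def)
    show "h = g"
      using Comp_assoc[OF Y X Y X ha fa ga] Comp_Ident_left[OF Y X ha] Comp_Ident_right[OF Y X ga] gf fh
      by simp
  qed
  then show ?thesis unfolding arr_inv_def using g by (rule theI[of _ g, rotated])
qed

lemma (in linear_category) kernel_is_mono: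
  assumes X: "X \<in> Ob C" and Y: "Y \<in> Ob C" and f: "f \<in> arr C X Y" and ker: "is_kernel C X Y f K k"
  shows "is_mono C K X k"
  unfolding is_mono_def
proof (intro conjI ballI impI)
  have K: "K \<in> Ob C" and k: "k \<in> arr C K X" and fk: "f \<cdot> k = \<zero>\<^bsub>Hom C K Y\<^esub>"
    using ker by (auto simp: is_kernel_def)
  show "k \<in> arr C K X" by (rule k)
  fix W g h assume W: "W \<in> Ob C" and g: "g \<in> arr C W K" and h: "h \<in> arr C W K" and eq: "k \<cdot> g = k \<cdot> h"
  have kg: "k \<cdot> g \<in> arr C W X" by (rule Comp_closed[OF W K X g k])
  have "f \<cdot> (k \<cdot> g) = \<zero>\<^bsub>Hom C W Y\<^esub>"
    using Comp_assoc[OF W K X Y g k f] fk Comp_zero_left[OF W K Y g] by simp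
  then have "\<exists>!l. l \<in> arr C W K \<and> k \<cdot> l = k \<cdot> g"
    using ker W kg unfolding is_kernel_def by blast
  then show "g = h" using g h eq by metis
qed

text \<open>If \<open>Y\<close> is a retract of \<open>X\<close> via \<open>p i = 1\<close>, then \<open>f \<mapsto> i f p\<close> embeds \<open>End(Y)\<close> into \<open>End(X)\<close>, and
  its image contains the identity only if \<open>i p = 1\<close>. This makes the dimension of \<open>End\<close> a
  size that decreases along proper retracts.\<close>

lemma (in linear_category) dim_End_less:
  assumes fin: "\<And>X. X \<in> Ob C \<Longrightarrow> vectorspace.fin_dim class_ring (Hom C X X)"
    and X: "X \<in> Ob C" and Y: "Y \<in> Ob C" and i: "i \<in> arr C Y X" and p: "p \<in> arr C X Y"
    and pi: "p \<cdot> i = Ident C Y" and ip: "i \<cdot> p \<noteq> Ident C X"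
  shows "vectorspace.dim class_ring (Hom C Y Y) < vectorspace.dim class_ring (Hom C X X)"
proof -
  define F where "F = (\<lambda>f. i \<cdot> (f \<cdot> p))"
  have fp: "f \<cdot> p \<in> arr C X Y" if "f \<in> arr C Y Y" for f by (rule Comp_closed[OF X Y Y p that])
  have Fa: "F f \<in> arr C X X" if "f \<in> arr C Y Y" for f
    unfolding F_def by (rule Comp_closed[OF X Y X fp[OF that] i])
  have lin: "linear_map class_ring (Hom C Y Y) (Hom C X X) F"
  proof (intro linear_map.intro mod_hom.intro mod_hom_axioms.intro Hom_vectorspace Hom_module X Y)
    show "F \<in> LinearCombinations.module_hom class_ring (Hom C Y Y) (Hom C X X)"
      using Fa fp Comp_add_left[OF X Y Y p] Comp_add_right[OF X Y X fp fp i]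
        Comp_smult_left[OF X Y Y p] Comp_smult_right[OF X Y X fp i]
      by (auto simp: LinearCombinations.module_hom_def F_def)
  qed
  have inj: "inj_on F (arr C Y Y)"
  proof (rule inj_onI)
    fix f g assume f: "f \<in> arr C Y Y" and g: "g \<in> arr C Y Y" and "F f = F g"
    then have "f \<cdot> p = g \<cdot> p"
      using retract_is_mono[OF Y X i p pi X fp[OF f] fp[OF g]] by (simp add: F_def)
    then show "f = g" by (rule section_is_epi[OF X Y p i pi Y f g])
  qed
  have "Ident C X \<notin> F ` arr C Y Y"
  proof
    assume "Ident C X \<in> F ` arr C Y Y"
    then obtain f where f: "f \<in> arr C Y Y" and 1: "Ident C X = F f" by auto
    have ipa: "i \<cdot> p \<in> arr C X X" by (rule Comp_closed[OF X Y X p i])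
    have "(i \<cdot> p) \<cdot> F f = i \<cdot> ((p \<cdot> i) \<cdot> (f \<cdot> p))"
      unfolding F_def by (rule Comp_assoc4[OF X Y X Y X fp[OF f] i p i])
    also have "\<dots> = F f"
      unfolding F_def pi Comp_Ident_left[OF X Y fp[OF f]] ..
    finally show False
      unfolding 1[symmetric] Comp_Ident_right[OF X X ipa] using ip by simp
  qed
  then show ?thesis
    using linear_map.dim_less_if_inj_not_surj[OF lin inj Ident_closed[OF X]] fin[OF X] fin[OF Y] by blast
qed

section \<open>Quasi-inverses make a linear category semisimple\<close>

text \<open>The size is a parameter rather than the dimension of an endomorphism space because for modules
  the size of the underlying object serves as well, so that finite-dimensionality has to be
  known in the base category only.\<close>

locale regular_linear_category = linear_category C
  for C :: "('o, 'm, 'e) lincat_scheme" (structure) +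
  fixes size :: "'o \<Rightarrow> nat"
  assumes ex_zero: "\<exists>Z. zero_object C Z"
    and ex_biproduct: "\<lbrakk>X \<in> Ob C; Y \<in> Ob C\<rbrakk> \<Longrightarrow> \<exists>S. direct_sum C [X, Y] S"
    and all_idem_split: "\<lbrakk>X \<in> Ob C; e \<in> arr C X X; e \<cdot> e = e\<rbrakk> \<Longrightarrow> idem_splits X e"
    and all_regular: "\<lbrakk>X \<in> Ob C; Y \<in> Ob C; f \<in> arr C X Y\<rbrakk> \<Longrightarrow> regular X Y f"
    and size_less: "\<lbrakk>X \<in> Ob C; Y \<in> Ob C; i \<in> arr C Y X; p \<in> arr C X Y;
      p \<cdot> i = Ident C Y; i \<cdot> p \<noteq> Ident C X\<rbrakk> \<Longrightarrow> size Y < size X"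
begin

lemma split_complement:
  assumes X: "X \<in> Ob C" and e: "e \<in> arr C X X" "e \<cdot> e = e"
  obtains K i p where "K \<in> Ob C" "i \<in> arr C K X" "p \<in> arr C X K" "p \<cdot> i = Ident C K"
    "i \<cdot> p = Ident C X \<ominus>\<^bsub>Hom C X X\<^esub> e"
  using all_idem_split[OF X complement_idem(1,2)[OF X e]] unfolding idem_splits_def by blast

lemma quasi_inverse:
  assumes X: "X \<in> Ob C" and Y: "Y \<in> Ob C" and f: "f \<in> arr C X Y"
  obtains g where "g \<in> arr C Y X" "f \<cdot> (g \<cdot> f) = f"
    "g \<cdot> f \<in> arr C X X" "(g \<cdot> f) \<cdot> (g \<cdot> f) = g \<cdot> f" "f \<cdot> g \<in> arr C Y Y" "(f \<cdot> g) \<cdot> (f \<cdot> g) = f \<cdot> g"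
proof -
  obtain g where g: "g \<in> arr C Y X" and fgf: "f \<cdot> (g \<cdot> f) = f"
    using all_regular[OF X Y f] unfolding regular_def by blast
  have gf: "g \<cdot> f \<in> arr C X X" by (rule Comp_closed[OF X Y X f g])
  have fg: "f \<cdot> g \<in> arr C Y Y" by (rule Comp_closed[OF Y X Y g f])
  have "(g \<cdot> f) \<cdot> (g \<cdot> f) = g \<cdot> f"
    using Comp_assoc[OF X X Y X gf f g] fgf by simp
  moreover have "(f \<cdot> g) \<cdot> (f \<cdot> g) = f \<cdot> g"
    using Comp_assoc[OF Y X Y Y g f fg] Comp_assoc[OF X Y X Y f g f] fgf
      Comp_assoc[OF Y Y X Y fg g f] Comp_assoc[OF Y X Y X g f g] Comp_assoc[OF Y X X Y g gf f]
    by simp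
  ultimately show thesis using that g fgf gf fg by blast
qed

sublocale abelian_category C
proof unfold_locales
  show "\<exists>Z. zero_object C Z" by (rule ex_zero)
  show "\<exists>S. direct_sum C [X, Y] S" if "X \<in> Ob C" "Y \<in> Ob C" for X Y
    using that by (rule ex_biproduct)
  fix X Y f
  assume X: "X \<in> Ob C" and Y: "Y \<in> Ob C"
  {
    assume f: "f \<in> arr C X Y"
    obtain g where g: "g \<in> arr C Y X" "f \<cdot> (g \<cdot> f) = f"
        "g \<cdot> f \<in> arr C X X" "(g \<cdot> f) \<cdot> (g \<cdot> f) = g \<cdot> f" "f \<cdot> g \<in> arr C Y Y" "(f \<cdot> g) \<cdot> (f \<cdot> g) = f \<cdot> g"
      by (rule quasi_inverse[OF X Y f])
    show "\<exists>K k. is_kernel C X Y f K k"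
      using split_complement[OF X g(3,4)] kernel_of_split_idem[OF X Y f g(1,2)] by metis
    show "\<exists>Q q. is_cokernel C X Y f Q q"
      using split_complement[OF Y g(5,6)] cokernel_of_split_idem[OF X Y f g(1,2)] by metis
  next
    assume m: "is_mono C X Y f"
    then have f: "f \<in> arr C X Y" by (simp add: is_mono_def)
    obtain g where g: "g \<in> arr C Y X" "f \<cdot> (g \<cdot> f) = f"
        "g \<cdot> f \<in> arr C X X" "(g \<cdot> f) \<cdot> (g \<cdot> f) = g \<cdot> f" "f \<cdot> g \<in> arr C Y Y" "(f \<cdot> g) \<cdot> (f \<cdot> g) = f \<cdot> g"
      by (rule quasi_inverse[OF X Y f])
    define d where "d = Ident C Y \<ominus>\<^bsub>Hom C Y Y\<^esub> (f \<cdot> g)"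
    note d = complement_idem(1,2)[OF Y g(5,6), folded d_def]
    have Id: "Ident C Y \<cdot> d = d" using Comp_Ident_left[OF Y Y d(1)] .
    \<comment> \<open>since \<open>1 - d = f g\<close>, the map \<open>f\<close> is the image of the complement of \<open>d\<close>; the identity is a
      quasi-inverse of the idempotent \<open>d\<close>\<close>
    have "is_kernel C Y Y d X f"
    proof (rule kernel_of_split_idem[OF Y Y d(1) Ident_closed[OF Y] _ X f g(1)])
      show "g \<cdot> f = Ident C X" by (rule regular_mono_retract[OF X Y m g(1,2)])
      show "f \<cdot> g = Ident C Y \<ominus>\<^bsub>Hom C Y Y\<^esub> (Ident C Y \<cdot> d)"
        unfolding Id unfolding d_def by (rule minus_minus_self[OF Y Y Ident_closed[OF Y] g(5), symmetric])
    qed (simp add: Id d)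
    then show "\<exists>Z\<in>Ob C. \<exists>g\<in>arr C Y Z. is_kernel C Y Z g X f"
      using Y d(1) by blast
  next
    assume m: "is_epi C X Y f"
    then have f: "f \<in> arr C X Y" by (simp add: is_epi_def)
    obtain g where g: "g \<in> arr C Y X" "f \<cdot> (g \<cdot> f) = f"
        "g \<cdot> f \<in> arr C X X" "(g \<cdot> f) \<cdot> (g \<cdot> f) = g \<cdot> f" "f \<cdot> g \<in> arr C Y Y" "(f \<cdot> g) \<cdot> (f \<cdot> g) = f \<cdot> g"
      by (rule quasi_inverse[OF X Y f])
    define d where "d = Ident C X \<ominus>\<^bsub>Hom C X X\<^esub> (g \<cdot> f)"
    note d = complement_idem(1,2)[OF X g(3,4), folded d_def]
    have Id: "d \<cdot> Ident C X = d" "Ident C X \<cdot> d = d"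
      using Comp_Ident_right[OF X X d(1)] Comp_Ident_left[OF X X d(1)] by auto
    have "is_cokernel C X X d Y f"
    proof (rule cokernel_of_split_idem[OF X X d(1) Ident_closed[OF X] _ Y g(1) f])
      show "f \<cdot> g = Ident C Y" by (rule regular_epi_section[OF X Y m g(1,2)])
      show "g \<cdot> f = Ident C X \<ominus>\<^bsub>Hom C X X\<^esub> (d \<cdot> Ident C X)"
        unfolding Id unfolding d_def by (rule minus_minus_self[OF X X Ident_closed[OF X] g(3), symmetric])
    qed (simp add: Id d)
    then show "\<exists>W\<in>Ob C. \<exists>g\<in>arr C W X. is_cokernel C W X g Y f"
      using X d(1) by blast
  }
qed

text \<open>A nonzero object that is not simple has a proper nonzero subobject. It is a retract, so the
  object is the sum of it and of the image of the complementary idempotent, and both are smaller.\<close>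

lemma sum_of_simples:
  "X \<in> Ob C \<Longrightarrow> \<exists>Xs. (\<forall>S\<in>set Xs. simple_object C S) \<and> direct_sum C Xs X"
proof (induction "size X" arbitrary: X rule: less_induct)
  case (less X)
  note X = \<open>X \<in> Ob C\<close>
  show ?case
  proof (cases "zero_object C X \<or> simple_object C X")
    case True
    then show ?thesis
    proof
      assume "zero_object C X"
      then show ?thesis using direct_sum_Nil[OF X] by (intro exI[of _ "[]"]) simp
    next
      assume "simple_object C X"
      then show ?thesis using direct_sum_single[OF X] by (intro exI[of _ "[X]"]) simp
    qed
  next
    case False
    then obtain Y f where Y: "Y \<in> Ob C" and m: "is_mono C Y X f" and nz: "\<not> zero_object C Y"
      and ni: "\<not> is_iso C Y X f"
      using X by (auto simp: simple_object_def)
    have f: "f \<in> arr C Y X" using m by (simp add: is_mono_def)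
    obtain g where g: "g \<in> arr C X Y" "f \<cdot> (g \<cdot> f) = f"
        "g \<cdot> f \<in> arr C Y Y" "(g \<cdot> f) \<cdot> (g \<cdot> f) = g \<cdot> f" "f \<cdot> g \<in> arr C X X" "(f \<cdot> g) \<cdot> (f \<cdot> g) = f \<cdot> g"
      by (rule quasi_inverse[OF Y X f])
    have gf: "g \<cdot> f = Ident C Y" by (rule regular_mono_retract[OF Y X m g(1,2)])
    have fg1: "f \<cdot> g \<noteq> Ident C X"
      using ni f g(1) gf by (auto simp: is_iso_def inverse_arr_def)
    obtain Z i p where Z: "Z \<in> Ob C" and i: "i \<in> arr C Z X" and p: "p \<in> arr C X Z"
      and pi: "p \<cdot> i = Ident C Z" and ip: "i \<cdot> p = Ident C X \<ominus>\<^bsub>Hom C X X\<^esub> (f \<cdot> g)"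
      by (rule split_complement[OF X g(5,6)])
    have IX: "Ident C X \<in> arr C X X" by (rule Ident_closed[OF X])
    have ipa: "i \<cdot> p \<in> arr C X X" by (rule Comp_closed[OF X Z X p i])
    have ip_fg: "(i \<cdot> p) \<cdot> (f \<cdot> g) = \<zero>\<^bsub>Hom C X X\<^esub>" and fg_ip: "(f \<cdot> g) \<cdot> (i \<cdot> p) = \<zero>\<^bsub>Hom C X X\<^esub>"
      using complement_idem(3,4)[OF X g(5,6)] ip by simp_all
    have ip1: "i \<cdot> p \<noteq> Ident C X"
    proof
      assume 1: "i \<cdot> p = Ident C X"
      have fg0: "f \<cdot> g = \<zero>\<^bsub>Hom C X X\<^esub>" using ip_fg Comp_Ident_left[OF X X g(5)] unfolding 1 by simp
      have "f \<cdot> (g \<cdot> f) = \<zero>\<^bsub>Hom C Y X\<^esub>"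
        using Comp_assoc[OF Y X Y X f g(1) f] Comp_zero_left[OF Y X X f] fg0 by simp
      then have "g \<cdot> f = g \<cdot> \<zero>\<^bsub>Hom C Y X\<^esub>" using g(2) by simp
      then have "Ident C Y = \<zero>\<^bsub>Hom C Y Y\<^esub>" using gf Comp_zero_right[OF Y X Y g(1)] by simp
      then show False using nz zero_object_iff[OF Y] by simp
    qed
    obtain Ys where Ys: "\<forall>S\<in>set Ys. simple_object C S" "direct_sum C Ys Y"
      using less.hyps[OF size_less[OF X Y f g(1) gf fg1] Y] by blast
    obtain Zs where Zs: "\<forall>S\<in>set Zs. simple_object C S" "direct_sum C Zs Z"
      using less.hyps[OF size_less[OF X Z i p pi ip1] Z] by blast
    have "direct_sum C (Ys @ Zs) X"
    proof (rule direct_sum_append[OF Ys(2) Zs(2) X f g(1) i p gf pi])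
      show "f \<cdot> g \<oplus>\<^bsub>Hom C X X\<^esub> i \<cdot> p = Ident C X"
        unfolding ip by (rule add_minus[OF X X IX g(5)])
          \<comment> \<open>the mixed composites vanish because the complementary idempotents are orthogonal, \<open>f\<close> and \<open>i\<close>
        are split monomorphisms and \<open>g\<close> and \<open>p\<close> split epimorphisms\<close>
      have gi: "g \<cdot> i \<in> arr C Z Y" by (rule Comp_closed[OF Z X Y i g(1)])
      have "f \<cdot> ((g \<cdot> i) \<cdot> p) = f \<cdot> ((\<zero>\<^bsub>Hom C Z Y\<^esub>) \<cdot> p)"
        using Comp_assoc4[OF X Z X Y X p i g(1) f] fg_ip Comp_zero_left[OF X Z Y p] Comp_zero_right[OF X Y X f]
        by simp
      then have "(g \<cdot> i) \<cdot> p = \<zero>\<^bsub>Hom C Z Y\<^esub> \<cdot> p"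
        by (rule retract_is_mono[OF Y X f g(1) gf X, rotated 2])
          (use Comp_closed[OF X Z Y p] gi zero_arr[OF Z Y] in auto)
      then show "g \<cdot> i = \<zero>\<^bsub>Hom C Z Y\<^esub>"
        by (rule section_is_epi[OF X Z p i pi Y, rotated 2]) (use gi zero_arr[OF Z Y] in auto)
      have pf: "p \<cdot> f \<in> arr C Y Z" by (rule Comp_closed[OF Y X Z f p])
      have "i \<cdot> ((p \<cdot> f) \<cdot> g) = i \<cdot> ((\<zero>\<^bsub>Hom C Y Z\<^esub>) \<cdot> g)"
        using Comp_assoc4[OF X Y X Z X g(1) f p i] ip_fg Comp_zero_left[OF X Y Z g(1)] Comp_zero_right[OF X Z X i]
        by simp
      then have "(p \<cdot> f) \<cdot> g = \<zero>\<^bsub>Hom C Y Z\<^esub> \<cdot> g"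
        by (rule retract_is_mono[OF Z X i p pi X, rotated 2])
          (use Comp_closed[OF X Y Z g(1)] pf zero_arr[OF Y Z] in auto)
      then show "p \<cdot> f = \<zero>\<^bsub>Hom C Y Z\<^esub>"
        by (rule section_is_epi[OF X Y g(1) f gf Z, rotated 2]) (use pf zero_arr[OF Y Z] in auto)
    qed
    then show ?thesis using Ys(1) Zs(1) by (intro exI[of _ "Ys @ Zs"]) auto
  qed
qed

lemma semisimple_category: "semisimple_category C"
  by unfold_locales (rule sum_of_simples)

end

section \<open>Semisimple categories have quasi-inverses\<close>

text \<open>Elimination step: \<open>f - f x f\<close> equals both \<open>f (1 - x f)\<close> and \<open>(1 - f x) f\<close>, so a quasi-inverse \<open>h\<close>
  of it yields the quasi-inverse \<open>x + (1 - x f) h (1 - f x)\<close> of \<open>f\<close>.\<close>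

lemma (in linear_category) regular_reduce:
  assumes X: "X \<in> Ob C" and Y: "Y \<in> Ob C" and f: "f \<in> arr C X Y" and x: "x \<in> arr C Y X"
    and reg: "regular X Y (f \<ominus>\<^bsub>Hom C X Y\<^esub> f \<cdot> (x \<cdot> f))"
  shows "regular X Y f"
proof -
  define f' where "f' = f \<ominus>\<^bsub>Hom C X Y\<^esub> f \<cdot> (x \<cdot> f)"
  obtain h where h: "h \<in> arr C Y X" and fhf: "f' \<cdot> (h \<cdot> f') = f'"
    using reg by (auto simp: regular_def f'_def)
  define u where "u = Ident C X \<ominus>\<^bsub>Hom C X X\<^esub> x \<cdot> f"
  define v where "v = Ident C Y \<ominus>\<^bsub>Hom C Y Y\<^esub> f \<cdot> x"
  have xf: "x \<cdot> f \<in> arr C X X" by (rule Comp_closed[OF X Y X f x])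
  have fx: "f \<cdot> x \<in> arr C Y Y" by (rule Comp_closed[OF Y X Y x f])
  have fxf: "f \<cdot> (x \<cdot> f) \<in> arr C X Y" by (rule Comp_closed[OF X X Y xf f])
  note IX = Ident_closed[OF X] and IY = Ident_closed[OF Y]
  have u: "u \<in> arr C X X" unfolding u_def by (rule minus_arr[OF X X IX xf])
  have v: "v \<in> arr C Y Y" unfolding v_def by (rule minus_arr[OF Y Y IY fx])
  have fu: "f' = f \<cdot> u"
    unfolding f'_def u_def Comp_minus_right[OF X X Y IX xf f] Comp_Ident_right[OF X Y f] ..
  have vf: "f' = v \<cdot> f"
    unfolding f'_def v_def Comp_minus_left[OF X Y Y f IY fx] Comp_Ident_left[OF X Y f]
      Comp_assoc[OF X Y X Y f x f] ..
  have uh: "u \<cdot> h \<in> arr C Y X" by (rule Comp_closed[OF Y X X h u])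
  define y where "y = (u \<cdot> h) \<cdot> v"
  have y: "y \<in> arr C Y X" unfolding y_def by (rule Comp_closed[OF Y Y X v uh])
  have f': "f' \<in> arr C X Y" unfolding f'_def by (rule minus_arr[OF X Y f fxf])
  have "y \<cdot> f = u \<cdot> (h \<cdot> f')"
    unfolding y_def Comp_assoc[OF X Y Y X f v uh] vf[symmetric] by (rule Comp_assoc[OF X Y X X f' h u])
  then have "f \<cdot> (y \<cdot> f) = f'"
    using Comp_assoc[OF X X X Y Comp_closed[OF X Y X f' h] u f] fhf fu by simp
  then have "f \<cdot> ((x \<oplus>\<^bsub>Hom C Y X\<^esub> y) \<cdot> f) = f \<cdot> (x \<cdot> f) \<oplus>\<^bsub>Hom C X Y\<^esub> f'"
    unfolding Comp_add_left[OF X Y X f x y]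
    using Comp_add_right[OF X X Y xf Comp_closed[OF X Y X f y] f] by simp
  also have "\<dots> = f" unfolding f'_def by (rule add_minus[OF X Y f fxf])
  finally show ?thesis unfolding regular_def using add_arr[OF Y X x y] by blast
qed

text \<open>The image of an idempotent \<open>e\<close> is the kernel of \<open>1 - e\<close>.\<close>

lemma (in abelian_category) idem_splits_abelian:
  assumes X: "X \<in> Ob C" and e: "e \<in> arr C X X" "e \<cdot> e = e"
  shows "idem_splits X e"
proof -
  define d where "d = Ident C X \<ominus>\<^bsub>Hom C X X\<^esub> e"
  note d = complement_idem[OF X e, folded d_def]
  obtain K k where ker: "is_kernel C X X d K k" using ex_kernel[OF X X d(1)] by blast
  then have K: "K \<in> Ob C" and k: "k \<in> arr C K X" and dk: "d \<cdot> k = \<zero>\<^bsub>Hom C K X\<^esub>"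
    by (auto simp: is_kernel_def)
  obtain p where p: "p \<in> arr C X K" and kp: "k \<cdot> p = e"
    using ker X e(1) d(3) unfolding is_kernel_def by blast
  have ek: "e \<cdot> k \<in> arr C K X" by (rule Comp_closed[OF K X X k e(1)])
  have "k \<ominus>\<^bsub>Hom C K X\<^esub> e \<cdot> k = \<zero>\<^bsub>Hom C K X\<^esub>"
    using dk Comp_minus_left[OF K X X k Ident_closed[OF X] e(1)] Comp_Ident_left[OF K X k]
    by (simp add: d_def)
  then have "k = e \<cdot> k" by (rule minus_eq_zero[OF K X k ek])
  then have "k \<cdot> (p \<cdot> k) = k \<cdot> Ident C K"
    using Comp_assoc[OF K X K X k p k] kp Comp_Ident_right[OF K X k] by simp
  then have "p \<cdot> k = Ident C K"
    using kernel_is_mono[OF X X d(1) ker] K Comp_closed[OF K X K k p] Ident_closed[OF K]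
    unfolding is_mono_def by blast
  then show ?thesis using K k p kp unfolding idem_splits_def by blast
qed

text \<open>The kernel of a nonzero map out of a simple object is zero, so the map is a monomorphism into
  a simple object.\<close>

lemma (in abelian_category) schur:
  assumes S: "simple_object C S" and T: "simple_object C T" and f: "f \<in> arr C S T"
    and nz: "f \<noteq> \<zero>\<^bsub>Hom C S T\<^esub>"
  obtains u where "u \<in> arr C T S" "u \<cdot> f = Ident C S" "f \<cdot> u = Ident C T"
proof -
  have So: "S \<in> Ob C" and To: "T \<in> Ob C" using S T by (auto simp: simple_object_def)
  obtain K k where ker: "is_kernel C S T f K k" using ex_kernel[OF So To f] by blast
  then have K: "K \<in> Ob C" and k: "k \<in> arr C K S" and fk: "f \<cdot> k = \<zero>\<^bsub>Hom C K T\<^esub>"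
    by (auto simp: is_kernel_def)
  have "\<not> is_iso C K S k"
  proof
    assume "is_iso C K S k"
    then obtain g where g: "g \<in> arr C S K" "k \<cdot> g = Ident C S" by (auto simp: is_iso_def inverse_arr_def)
    have "f = (f \<cdot> k) \<cdot> g"
      using Comp_assoc[OF So K So To g(1) k f] g(2) Comp_Ident_right[OF So To f] by simp
    then show False using nz fk Comp_zero_left[OF So K To g(1)] by simp
  qed
  then have zK: "zero_object C K"
    using S K kernel_is_mono[OF So To f ker] by (auto simp: simple_object_def)
  have "is_mono C S T f"
    unfolding is_mono_def
  proof (intro conjI ballI impI)
    fix W g h assume W: "W \<in> Ob C" and g: "g \<in> arr C W S" and h: "h \<in> arr C W S" and eq: "f \<cdot> g = f \<cdot> h"
    have gh: "g \<ominus>\<^bsub>Hom C W S\<^esub> h \<in> arr C W S" by (rule minus_arr[OF W So g h])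
    have "f \<cdot> (g \<ominus>\<^bsub>Hom C W S\<^esub> h) = \<zero>\<^bsub>Hom C W T\<^esub>"
      unfolding Comp_minus_right[OF W So To g h f] eq
      by (rule minus_self[OF W To Comp_closed[OF W So To h f]])
    then obtain l where l: "l \<in> arr C W K" "k \<cdot> l = g \<ominus>\<^bsub>Hom C W S\<^esub> h"
      using ker W gh unfolding is_kernel_def by blast
    have "l = \<zero>\<^bsub>Hom C W K\<^esub>"
      using zK W l(1) zero_arr[OF W K] unfolding zero_object_def by blast
    then have "g \<ominus>\<^bsub>Hom C W S\<^esub> h = \<zero>\<^bsub>Hom C W S\<^esub>"
      using l(2) Comp_zero_right[OF W K So k] by simp
    then show "g = h" by (rule minus_eq_zero[OF W So g h])
  qed (rule f)
  then have "is_iso C S T f"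
    using T S So unfolding simple_object_def by blast
  then show thesis using that by (auto simp: is_iso_def inverse_arr_def)
qed

text \<open>Gaussian elimination on the matrix of \<open>f\<close> with respect to decompositions into simple objects:
  by Schur's lemma a nonzero entry is invertible, and using it as a pivot in \<open>regular_reduce\<close>
  kills the column of the pivot without touching the columns that are already zero. The induction
  is on the number of nonzero columns.\<close>

lemma (in semisimple_category) regular_semisimple:
  assumes X: "X \<in> Ob C" and Y: "Y \<in> Ob C" and f: "f \<in> arr C X Y"
  shows "regular X Y f"
proof -
  obtain Xs where Xs: "\<forall>S\<in>set Xs. simple_object C S" "direct_sum C Xs X"
    using semisimple[OF X] by blast
  obtain Ys where Ys: "\<forall>S\<in>set Ys. simple_object C S" "direct_sum C Ys Y"
    using semisimple[OF Y] by blast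
  let ?n = "length Xs" and ?m = "length Ys"
  obtain i p where i: "\<And>k. k < ?n \<Longrightarrow> i k \<in> arr C (Xs ! k) X" and p: "\<And>k. k < ?n \<Longrightarrow> p k \<in> arr C X (Xs ! k)"
    and ip: "Ident C X = finsum (Hom C X X) (\<lambda>k. i k \<cdot> p k) {..<?n}"
    using Xs(2) unfolding direct_sum_def by blast
  obtain j q where j: "\<And>k. k < ?m \<Longrightarrow> j k \<in> arr C (Ys ! k) Y" and q: "\<And>k. k < ?m \<Longrightarrow> q k \<in> arr C Y (Ys ! k)"
    and jq: "Ident C Y = finsum (Hom C Y Y) (\<lambda>k. j k \<cdot> q k) {..<?m}"
    using Ys(2) unfolding direct_sum_def by blast
  have S: "simple_object C (Xs ! k)" "Xs ! k \<in> Ob C" if "k < ?n" for k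
    using Xs(1) that by (auto simp: simple_object_def)
  have T: "simple_object C (Ys ! k)" "Ys ! k \<in> Ob C" if "k < ?m" for k
    using Ys(1) that by (auto simp: simple_object_def)
  define supp where "supp f = {k. k < ?n \<and> f \<cdot> i k \<noteq> \<zero>\<^bsub>Hom C (Xs ! k) Y\<^esub>}" for f
  show ?thesis using f
  proof (induction "card (supp f)" arbitrary: f rule: less_induct)
    case (less f)
    note f = \<open>f \<in> arr C X Y\<close>
    show ?case
    proof (cases "supp f = {}")
      case True
      have "f = f \<cdot> Ident C X" using Comp_Ident_right[OF X Y f] by simp
      also have "\<dots> = finsum (Hom C X Y) (\<lambda>k. f \<cdot> (i k \<cdot> p k)) {..<?n}"
        unfolding ip by (rule Comp_finsum_right[OF X X Y f]) (use Comp_closed[OF X S(2) X p i] in auto)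
      also have "\<dots> = \<zero>\<^bsub>Hom C X Y\<^esub>"
      proof (rule finsum_zero[OF X Y])
        fix k assume "k \<in> {..<?n}"
        then have k: "k < ?n" by simp
        have "f \<cdot> i k = \<zero>\<^bsub>Hom C (Xs ! k) Y\<^esub>" using True k by (auto simp: supp_def)
        then show "f \<cdot> (i k \<cdot> p k) = \<zero>\<^bsub>Hom C X Y\<^esub>"
          using Comp_assoc[OF X S(2)[OF k] X Y p[OF k] i[OF k] f] Comp_zero_left[OF X S(2)[OF k] Y p[OF k]]
          by simp
      qed
      finally have f0: "f = \<zero>\<^bsub>Hom C X Y\<^esub>" .
      show ?thesis
        unfolding regular_def f0 using zero_arr[OF X Y] zero_arr[OF Y X]
          Comp_zero_left[OF X X Y] Comp_closed[OF X Y X]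
        by (intro bexI[of _ "\<zero>\<^bsub>Hom C Y X\<^esub>"]) auto
    next
      case False
      then obtain k where k: "k < ?n" and fk: "f \<cdot> i k \<noteq> \<zero>\<^bsub>Hom C (Xs ! k) Y\<^esub>"
        by (auto simp: supp_def)
      let ?S = "Xs ! k"
      note S = S[OF k] and ik = i[OF k]
      have fi: "f \<cdot> i k \<in> arr C ?S Y" by (rule Comp_closed[OF S(2) X Y ik f])
      have "\<exists>l<?m. q l \<cdot> (f \<cdot> i k) \<noteq> \<zero>\<^bsub>Hom C ?S (Ys ! l)\<^esub>"
      proof (rule ccontr)
        assume none: "\<not> ?thesis"
        have "f \<cdot> i k = Ident C Y \<cdot> (f \<cdot> i k)" using Comp_Ident_left[OF S(2) Y fi] by simp
        also have "\<dots> = finsum (Hom C ?S Y) (\<lambda>l. (j l \<cdot> q l) \<cdot> (f \<cdot> i k)) {..<?m}"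
          unfolding jq by (rule Comp_finsum_left[OF S(2) Y Y fi]) (use Comp_closed[OF Y T(2) Y q j] in auto)
        also have "\<dots> = \<zero>\<^bsub>Hom C ?S Y\<^esub>"
        proof (rule finsum_zero[OF S(2) Y])
          fix l assume "l \<in> {..<?m}"
          then have l: "l < ?m" by simp
          then have "q l \<cdot> (f \<cdot> i k) = \<zero>\<^bsub>Hom C ?S (Ys ! l)\<^esub>" using none by blast
          then show "(j l \<cdot> q l) \<cdot> (f \<cdot> i k) = \<zero>\<^bsub>Hom C ?S Y\<^esub>"
            using Comp_assoc[OF S(2) Y T(2)[OF l] Y fi q[OF l] j[OF l]]
              Comp_zero_right[OF S(2) T(2)[OF l] Y j[OF l]] by simp
        qed
        finally show False using fk by simp
      qed
      then obtain l where l: "l < ?m" and ne: "q l \<cdot> (f \<cdot> i k) \<noteq> \<zero>\<^bsub>Hom C ?S (Ys ! l)\<^esub>" by blast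
      note T = T[OF l] and ql = q[OF l]
      have qfi: "q l \<cdot> (f \<cdot> i k) \<in> arr C ?S (Ys ! l)" by (rule Comp_closed[OF S(2) Y T(2) fi ql])
      obtain u where u: "u \<in> arr C (Ys ! l) ?S" "u \<cdot> (q l \<cdot> (f \<cdot> i k)) = Ident C ?S"
        using schur[OF S(1) T(1) qfi ne] by blast
      have uq: "u \<cdot> q l \<in> arr C Y ?S" by (rule Comp_closed[OF Y T(2) S(2) ql u(1)])
      define x where "x = i k \<cdot> (u \<cdot> q l)"
      have x: "x \<in> arr C Y X" unfolding x_def by (rule Comp_closed[OF Y S(2) X uq ik])
      have xfi: "x \<cdot> (f \<cdot> i k) = i k"
        unfolding x_def Comp_assoc[OF S(2) Y S(2) X fi uq ik] Comp_assoc[OF S(2) Y T(2) S(2) fi ql u(1)] u(2)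
        by (rule Comp_Ident_right[OF S(2) X ik])
      have xf: "x \<cdot> f \<in> arr C X X" by (rule Comp_closed[OF X Y X f x])
      have fxf: "f \<cdot> (x \<cdot> f) \<in> arr C X Y" by (rule Comp_closed[OF X X Y xf f])
      define f' where "f' = f \<ominus>\<^bsub>Hom C X Y\<^esub> f \<cdot> (x \<cdot> f)"
      have f': "f' \<in> arr C X Y" unfolding f'_def by (rule minus_arr[OF X Y f fxf])
      have f'i: "f' \<cdot> i n = f \<cdot> i n \<ominus>\<^bsub>Hom C (Xs ! n) Y\<^esub> f \<cdot> (x \<cdot> (f \<cdot> i n))" if n: "n < ?n" for n
      proof -
        have So: "Xs ! n \<in> Ob C" using Xs(1) n by (auto simp: simple_object_def)
        show ?thesis
          unfolding f'_def Comp_minus_left[OF So X Y i[OF n] f fxf]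
            Comp_assoc[OF So X X Y i[OF n] xf f] Comp_assoc[OF So X Y X i[OF n] f x] ..
      qed
      have "f' \<cdot> i k = \<zero>\<^bsub>Hom C ?S Y\<^esub>"
        unfolding f'i[OF k] xfi by (rule minus_self[OF S(2) Y fi])
      then have "k \<notin> supp f'" by (simp add: supp_def)
      moreover have "supp f' \<subseteq> supp f"
      proof
        fix n assume n': "n \<in> supp f'"
        then have n: "n < ?n" by (simp add: supp_def)
        have So: "Xs ! n \<in> Ob C" using Xs(1) n by (auto simp: simple_object_def)
        show "n \<in> supp f"
        proof (rule ccontr)
          assume "n \<notin> supp f"
          then have 0: "f \<cdot> i n = \<zero>\<^bsub>Hom C (Xs ! n) Y\<^esub>" using n by (simp add: supp_def)
          have "f' \<cdot> i n = \<zero>\<^bsub>Hom C (Xs ! n) Y\<^esub>"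
            unfolding f'i[OF n] 0 Comp_zero_right[OF So Y X x] Comp_zero_right[OF So X Y f]
            by (rule minus_zero[OF So Y zero_arr[OF So Y]])
          then show False using n' by (simp add: supp_def)
        qed
      qed
      moreover have "k \<in> supp f" using k fk by (simp add: supp_def)
      moreover have "finite (supp f)" by (simp add: supp_def)
      ultimately have "card (supp f') < card (supp f)" by (intro psubset_card_mono) auto
      then have "regular X Y f'" using less.hyps f' by blast
      then show ?thesis unfolding f'_def by (rule regular_reduce[OF X Y f x])
    qed
  qed
qed

section \<open>Categories with total composition\<close>

text \<open>A category in which every arrow determines its domain and codomain and composition is a total
  operation, meaningful only on composable arrows. Types of arrows are then computed by
  rewriting, which makes long compositions tractable; with Hom sets that may overlap, the
  intermediate objects would have to be supplied by hand.\<close>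

locale arrows =
  fixes ob :: "'x \<Rightarrow> bool" and ar :: "'a \<Rightarrow> bool" and dom cod :: "'a \<Rightarrow> 'x"
    and Id :: "'x \<Rightarrow> 'a" and cmp :: "'a \<Rightarrow> 'a \<Rightarrow> 'a"  (infixr \<open>\<star>\<close> 60)
  assumes ob_dom [simp]: "ar f \<Longrightarrow> ob (dom f)"
    and ob_cod [simp]: "ar f \<Longrightarrow> ob (cod f)"
    and dom_Id [simp]: "dom (Id X) = X"
    and cod_Id [simp]: "cod (Id X) = X"
    and ar_Id [simp]: "ob X \<Longrightarrow> ar (Id X)"
    and dom_cmp [simp]: "dom (g \<star> f) = dom f"
    and cod_cmp [simp]: "cod (g \<star> f) = cod g"
    and ar_cmp [simp]: "ar f \<Longrightarrow> ar g \<Longrightarrow> cod f = dom g \<Longrightarrow> ar (g \<star> f)"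
    and cmp_Id_left [simp]: "ar f \<Longrightarrow> cod f = Y \<Longrightarrow> Id Y \<star> f = f"
    and cmp_Id_right [simp]: "ar f \<Longrightarrow> dom f = X \<Longrightarrow> f \<star> Id X = f"
    and cmp_assoc [simp]:
      "ar f \<Longrightarrow> ar g \<Longrightarrow> ar h \<Longrightarrow> cod f = dom g \<Longrightarrow> cod g = dom h
        \<Longrightarrow> (h \<star> g) \<star> f = h \<star> (g \<star> f)"
begin

text \<open>Compositions are kept bracketed to the right; this turns an equation between composites into
  a rewrite rule that applies inside a longer composite.\<close>

lemma comp_reassoc: "g \<star> f = h \<Longrightarrow> ar g \<Longrightarrow> ar f \<Longrightarrow> ar z \<Longrightarrow> cod f = dom g \<Longrightarrow> cod z = dom f
    \<Longrightarrow> g \<star> f \<star> z = h \<star> z"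
  by (metis cmp_assoc)

end

section \<open>Frobenius monads and averaging\<close>

locale functor_arrows = arrows ob ar dom cod Id cmp
  for ob :: "'x \<Rightarrow> bool" and ar :: "'a \<Rightarrow> bool" and dom cod :: "'a \<Rightarrow> 'x"
    and Id :: "'x \<Rightarrow> 'a" and cmp :: "'a \<Rightarrow> 'a \<Rightarrow> 'a"  (infixr \<open>\<star>\<close> 60) +
  fixes To :: "'x \<Rightarrow> 'x" and T :: "'a \<Rightarrow> 'a"
  assumes ob_T [simp]: "ob X \<Longrightarrow> ob (To X)"
    and ar_T [simp]: "ar f \<Longrightarrow> ar (T f)"
    and dom_T [simp]: "dom (T f) = To (dom f)"
    and cod_T [simp]: "cod (T f) = To (cod f)"
    and T_Id [simp]: "ob X \<Longrightarrow> T (Id X) = Id (To X)"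
    and T_cmp: "ar f \<Longrightarrow> ar g \<Longrightarrow> cod f = dom g \<Longrightarrow> T (g \<star> f) = T g \<star> T f"

text \<open>A monad \<open>(T, m, \<eta>)\<close> with a counit \<open>\<epsilon>\<close> such that \<open>\<epsilon> m\<close> and \<open>I\<close> exhibit \<open>T\<close> as its own adjoint. For
  \<open>T = A \<otimes> -\<close> these are the pairing \<open>\<epsilon>\<^sub>A \<mu>\<close> and its copairing, each tensored with the identity.\<close>

locale frobenius_monad = functor_arrows ob ar dom cod Id cmp To T
  for ob :: "'x \<Rightarrow> bool" and ar :: "'a \<Rightarrow> bool" and dom cod :: "'a \<Rightarrow> 'x"
    and Id :: "'x \<Rightarrow> 'a" and cmp :: "'a \<Rightarrow> 'a \<Rightarrow> 'a"  (infixr \<open>\<star>\<close> 60)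
    and To :: "'x \<Rightarrow> 'x" and T :: "'a \<Rightarrow> 'a" +
  fixes m \<eta> \<epsilon> I :: "'x \<Rightarrow> 'a"
  assumes m_type [simp]: "ob X \<Longrightarrow> ar (m X)" "dom (m X) = To (To X)" "cod (m X) = To X"
    and m_nat: "ar f \<Longrightarrow> dom f = X \<Longrightarrow> cod f = Y \<Longrightarrow> m Y \<star> T (T f) = T f \<star> m X"
    and m_assoc: "ob X \<Longrightarrow> m X \<star> m (To X) = m X \<star> T (m X)"
    and \<eta>_type [simp]: "ob X \<Longrightarrow> ar (\<eta> X)" "dom (\<eta> X) = X" "cod (\<eta> X) = To X"
    and \<eta>_nat: "ar f \<Longrightarrow> dom f = X \<Longrightarrow> cod f = Y \<Longrightarrow> \<eta> Y \<star> f = T f \<star> \<eta> X"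
    and m_unit: "ob X \<Longrightarrow> m X \<star> \<eta> (To X) = Id (To X)"
    and \<epsilon>_type [simp]: "ob X \<Longrightarrow> ar (\<epsilon> X)" "dom (\<epsilon> X) = To X" "cod (\<epsilon> X) = X"
    and \<epsilon>_nat: "ar f \<Longrightarrow> dom f = X \<Longrightarrow> cod f = Y \<Longrightarrow> \<epsilon> Y \<star> T f = f \<star> \<epsilon> X"
    and I_type [simp]: "ob X \<Longrightarrow> ar (I X)" "dom (I X) = X" "cod (I X) = To (To X)"
    and I_nat: "ar f \<Longrightarrow> dom f = X \<Longrightarrow> cod f = Y \<Longrightarrow> I Y \<star> f = T (T f) \<star> I X"
    and zigzag1: "ob X \<Longrightarrow> T (\<epsilon> X \<star> m X) \<star> I (To X) = Id (To X)"
    and zigzag2: "ob X \<Longrightarrow> \<epsilon> (To X) \<star> m (To X) \<star> T (I X) = Id (To X)"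
begin

text \<open>The zigzag identity recovers an arrow into \<open>T X\<close> from its pairing with \<open>T\<close>.\<close>

lemma pairing_nondegenerate:
  assumes f: "ar f" "dom f = Y" "cod f = To X"
    and g: "ar g" "dom g = Y" "cod g = To X"
    and X: "ob X"
    and eq: "\<epsilon> X \<star> m X \<star> T f = \<epsilon> X \<star> m X \<star> T g"
  shows "f = g"
proof -
  have recover: "T (\<epsilon> X \<star> m X \<star> T h) \<star> I Y = h"
    if h: "ar h" "dom h = Y" "cod h = To X" for h
  proof -
    have Y: "ob Y" using ob_dom[OF h(1)] h(2) by simp
    have "T (\<epsilon> X \<star> m X \<star> T h) \<star> I Y = T (\<epsilon> X \<star> m X) \<star> T (T h) \<star> I Y"
      using h X Y by (simp add: T_cmp)
    also have "\<dots> = T (\<epsilon> X \<star> m X) \<star> I (To X) \<star> h"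
      using h by (simp add: I_nat)
    also have "\<dots> = h"
      using h X by (simp add: comp_reassoc[OF zigzag1])
    finally show ?thesis .
  qed
  show ?thesis using recover[OF f] recover[OF g] unfolding eq by (rule trans[OF sym])
qed

text \<open>For \<open>T = A \<otimes> -\<close> this is \<open>\<Sum> x\<^sub>j \<otimes> x\<^sup>j a = \<Sum> a x\<^sub>j \<otimes> x\<^sup>j\<close>: paired with \<open>T\<close>, both sides
  give the multiplication, by naturality and by associativity respectively.\<close>

lemma frobenius_law:
  assumes X: "ob X"
  shows "T (m X) \<star> I (To X) = m (To X) \<star> T (I X)"
proof (rule pairing_nondegenerate[where Y = "To X" and X = "To X"])
  have "\<epsilon> (To X) \<star> m (To X) \<star> T (T (m X) \<star> I (To X))
      = \<epsilon> (To X) \<star> (m (To X) \<star> T (T (m X))) \<star> T (I (To X))"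
    using X by (simp add: T_cmp)
  also have "\<dots> = \<epsilon> (To X) \<star> T (m X) \<star> m (To (To X)) \<star> T (I (To X))"
    using X by (simp add: m_nat[of "m X" "To (To X)" "To X"])
  also have "\<dots> = m X \<star> \<epsilon> (To (To X)) \<star> m (To (To X)) \<star> T (I (To X))"
    using X by (simp add: comp_reassoc[OF \<epsilon>_nat[of "m X" "To (To X)" "To X"]])
  also have "\<dots> = m X"
    using X by (simp add: zigzag2)
  finally have L: "\<epsilon> (To X) \<star> m (To X) \<star> T (T (m X) \<star> I (To X)) = m X" .
  have "\<epsilon> (To X) \<star> m (To X) \<star> T (m (To X) \<star> T (I X))
      = \<epsilon> (To X) \<star> m (To X) \<star> m (To (To X)) \<star> T (T (I X))"
    using X by (simp add: T_cmp comp_reassoc[OF m_assoc])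
  also have "\<dots> = (\<epsilon> (To X) \<star> m (To X) \<star> T (I X)) \<star> m X"
    using X by (simp add: m_nat)
  also have "\<dots> = m X"
    using X by (simp only: zigzag2) simp
  finally show "\<epsilon> (To X) \<star> m (To X) \<star> T (T (m X) \<star> I (To X))
      = \<epsilon> (To X) \<star> m (To X) \<star> T (m (To X) \<star> T (I X))"
    using L by simp
qed (use X in simp_all)

text \<open>Here \<open>\<Theta>\<close> is a monad endomorphism, \<open>K\<close> an invertible scalar and \<open>trace\<close> says
  \<open>\<Sum> \<theta>(x\<^sub>j) x\<^sup>j = \<kappa> 1\<close>. Pushing an element \<open>a\<close> from the right end of the sum to its left end with
  the Frobenius law gives \<open>\<kappa> a = \<kappa> (\<theta>(a) 1)\<close>. Right multiplication by \<open>1\<close> is the idempotent \<open>r\<close>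
  below; having the right inverse \<open>\<Theta>\<close>, it is the identity.\<close>

lemma twist_trivial:
  assumes \<Theta>_type [simp]: "\<And>X. ob X \<Longrightarrow> ar (\<Theta> X)" "\<And>X. dom (\<Theta> X) = To X" "\<And>X. cod (\<Theta> X) = To X"
    and \<Theta>_nat: "\<And>f X Y. ar f \<Longrightarrow> dom f = X \<Longrightarrow> cod f = Y \<Longrightarrow> \<Theta> Y \<star> T f = T f \<star> \<Theta> X"
    and \<Theta>_m: "\<And>X. ob X \<Longrightarrow> \<Theta> X \<star> m X = m X \<star> \<Theta> (To X) \<star> T (\<Theta> X)"
    and K_type [simp]: "\<And>X. ob X \<Longrightarrow> ar (K X)" "\<And>X. dom (K X) = X" "\<And>X. cod (K X) = X"
    and L_type [simp]: "\<And>X. ob X \<Longrightarrow> ar (L X)" "\<And>X. dom (L X) = X" "\<And>X. cod (L X) = X"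
    and K_nat: "\<And>f X Y. ar f \<Longrightarrow> dom f = X \<Longrightarrow> cod f = Y \<Longrightarrow> K Y \<star> f = f \<star> K X"
    and T_K: "\<And>X. ob X \<Longrightarrow> T (K X) = K (To X)"
    and KL: "\<And>X. ob X \<Longrightarrow> K X \<star> L X = Id X"
    and trace: "\<And>X. ob X \<Longrightarrow> m X \<star> \<Theta> (To X) \<star> I X = \<eta> X \<star> K X"
    and X: "ob X"
  shows "\<Theta> X = Id (To X)"
proof -
  define r where "r = m X \<star> T (\<eta> X)"
  have r [simp]: "ar r" "dom r = To X" "cod r = To X"
    using X by (simp_all add: r_def)
  \<comment> \<open>associativity and \<open>1 1 = 1\<close>: \<open>(a 1) 1 = a 1\<close>\<close>
  have "r \<star> r = m X \<star> (T (\<eta> X) \<star> m X) \<star> T (\<eta> X)"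
    using X by (simp add: r_def)
  also have "\<dots> = m X \<star> m (To X) \<star> T (T (\<eta> X)) \<star> T (\<eta> X)"
    using X by (simp add: m_nat[symmetric])
  also have "\<dots> = m X \<star> T (m X \<star> T (\<eta> X) \<star> \<eta> X)"
    using X by (simp add: comp_reassoc[OF m_assoc] T_cmp)
  also have "\<dots> = m X \<star> T (m X \<star> \<eta> (To X) \<star> \<eta> X)"
    using X by (simp add: \<eta>_nat)
  also have "\<dots> = r"
    using X by (simp add: comp_reassoc[OF m_unit] r_def)
  finally have rr: "r \<star> r = r" .
  \<comment> \<open>the chain \<open>\<kappa> a = \<Sum> \<theta>(x\<^sub>j) x\<^sup>j a = \<Sum> \<theta>(a x\<^sub>j) x\<^sup>j = \<theta>(a) (\<kappa> 1)\<close>\<close>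
  have "K (To X) = m X \<star> \<eta> (To X) \<star> K (To X)"
    using X by (simp add: comp_reassoc[OF m_unit])
  also have "\<dots> = m X \<star> m (To X) \<star> \<Theta> (To (To X)) \<star> I (To X)"
    using X by (simp add: trace)
  also have "\<dots> = m X \<star> T (m X) \<star> \<Theta> (To (To X)) \<star> I (To X)"
    using X by (simp add: comp_reassoc[OF m_assoc])
  also have "\<dots> = m X \<star> \<Theta> (To X) \<star> T (m X) \<star> I (To X)"
    using X by (simp add: comp_reassoc[OF \<Theta>_nat[of "m X" "To (To X)" "To X"]])
  also have "\<dots> = m X \<star> (\<Theta> (To X) \<star> m (To X)) \<star> T (I X)"
    using X by (simp add: frobenius_law)
  also have "\<dots> = m X \<star> m (To X) \<star> \<Theta> (To (To X)) \<star> T (\<Theta> (To X)) \<star> T (I X)"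
    using X by (simp add: \<Theta>_m)
  also have "\<dots> = m X \<star> T (m X) \<star> \<Theta> (To (To X)) \<star> T (\<Theta> (To X) \<star> I X)"
    using X by (simp add: comp_reassoc[OF m_assoc] T_cmp)
  also have "\<dots> = m X \<star> T (m X) \<star> T (\<Theta> (To X) \<star> I X) \<star> \<Theta> X"
    using X by (simp add: \<Theta>_nat)
  also have "\<dots> = m X \<star> T (m X \<star> \<Theta> (To X) \<star> I X) \<star> \<Theta> X"
    using X by (simp add: T_cmp)
  also have "\<dots> = m X \<star> T (\<eta> X) \<star> K (To X) \<star> \<Theta> X"
    using X by (simp add: trace T_cmp T_K)
  also have "\<dots> = r \<star> \<Theta> X \<star> K (To X)"
    using X by (simp add: r_def K_nat)
  finally have "K (To X) \<star> L (To X) = (r \<star> \<Theta> X \<star> K (To X)) \<star> L (To X)"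
    by simp
  then have r\<Theta>: "r \<star> \<Theta> X = Id (To X)"
    using X by (simp add: KL)
  have "r = r \<star> r \<star> \<Theta> X"
    using X r\<Theta> by simp
  also have "\<dots> = r \<star> \<Theta> X"
    using X by (simp add: comp_reassoc[OF rr] del: cmp_Id_right)
  also have "\<dots> = Id (To X)"
    by (rule r\<Theta>)
  finally show ?thesis using r\<Theta> X by simp
qed

end

text \<open>If \<open>\<Sum> x\<^sub>j x\<^sup>j = \<kappa> 1\<close>, then \<open>L\<close> is the family of multiplications by \<open>\<kappa>\<^sup>-\<^sup>1\<close>.\<close>

locale special_frobenius_monad =
  frobenius_monad ob ar dom cod Id cmp To T m \<eta> \<epsilon> I
  for ob :: "'x \<Rightarrow> bool" and ar :: "'a \<Rightarrow> bool" and dom cod :: "'a \<Rightarrow> 'x"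
    and Id :: "'x \<Rightarrow> 'a" and cmp :: "'a \<Rightarrow> 'a \<Rightarrow> 'a"  (infixr \<open>\<star>\<close> 60)
    and To :: "'x \<Rightarrow> 'x" and T :: "'a \<Rightarrow> 'a" and m \<eta> \<epsilon> I :: "'x \<Rightarrow> 'a" +
  fixes L :: "'x \<Rightarrow> 'a"
  assumes L_type [simp]: "ob X \<Longrightarrow> ar (L X)" "dom (L X) = X" "cod (L X) = X"
    and L_nat: "ar f \<Longrightarrow> dom f = X \<Longrightarrow> cod f = Y \<Longrightarrow> L Y \<star> f = f \<star> L X"
    and T_L: "ob X \<Longrightarrow> T (L X) = L (To X)"
    and separable: "ob X \<Longrightarrow> m X \<star> I X \<star> L X = \<eta> X"
begin

text \<open>The averaged map is \<open>w \<mapsto> \<kappa>\<^sup>-\<^sup>1 \<Sum> x\<^sub>j g(x\<^sup>j w)\<close>, the Casimir-type average of the quasi-inverse \<open>g\<close>.\<close>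

lemma averaging:
  assumes \<rho> [simp]: "ar \<rho>" "dom \<rho> = To V" "cod \<rho> = V" and \<rho>_assoc: "\<rho> \<star> m V = \<rho> \<star> T \<rho>"
    and \<rho>_unit: "\<rho> \<star> \<eta> V = Id V"
    and \<sigma> [simp]: "ar \<sigma>" "dom \<sigma> = To W" "cod \<sigma> = W" and \<sigma>_assoc: "\<sigma> \<star> m W = \<sigma> \<star> T \<sigma>"
    and f [simp]: "ar f" "dom f = V" "cod f = W" and f_lin: "f \<star> \<rho> = \<sigma> \<star> T f"
    and g [simp]: "ar g" "dom g = W" "cod g = V" and fgf: "f \<star> g \<star> f = f"
  obtains h where "ar h" "dom h = W" "cod h = V" "h \<star> \<sigma> = \<rho> \<star> T h" "f \<star> h \<star> f = f"
proof -
  have V [simp]: "ob V" and W [simp]: "ob W"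
    using ob_cod[of \<rho>] ob_cod[of \<sigma>] by simp_all
  define h where "h = \<rho> \<star> T (g \<star> \<sigma>) \<star> I W \<star> L W"
  have h: "ar h" "dom h = W" "cod h = V"
    by (simp_all add: h_def)
  have g_m: "T g \<star> m W = m V \<star> T (T g)"
    by (simp add: m_nat)
  have \<sigma>_m: "T \<sigma> \<star> m (To W) = m W \<star> T (T \<sigma>)"
    by (simp add: m_nat)
  have "h \<star> \<sigma> = \<rho> \<star> T g \<star> T \<sigma> \<star> (I W \<star> \<sigma>) \<star> L (To W)"
    by (simp add: h_def T_cmp L_nat)
  also have "\<dots> = \<rho> \<star> T g \<star> T (\<sigma> \<star> T \<sigma>) \<star> I (To W) \<star> L (To W)"
    by (simp add: I_nat T_cmp)
  also have "\<dots> = \<rho> \<star> T g \<star> T \<sigma> \<star> (T (m W) \<star> I (To W)) \<star> L (To W)"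
    by (simp add: \<sigma>_assoc[symmetric] T_cmp)
  also have "\<dots> = \<rho> \<star> T g \<star> (T \<sigma> \<star> m (To W)) \<star> T (I W) \<star> L (To W)"
    by (simp add: frobenius_law)
  also have "\<dots> = \<rho> \<star> (T g \<star> m W) \<star> T (T \<sigma>) \<star> T (I W) \<star> L (To W)"
    by (simp add: comp_reassoc[OF \<sigma>_m])
  also have "\<dots> = \<rho> \<star> m V \<star> T (T g) \<star> T (T \<sigma>) \<star> T (I W) \<star> L (To W)"
    by (simp add: comp_reassoc[OF g_m])
  also have "\<dots> = \<rho> \<star> T h"
    by (simp add: h_def T_cmp T_L comp_reassoc[OF \<rho>_assoc])
  finally have lin: "h \<star> \<sigma> = \<rho> \<star> T h" .
  have "f \<star> h \<star> f = f \<star> \<rho> \<star> T g \<star> T \<sigma> \<star> (I W \<star> f) \<star> L V"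
    by (simp add: h_def T_cmp L_nat)
  also have "\<dots> = f \<star> \<rho> \<star> T g \<star> T (\<sigma> \<star> T f) \<star> I V \<star> L V"
    by (simp add: I_nat T_cmp)
  also have "\<dots> = f \<star> \<rho> \<star> T g \<star> T (f \<star> \<rho>) \<star> I V \<star> L V"
    by (simp only: f_lin)
  also have "\<dots> = \<sigma> \<star> T (f \<star> g \<star> f) \<star> T \<rho> \<star> I V \<star> L V"
    by (simp add: comp_reassoc[OF f_lin] T_cmp)
  also have "\<dots> = f \<star> \<rho> \<star> T \<rho> \<star> I V \<star> L V"
    by (simp add: fgf comp_reassoc[OF f_lin])
  also have "\<dots> = f \<star> \<rho> \<star> m V \<star> I V \<star> L V"
    by (simp add: comp_reassoc[OF \<rho>_assoc])
  also have "\<dots> = f"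
    by (simp add: separable \<rho>_unit)
  finally show thesis by (rule that[OF h lin])
qed

end

section \<open>Coherence and duality in monoidal categories\<close>

locale monoidal_arrows = arrows ob ar dom cod Id cmp
  for ob :: "'x \<Rightarrow> bool" and ar :: "'a \<Rightarrow> bool" and dom cod :: "'a \<Rightarrow> 'x"
    and Id :: "'x \<Rightarrow> 'a" and cmp :: "'a \<Rightarrow> 'a \<Rightarrow> 'a"  (infixr \<open>\<star>\<close> 60) +
  fixes tob :: "'x \<Rightarrow> 'x \<Rightarrow> 'x"  (infixr \<open>\<boxtimes>\<close> 75)
    and tar :: "'a \<Rightarrow> 'a \<Rightarrow> 'a"  (infixr \<open>\<boxdot>\<close> 75)
    and U :: 'x and as ai :: "'x \<Rightarrow> 'x \<Rightarrow> 'x \<Rightarrow> 'a" and lu li ru ri :: "'x \<Rightarrow> 'a"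
  assumes ob_tob [simp]: "ob X \<Longrightarrow> ob Y \<Longrightarrow> ob (X \<boxtimes> Y)"
    and ar_tar [simp]: "ar f \<Longrightarrow> ar g \<Longrightarrow> ar (f \<boxdot> g)"
    and dom_tar [simp]: "dom (f \<boxdot> g) = dom f \<boxtimes> dom g"
    and cod_tar [simp]: "cod (f \<boxdot> g) = cod f \<boxtimes> cod g"
    and tar_Id [simp]: "ob X \<Longrightarrow> ob Y \<Longrightarrow> Id X \<boxdot> Id Y = Id (X \<boxtimes> Y)"
    and tar_cmp: "ar f \<Longrightarrow> ar f' \<Longrightarrow> ar g \<Longrightarrow> ar g' \<Longrightarrow> cod f = dom f' \<Longrightarrow> cod g = dom g'
      \<Longrightarrow> (f' \<star> f) \<boxdot> (g' \<star> g) = (f' \<boxdot> g') \<star> (f \<boxdot> g)"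
    and ob_U [simp]: "ob U"
    and as_type [simp]: "ob X \<Longrightarrow> ob Y \<Longrightarrow> ob Z \<Longrightarrow> ar (as X Y Z)"
      "dom (as X Y Z) = (X \<boxtimes> Y) \<boxtimes> Z" "cod (as X Y Z) = X \<boxtimes> (Y \<boxtimes> Z)"
    and ai_type [simp]: "ob X \<Longrightarrow> ob Y \<Longrightarrow> ob Z \<Longrightarrow> ar (ai X Y Z)"
      "dom (ai X Y Z) = X \<boxtimes> (Y \<boxtimes> Z)" "cod (ai X Y Z) = (X \<boxtimes> Y) \<boxtimes> Z"
    and as_ai [simp]: "ob X \<Longrightarrow> ob Y \<Longrightarrow> ob Z \<Longrightarrow> as X Y Z \<star> ai X Y Z = Id (X \<boxtimes> (Y \<boxtimes> Z))"
    and ai_as [simp]: "ob X \<Longrightarrow> ob Y \<Longrightarrow> ob Z \<Longrightarrow> ai X Y Z \<star> as X Y Z = Id ((X \<boxtimes> Y) \<boxtimes> Z)"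
    and lu_type [simp]: "ob X \<Longrightarrow> ar (lu X)" "dom (lu X) = U \<boxtimes> X" "cod (lu X) = X"
    and li_type [simp]: "ob X \<Longrightarrow> ar (li X)" "dom (li X) = X" "cod (li X) = U \<boxtimes> X"
    and lu_li [simp]: "ob X \<Longrightarrow> lu X \<star> li X = Id X"
    and li_lu [simp]: "ob X \<Longrightarrow> li X \<star> lu X = Id (U \<boxtimes> X)"
    and ru_type [simp]: "ob X \<Longrightarrow> ar (ru X)" "dom (ru X) = X \<boxtimes> U" "cod (ru X) = X"
    and ri_type [simp]: "ob X \<Longrightarrow> ar (ri X)" "dom (ri X) = X" "cod (ri X) = X \<boxtimes> U"
    and ru_ri [simp]: "ob X \<Longrightarrow> ru X \<star> ri X = Id X"
    and ri_ru [simp]: "ob X \<Longrightarrow> ri X \<star> ru X = Id (X \<boxtimes> U)"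
    and as_nat: "\<lbrakk>ar f; ar g; ar h; dom f = X; dom g = Y; dom h = Z;
        cod f = X'; cod g = Y'; cod h = Z'\<rbrakk>
      \<Longrightarrow> as X' Y' Z' \<star> ((f \<boxdot> g) \<boxdot> h) = (f \<boxdot> (g \<boxdot> h)) \<star> as X Y Z"
    and lu_nat: "ar f \<Longrightarrow> dom f = X \<Longrightarrow> cod f = Y \<Longrightarrow> lu Y \<star> (Id U \<boxdot> f) = f \<star> lu X"
    and ru_nat: "ar f \<Longrightarrow> dom f = X \<Longrightarrow> cod f = Y \<Longrightarrow> ru Y \<star> (f \<boxdot> Id U) = f \<star> ru X"
    and pentagon: "ob W \<Longrightarrow> ob X \<Longrightarrow> ob Y \<Longrightarrow> ob Z
      \<Longrightarrow> (Id W \<boxdot> as X Y Z) \<star> as W (X \<boxtimes> Y) Z \<star> (as W X Y \<boxdot> Id Z)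
          = as W X (Y \<boxtimes> Z) \<star> as (W \<boxtimes> X) Y Z"
    and triangle: "ob X \<Longrightarrow> ob Y \<Longrightarrow> (Id X \<boxdot> lu Y) \<star> as X U Y = ru X \<boxdot> Id Y"
begin

lemmas inverse_reassoc [simp] =
  comp_reassoc[OF as_ai] comp_reassoc[OF ai_as] comp_reassoc[OF lu_li] comp_reassoc[OF li_lu] comp_reassoc[OF ru_ri] comp_reassoc[OF ri_ru]

lemma whisker_left:
  "ob W \<Longrightarrow> ar f \<Longrightarrow> ar g \<Longrightarrow> cod f = dom g \<Longrightarrow> Id W \<boxdot> (g \<star> f) = (Id W \<boxdot> g) \<star> (Id W \<boxdot> f)"
  using tar_cmp[of "Id W" "Id W" f g] by simp

lemma whisker_right:
  "ob W \<Longrightarrow> ar f \<Longrightarrow> ar g \<Longrightarrow> cod f = dom g \<Longrightarrow> (g \<star> f) \<boxdot> Id W = (g \<boxdot> Id W) \<star> (f \<boxdot> Id W)"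
  using tar_cmp[of f g "Id W" "Id W"] by simp

lemma interchange:
  "ar f \<Longrightarrow> ar g \<Longrightarrow> dom f = X \<Longrightarrow> cod f = X' \<Longrightarrow> dom g = Y \<Longrightarrow> cod g = Y'
    \<Longrightarrow> (f \<boxdot> Id Y') \<star> (Id X \<boxdot> g) = (Id X' \<boxdot> g) \<star> (f \<boxdot> Id Y)"
  using tar_cmp[of "Id X" f g "Id Y'"] tar_cmp[of f "Id X'" "Id Y" g]
  using ob_dom[of f] ob_dom[of g] ob_cod[of f] ob_cod[of g] by simp

lemma ai_nat:
  assumes [simp]: "ar f" "ar g" "ar h" "dom f = X" "dom g = Y" "dom h = Z"
    "cod f = X'" "cod g = Y'" "cod h = Z'"
  shows "ai X' Y' Z' \<star> (f \<boxdot> (g \<boxdot> h)) = ((f \<boxdot> g) \<boxdot> h) \<star> ai X Y Z"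
proof -
  have [simp]: "ob X" "ob Y" "ob Z" "ob X'" "ob Y'" "ob Z'"
    using ob_dom[of f] ob_dom[of g] ob_dom[of h] ob_cod[of f] ob_cod[of g] ob_cod[of h] by simp_all
  have "ai X' Y' Z' \<star> (f \<boxdot> (g \<boxdot> h)) = ai X' Y' Z' \<star> ((f \<boxdot> (g \<boxdot> h)) \<star> as X Y Z) \<star> ai X Y Z"
    by simp
  also have "\<dots> = ai X' Y' Z' \<star> (as X' Y' Z' \<star> ((f \<boxdot> g) \<boxdot> h)) \<star> ai X Y Z"
    by (simp only: as_nat assms)
  also have "\<dots> = ((f \<boxdot> g) \<boxdot> h) \<star> ai X Y Z"
    by simp
  finally show ?thesis .
qed

lemma as_nat1: "\<lbrakk>ar f; dom f = X; cod f = X'; ob Y; ob Z\<rbrakk>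
    \<Longrightarrow> as X' Y Z \<star> ((f \<boxdot> Id Y) \<boxdot> Id Z) = (f \<boxdot> Id (Y \<boxtimes> Z)) \<star> as X Y Z"
  using as_nat[of f "Id Y" "Id Z" X Y Z X' Y Z] by simp

lemma as_nat2: "\<lbrakk>ar f; dom f = Y; cod f = Y'; ob X; ob Z\<rbrakk>
    \<Longrightarrow> as X Y' Z \<star> ((Id X \<boxdot> f) \<boxdot> Id Z) = (Id X \<boxdot> (f \<boxdot> Id Z)) \<star> as X Y Z"
  using as_nat[of "Id X" f "Id Z" X Y Z X Y' Z] by simp

lemma as_nat3: "\<lbrakk>ar f; dom f = Z; cod f = Z'; ob X; ob Y\<rbrakk>
    \<Longrightarrow> as X Y Z' \<star> (Id (X \<boxtimes> Y) \<boxdot> f) = (Id X \<boxdot> (Id Y \<boxdot> f)) \<star> as X Y Z"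
  using as_nat[of "Id X" "Id Y" f X Y Z X Y Z'] by simp

lemma ai_nat1: "\<lbrakk>ar f; dom f = X; cod f = X'; ob Y; ob Z\<rbrakk>
    \<Longrightarrow> ai X' Y Z \<star> (f \<boxdot> Id (Y \<boxtimes> Z)) = ((f \<boxdot> Id Y) \<boxdot> Id Z) \<star> ai X Y Z"
  using ai_nat[of f "Id Y" "Id Z" X Y Z X' Y Z] by simp

lemma ai_nat2: "\<lbrakk>ar f; dom f = Y; cod f = Y'; ob X; ob Z\<rbrakk>
    \<Longrightarrow> ai X Y' Z \<star> (Id X \<boxdot> (f \<boxdot> Id Z)) = ((Id X \<boxdot> f) \<boxdot> Id Z) \<star> ai X Y Z"
  using ai_nat[of "Id X" f "Id Z" X Y Z X Y' Z] by simp

lemma ai_nat3: "\<lbrakk>ar f; dom f = Z; cod f = Z'; ob X; ob Y\<rbrakk>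
    \<Longrightarrow> ai X Y Z' \<star> (Id X \<boxdot> (Id Y \<boxdot> f)) = (Id (X \<boxtimes> Y) \<boxdot> f) \<star> ai X Y Z"
  using ai_nat[of "Id X" "Id Y" f X Y Z X Y Z'] by simp

lemma cancel_right:
  assumes "h \<star> k = Id Y" "f \<star> h = g \<star> h"
    and "ar f" "ar g" "ar h" "ar k" "dom f = Y" "dom g = Y" "cod h = Y" "cod k = dom h"
  shows "f = g"
proof -
  have "(f \<star> h) \<star> k = f" "(g \<star> h) \<star> k = g"
    using assms(1) assms(3-) by simp_all
  then show ?thesis using assms(2) by metis
qed

lemma cancel_left:
  assumes "k \<star> h = Id Y" "h \<star> f = h \<star> g"
    and "ar f" "ar g" "ar h" "ar k" "cod f = Y" "cod g = Y" "dom h = Y" "cod h = dom k"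
  shows "f = g"
proof -
  have "k \<star> h \<star> f = f" "k \<star> h \<star> g = g"
    using assms(3-) by (simp_all add: comp_reassoc[OF assms(1)])
  then show ?thesis using assms(2) by metis
qed

lemma unit_left_faithful:
  assumes eq: "Id U \<boxdot> f = Id U \<boxdot> g" and [simp]: "ar f" "ar g" "dom f = X" "dom g = X"
    "cod f = Y" "cod g = Y"
  shows "f = g"
proof (rule cancel_right)
  have [simp]: "ob X" using ob_dom[of f] by simp
  show "lu X \<star> li X = Id X" by simp
  show "f \<star> lu X = g \<star> lu X"
    using lu_nat[of f X Y] lu_nat[of g X Y] eq by simp
qed (use ob_dom[of f] in simp_all)

lemma unit_right_faithful:
  assumes eq: "f \<boxdot> Id U = g \<boxdot> Id U" and [simp]: "ar f" "ar g" "dom f = X" "dom g = X"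
    "cod f = Y" "cod g = Y"
  shows "f = g"
proof (rule cancel_right)
  have [simp]: "ob X" using ob_dom[of f] by simp
  show "ru X \<star> ri X = Id X" by simp
  show "f \<star> ru X = g \<star> ru X"
    using ru_nat[of f X Y] ru_nat[of g X Y] eq by simp
qed (use ob_dom[of f] in simp_all)

text \<open>The pentagon solved for the two mixed composites of associators and inverse associators that
  occur in the zigzag identities.\<close>

lemma pentagon_mixed:
  assumes [simp]: "ob W" "ob X" "ob Y" "ob Z"
  shows "(Id W \<boxdot> ai X Y Z) \<star> as W X (Y \<boxtimes> Z) = as W (X \<boxtimes> Y) Z \<star> (as W X Y \<boxdot> Id Z) \<star> ai (W \<boxtimes> X) Y Z"
proof -
  have "(Id W \<boxdot> ai X Y Z) \<star> as W X (Y \<boxtimes> Z)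
      = (Id W \<boxdot> ai X Y Z) \<star> (as W X (Y \<boxtimes> Z) \<star> as (W \<boxtimes> X) Y Z) \<star> ai (W \<boxtimes> X) Y Z"
    by simp
  also have "\<dots> = ((Id W \<boxdot> ai X Y Z) \<star> (Id W \<boxdot> as X Y Z))
      \<star> as W (X \<boxtimes> Y) Z \<star> (as W X Y \<boxdot> Id Z) \<star> ai (W \<boxtimes> X) Y Z"
    by (simp add: pentagon[symmetric])
  also have "(Id W \<boxdot> ai X Y Z) \<star> (Id W \<boxdot> as X Y Z) = Id (W \<boxtimes> (X \<boxtimes> Y) \<boxtimes> Z)"
    by (simp add: whisker_left[symmetric])
  finally show ?thesis by simp
qed

lemma pentagon_mixed':
  assumes [simp]: "ob W" "ob X" "ob Y" "ob Z"
  shows "ai W X (Y \<boxtimes> Z) \<star> (Id W \<boxdot> as X Y Z) = as (W \<boxtimes> X) Y Z \<star> (ai W X Y \<boxdot> Id Z) \<star> ai W (X \<boxtimes> Y) Z"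
proof (rule cancel_right[where h = "as W (X \<boxtimes> Y) Z \<star> (as W X Y \<boxdot> Id Z)"
      and k = "(ai W X Y \<boxdot> Id Z) \<star> ai W (X \<boxtimes> Y) Z"])
  have A: "(as W X Y \<boxdot> Id Z) \<star> (ai W X Y \<boxdot> Id Z) = Id ((W \<boxtimes> X \<boxtimes> Y) \<boxtimes> Z)"
    "(ai W X Y \<boxdot> Id Z) \<star> (as W X Y \<boxdot> Id Z) = Id (((W \<boxtimes> X) \<boxtimes> Y) \<boxtimes> Z)"
    by (simp_all add: whisker_right[symmetric])
  show "(as W (X \<boxtimes> Y) Z \<star> (as W X Y \<boxdot> Id Z)) \<star> (ai W X Y \<boxdot> Id Z) \<star> ai W (X \<boxtimes> Y) Z
      = Id (W \<boxtimes> (X \<boxtimes> Y) \<boxtimes> Z)"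
    by (simp add: comp_reassoc[OF A(1)])
  show "(ai W X (Y \<boxtimes> Z) \<star> (Id W \<boxdot> as X Y Z)) \<star> as W (X \<boxtimes> Y) Z \<star> (as W X Y \<boxdot> Id Z)
      = (as (W \<boxtimes> X) Y Z \<star> (ai W X Y \<boxdot> Id Z) \<star> ai W (X \<boxtimes> Y) Z) \<star> as W (X \<boxtimes> Y) Z \<star> (as W X Y \<boxdot> Id Z)"
    by (simp add: pentagon A)
qed simp_all

text \<open>Kelly's derivation: after tensoring with the unit object, which is faithful, both sides
  become instances of the pentagon and the triangle.\<close>

lemma left_unitor_tensor:
  assumes [simp]: "ob X" "ob Y"
  shows "lu (X \<boxtimes> Y) \<star> as U X Y = lu X \<boxdot> Id Y"
proof (rule unit_left_faithful)
  let ?P = "as U (U \<boxtimes> X) Y \<star> (as U U X \<boxdot> Id Y)"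
  show "Id U \<boxdot> (lu (X \<boxtimes> Y) \<star> as U X Y) = Id U \<boxdot> (lu X \<boxdot> Id Y)"
  proof (rule cancel_right[where h = ?P and k = "(ai U U X \<boxdot> Id Y) \<star> ai U (U \<boxtimes> X) Y"])
    have A: "(as U U X \<boxdot> Id Y) \<star> (ai U U X \<boxdot> Id Y) = Id ((U \<boxtimes> U \<boxtimes> X) \<boxtimes> Y)"
      by (simp add: whisker_right[symmetric])
    show "?P \<star> (ai U U X \<boxdot> Id Y) \<star> ai U (U \<boxtimes> X) Y = Id (U \<boxtimes> (U \<boxtimes> X) \<boxtimes> Y)"
      by (simp add: comp_reassoc[OF A])
    have "(Id U \<boxdot> (lu (X \<boxtimes> Y) \<star> as U X Y)) \<star> ?P
        = (Id U \<boxdot> lu (X \<boxtimes> Y)) \<star> as U U (X \<boxtimes> Y) \<star> as (U \<boxtimes> U) X Y"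
      by (simp add: whisker_left pentagon)
    also have "\<dots> = (ru U \<boxdot> Id (X \<boxtimes> Y)) \<star> as (U \<boxtimes> U) X Y"
      by (simp add: comp_reassoc[OF triangle])
    also have "\<dots> = as U X Y \<star> ((ru U \<boxdot> Id X) \<boxdot> Id Y)"
      by (simp add: as_nat1)
    also have "\<dots> = as U X Y \<star> ((Id U \<boxdot> lu X) \<boxdot> Id Y) \<star> (as U U X \<boxdot> Id Y)"
      by (simp add: triangle[symmetric] whisker_right)
    also have "\<dots> = (Id U \<boxdot> (lu X \<boxdot> Id Y)) \<star> ?P"
      by (simp add: comp_reassoc[OF as_nat2])
    finally show "(Id U \<boxdot> (lu (X \<boxtimes> Y) \<star> as U X Y)) \<star> ?P = (Id U \<boxdot> (lu X \<boxdot> Id Y)) \<star> ?P" .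
  qed simp_all
qed simp_all

lemma right_unitor_tensor:
  assumes [simp]: "ob X" "ob Y"
  shows "(Id X \<boxdot> ru Y) \<star> as X Y U = ru (X \<boxtimes> Y)"
proof (rule unit_right_faithful)
  show "((Id X \<boxdot> ru Y) \<star> as X Y U) \<boxdot> Id U = ru (X \<boxtimes> Y) \<boxdot> Id U"
  proof (rule cancel_left[where h = "as X Y U" and k = "ai X Y U"])
    have "as X Y U \<star> (((Id X \<boxdot> ru Y) \<star> as X Y U) \<boxdot> Id U)
        = (Id X \<boxdot> (ru Y \<boxdot> Id U)) \<star> as X (Y \<boxtimes> U) U \<star> (as X Y U \<boxdot> Id U)"
      by (simp add: whisker_right comp_reassoc[OF as_nat2])
    also have "\<dots> = (Id X \<boxdot> (Id Y \<boxdot> lu U)) \<star> (Id X \<boxdot> as Y U U) \<star> as X (Y \<boxtimes> U) U \<star> (as X Y U \<boxdot> Id U)"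
      by (simp add: triangle[symmetric] whisker_left)
    also have "\<dots> = (Id X \<boxdot> (Id Y \<boxdot> lu U)) \<star> as X Y (U \<boxtimes> U) \<star> as (X \<boxtimes> Y) U U"
      by (simp add: pentagon)
    also have "\<dots> = as X Y U \<star> (Id (X \<boxtimes> Y) \<boxdot> lu U) \<star> as (X \<boxtimes> Y) U U"
      by (simp add: comp_reassoc[OF as_nat3])
    also have "\<dots> = as X Y U \<star> (ru (X \<boxtimes> Y) \<boxdot> Id U)"
      by (simp add: triangle)
    finally show "as X Y U \<star> (((Id X \<boxdot> ru Y) \<star> as X Y U) \<boxdot> Id U) = as X Y U \<star> (ru (X \<boxtimes> Y) \<boxdot> Id U)" .
  qed simp_all
qed simp_all

lemma ai_li:
  assumes [simp]: "ob X" "ob Y"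
  shows "ai U X Y \<star> li (X \<boxtimes> Y) = li X \<boxdot> Id Y"
proof (rule cancel_left[where h = "lu X \<boxdot> Id Y" and k = "li X \<boxdot> Id Y"])
  show "(li X \<boxdot> Id Y) \<star> (lu X \<boxdot> Id Y) = Id ((U \<boxtimes> X) \<boxtimes> Y)"
    by (simp add: whisker_right[symmetric])
  have "(lu X \<boxdot> Id Y) \<star> ai U X Y \<star> li (X \<boxtimes> Y) = Id (X \<boxtimes> Y)"
    by (simp add: left_unitor_tensor[symmetric])
  then show "(lu X \<boxdot> Id Y) \<star> ai U X Y \<star> li (X \<boxtimes> Y) = (lu X \<boxdot> Id Y) \<star> (li X \<boxdot> Id Y)"
    by (simp add: whisker_right[symmetric])
qed simp_all

text \<open>A pairing \<open>D \<otimes> V \<rightarrow> 1\<close> and a copairing \<open>1 \<rightarrow> V \<otimes> D\<close>, spread to natural transformations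
  \<open>D \<otimes> (V \<otimes> X) \<rightarrow> X\<close> and \<open>X \<rightarrow> V \<otimes> (D \<otimes> X)\<close>.\<close>

definition Ev :: "'a \<Rightarrow> 'x \<Rightarrow> 'x \<Rightarrow> 'x \<Rightarrow> 'a" where
  "Ev e D V X = lu X \<star> (e \<boxdot> Id X) \<star> ai D V X"

definition Cv :: "'a \<Rightarrow> 'x \<Rightarrow> 'x \<Rightarrow> 'x \<Rightarrow> 'a" where
  "Cv i V D X = as V D X \<star> (i \<boxdot> Id X) \<star> li X"

lemma Ev_type [simp]:
  "ob V \<Longrightarrow> ob D \<Longrightarrow> ob X \<Longrightarrow> ar e \<Longrightarrow> dom e = D \<boxtimes> V \<Longrightarrow> cod e = U \<Longrightarrow> ar (Ev e D V X)"
  "dom (Ev e D V X) = D \<boxtimes> (V \<boxtimes> X)" "cod (Ev e D V X) = X"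
  by (simp_all add: Ev_def)

lemma Cv_type [simp]:
  "ob V \<Longrightarrow> ob D \<Longrightarrow> ob X \<Longrightarrow> ar i \<Longrightarrow> dom i = U \<Longrightarrow> cod i = V \<boxtimes> D \<Longrightarrow> ar (Cv i V D X)"
  "dom (Cv i V D X) = X" "cod (Cv i V D X) = V \<boxtimes> (D \<boxtimes> X)"
  by (simp_all add: Cv_def)

lemma Ev_nat:
  assumes [simp]: "ob V" "ob D" "ar e" "dom e = D \<boxtimes> V" "cod e = U"
    and [simp]: "ar f" "dom f = X" "cod f = Y"
  shows "Ev e D V Y \<star> (Id D \<boxdot> (Id V \<boxdot> f)) = f \<star> Ev e D V X"
proof -
  have [simp]: "ob X" "ob Y" using ob_dom[of f] ob_cod[of f] by simp_all
  have "Ev e D V Y \<star> (Id D \<boxdot> (Id V \<boxdot> f)) = lu Y \<star> ((e \<boxdot> Id Y) \<star> (Id (D \<boxtimes> V) \<boxdot> f)) \<star> ai D V X"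
    by (simp add: Ev_def ai_nat3)
  also have "\<dots> = lu Y \<star> (Id U \<boxdot> f) \<star> (e \<boxdot> Id X) \<star> ai D V X"
    by (simp add: interchange[of e f "D \<boxtimes> V" U X Y])
  also have "\<dots> = f \<star> Ev e D V X"
    by (simp add: Ev_def comp_reassoc[OF lu_nat])
  finally show ?thesis .
qed

lemma li_nat:
  assumes [simp]: "ar f" "dom f = X" "cod f = Y"
  shows "li Y \<star> f = (Id U \<boxdot> f) \<star> li X"
proof -
  have [simp]: "ob X" "ob Y" using ob_dom[of f] ob_cod[of f] by simp_all
  have "li Y \<star> f = li Y \<star> (f \<star> lu X) \<star> li X" by simp
  also have "\<dots> = li Y \<star> (lu Y \<star> (Id U \<boxdot> f)) \<star> li X" by (simp only: lu_nat assms)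
  also have "\<dots> = (Id U \<boxdot> f) \<star> li X" by simp
  finally show ?thesis .
qed

lemma Cv_nat:
  assumes [simp]: "ob V" "ob D" "ar i" "dom i = U" "cod i = V \<boxtimes> D"
    and [simp]: "ar f" "dom f = X" "cod f = Y"
  shows "Cv i V D Y \<star> f = (Id V \<boxdot> (Id D \<boxdot> f)) \<star> Cv i V D X"
proof -
  have [simp]: "ob X" "ob Y" using ob_dom[of f] ob_cod[of f] by simp_all
  have "Cv i V D Y \<star> f = as V D Y \<star> ((i \<boxdot> Id Y) \<star> (Id U \<boxdot> f)) \<star> li X"
    by (simp add: Cv_def li_nat)
  also have "\<dots> = as V D Y \<star> (Id (V \<boxtimes> D) \<boxdot> f) \<star> (i \<boxdot> Id X) \<star> li X"
    by (simp add: interchange[of i f U "V \<boxtimes> D" X Y])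
  also have "\<dots> = (Id V \<boxdot> (Id D \<boxdot> f)) \<star> Cv i V D X"
    by (simp add: Cv_def comp_reassoc[OF as_nat3])
  finally show ?thesis .
qed

definition snake1 :: "'x \<Rightarrow> 'x \<Rightarrow> 'a \<Rightarrow> 'a \<Rightarrow> bool" where
  "snake1 V D e i \<longleftrightarrow> ru V \<star> (Id V \<boxdot> e) \<star> as V D V \<star> (i \<boxdot> Id V) \<star> li V = Id V"

definition snake2 :: "'x \<Rightarrow> 'x \<Rightarrow> 'a \<Rightarrow> 'a \<Rightarrow> bool" where
  "snake2 V D e i \<longleftrightarrow> lu D \<star> (e \<boxdot> Id D) \<star> ai D V D \<star> (Id D \<boxdot> i) \<star> ri D = Id D"

text \<open>The first rigidity axiom tensored with \<open>X\<close>, with the constraints moved into the definitions of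
  the natural transformations; the next lemma does this for the second one.\<close>

lemma zigzag_left:
  assumes [simp]: "ob V" "ob D" "ar e" "dom e = D \<boxtimes> V" "cod e = U"
    "ar i" "dom i = U" "cod i = V \<boxtimes> D" and snake: "snake1 V D e i" and [simp]: "ob X"
  shows "(Id V \<boxdot> Ev e D V X) \<star> Cv i V D (V \<boxtimes> X) = Id (V \<boxtimes> X)"
proof -
  have "(Id V \<boxdot> Ev e D V X) \<star> Cv i V D (V \<boxtimes> X)
      = (Id V \<boxdot> lu X) \<star> (Id V \<boxdot> (e \<boxdot> Id X)) \<star> ((Id V \<boxdot> ai D V X) \<star> as V D (V \<boxtimes> X))
        \<star> (i \<boxdot> Id (V \<boxtimes> X)) \<star> li (V \<boxtimes> X)"
    by (simp add: Ev_def Cv_def whisker_left)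
  also have "\<dots> = (Id V \<boxdot> lu X) \<star> (Id V \<boxdot> (e \<boxdot> Id X)) \<star> as V (D \<boxtimes> V) X \<star> (as V D V \<boxdot> Id X)
        \<star> (ai (V \<boxtimes> D) V X \<star> (i \<boxdot> Id (V \<boxtimes> X))) \<star> li (V \<boxtimes> X)"
    by (simp add: pentagon_mixed)
  also have "\<dots> = (Id V \<boxdot> lu X) \<star> ((Id V \<boxdot> (e \<boxdot> Id X)) \<star> as V (D \<boxtimes> V) X) \<star> (as V D V \<boxdot> Id X)
        \<star> ((i \<boxdot> Id V) \<boxdot> Id X) \<star> (li V \<boxdot> Id X)"
    by (simp add: ai_nat1 ai_li)
  also have "\<dots> = ((Id V \<boxdot> lu X) \<star> as V U X) \<star> ((Id V \<boxdot> e) \<boxdot> Id X) \<star> (as V D V \<boxdot> Id X)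
        \<star> ((i \<boxdot> Id V) \<boxdot> Id X) \<star> (li V \<boxdot> Id X)"
    by (simp add: as_nat2[symmetric])
  also have "\<dots> = (ru V \<star> (Id V \<boxdot> e) \<star> as V D V \<star> (i \<boxdot> Id V) \<star> li V) \<boxdot> Id X"
    by (simp add: triangle whisker_right)
  finally show ?thesis
    using snake by (simp add: snake1_def)
qed

lemma zigzag_right:
  assumes [simp]: "ob V" "ob D" "ar e" "dom e = D \<boxtimes> V" "cod e = U"
    "ar i" "dom i = U" "cod i = V \<boxtimes> D" and snake: "snake2 V D e i" and [simp]: "ob X"
  shows "Ev e D V (D \<boxtimes> X) \<star> (Id D \<boxdot> Cv i V D X) = Id (D \<boxtimes> X)"
proof -
  have tri: "ai D U X \<star> (Id D \<boxdot> li X) = ri D \<boxdot> Id X"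
  proof (rule cancel_left[where h = "ru D \<boxdot> Id X" and k = "ri D \<boxdot> Id X"])
    show "(ri D \<boxdot> Id X) \<star> (ru D \<boxdot> Id X) = Id ((D \<boxtimes> U) \<boxtimes> X)"
      by (simp add: whisker_right[symmetric])
    have "(ru D \<boxdot> Id X) \<star> ai D U X \<star> (Id D \<boxdot> li X) = (Id D \<boxdot> lu X) \<star> (Id D \<boxdot> li X)"
      by (simp add: triangle[symmetric])
    then show "(ru D \<boxdot> Id X) \<star> ai D U X \<star> (Id D \<boxdot> li X) = (ru D \<boxdot> Id X) \<star> (ri D \<boxdot> Id X)"
      by (simp add: whisker_right[symmetric] whisker_left[symmetric])
  qed simp_all
  have "Ev e D V (D \<boxtimes> X) \<star> (Id D \<boxdot> Cv i V D X)
      = lu (D \<boxtimes> X) \<star> (e \<boxdot> Id (D \<boxtimes> X)) \<star> (ai D V (D \<boxtimes> X) \<star> (Id D \<boxdot> as V D X))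
        \<star> (Id D \<boxdot> (i \<boxdot> Id X)) \<star> (Id D \<boxdot> li X)"
    by (simp add: Ev_def Cv_def whisker_left)
  also have "\<dots> = lu (D \<boxtimes> X) \<star> ((e \<boxdot> Id (D \<boxtimes> X)) \<star> as (D \<boxtimes> V) D X) \<star> (ai D V D \<boxdot> Id X)
        \<star> (ai D (V \<boxtimes> D) X \<star> (Id D \<boxdot> (i \<boxdot> Id X))) \<star> (Id D \<boxdot> li X)"
    by (simp add: pentagon_mixed')
  also have "\<dots> = (lu (D \<boxtimes> X) \<star> as U D X) \<star> ((e \<boxdot> Id D) \<boxdot> Id X) \<star> (ai D V D \<boxdot> Id X)
        \<star> ((Id D \<boxdot> i) \<boxdot> Id X) \<star> (ai D U X \<star> (Id D \<boxdot> li X))"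
    by (simp add: as_nat1[symmetric] ai_nat2)
  also have "\<dots> = (lu D \<star> (e \<boxdot> Id D) \<star> ai D V D \<star> (Id D \<boxdot> i) \<star> ri D) \<boxdot> Id X"
    by (simp add: left_unitor_tensor tri whisker_right)
  finally show ?thesis
    using snake by (simp add: snake2_def)
qed

text \<open>The usual argument for the uniqueness of an adjunct, carried out on the natural transformations
  and evaluated at the unit object.\<close>

lemma pairing_unique:
  assumes [simp]: "ob V" "ob D" "ar e" "dom e = D \<boxtimes> V" "cod e = U"
    "ar e'" "dom e' = D \<boxtimes> V" "cod e' = U"
    "ar i" "dom i = U" "cod i = V \<boxtimes> D"
    and s2: "snake2 V D e i" and s1: "snake1 V D e' i"
  shows "e' = e"
proof -
  have "Ev e' D V U = Ev e' D V U \<star> Ev e D V (D \<boxtimes> V \<boxtimes> U) \<star> (Id D \<boxdot> Cv i V D (V \<boxtimes> U))"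
    by (simp add: zigzag_right[OF _ _ _ _ _ _ _ _ s2])
  also have "\<dots> = Ev e D V U \<star> (Id D \<boxdot> (Id V \<boxdot> Ev e' D V U)) \<star> (Id D \<boxdot> Cv i V D (V \<boxtimes> U))"
    by (simp add: comp_reassoc[OF Ev_nat[of V D e "Ev e' D V U" "D \<boxtimes> V \<boxtimes> U" U]])
  also have "\<dots> = Ev e D V U"
    by (simp add: whisker_left[symmetric] zigzag_left[OF _ _ _ _ _ _ _ _ s1])
  finally have "Ev e' D V U \<star> as D V U \<star> ri (D \<boxtimes> V) = Ev e D V U \<star> as D V U \<star> ri (D \<boxtimes> V)"
    by simp
  then have "lu U \<star> ((e' \<boxdot> Id U) \<star> ri (D \<boxtimes> V)) = lu U \<star> ((e \<boxdot> Id U) \<star> ri (D \<boxtimes> V))"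
    by (simp add: Ev_def)
  then have "(e' \<boxdot> Id U) \<star> ri (D \<boxtimes> V) = (e \<boxdot> Id U) \<star> ri (D \<boxtimes> V)"
    by (rule cancel_left[where k = "li U" and Y = "U \<boxtimes> U", rotated]) simp_all
  then have "ru U \<star> (e' \<boxdot> Id U) \<star> ri (D \<boxtimes> V) = ru U \<star> (e \<boxdot> Id U) \<star> ri (D \<boxtimes> V)"
    by simp
  then show ?thesis
    by (simp add: comp_reassoc[OF ru_nat])
qed

text \<open>Two duals of \<open>V\<close> are related by \<open>D \<rightarrow> D \<otimes> (V \<otimes> D') \<rightarrow> D'\<close>. That this map respects the
  copairings is a zigzag identity. It respects the pairings because \<open>e' (\<phi> \<otimes> 1)\<close> satisfies the
  first rigidity axiom together with \<open>i\<close>, which determines it.\<close>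

lemma dual_unique:
  assumes [simp]: "ob V" "ob D" "ar e" "dom e = D \<boxtimes> V" "cod e = U"
    "ar i" "dom i = U" "cod i = V \<boxtimes> D"
    and s1: "snake1 V D e i" and s2: "snake2 V D e i"
    and [simp]: "ob D'" "ar e'" "dom e' = D' \<boxtimes> V" "cod e' = U"
    "ar i'" "dom i' = U" "cod i' = V \<boxtimes> D'"
    and s1': "snake1 V D' e' i'"
  obtains \<phi> where "ar \<phi>" "dom \<phi> = D" "cod \<phi> = D'" "(Id V \<boxdot> \<phi>) \<star> i = i'" "e' \<star> (\<phi> \<boxdot> Id V) = e"
proof -
  define P where "P = Ev e D V (D' \<boxtimes> U) \<star> (Id D \<boxdot> Cv i' V D' U)"
  have P [simp]: "ar P" "dom P = D \<boxtimes> U" "cod P = D' \<boxtimes> U"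
    by (simp_all add: P_def)
  have "(Id V \<boxdot> P) \<star> Cv i V D U
      = (Id V \<boxdot> Ev e D V (D' \<boxtimes> U)) \<star> (Id V \<boxdot> (Id D \<boxdot> Cv i' V D' U)) \<star> Cv i V D U"
    by (simp add: P_def whisker_left)
  also have "\<dots> = (Id V \<boxdot> Ev e D V (D' \<boxtimes> U)) \<star> Cv i V D (V \<boxtimes> D' \<boxtimes> U) \<star> Cv i' V D' U"
    by (simp add: Cv_nat)
  also have "\<dots> = Cv i' V D' U"
    by (simp add: comp_reassoc[OF zigzag_left[OF _ _ _ _ _ _ _ _ s1]])
  finally have PC: "(Id V \<boxdot> P) \<star> Cv i V D U = Cv i' V D' U" .
  define \<phi> where "\<phi> = ru D' \<star> P \<star> ri D"
  have \<phi> [simp]: "ar \<phi>" "dom \<phi> = D" "cod \<phi> = D'"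
    by (simp_all add: \<phi>_def)
  have ruC: "(Id V \<boxdot> ru E) \<star> Cv j V E U = j \<star> ru U \<star> li U"
    if [simp]: "ob E" "ar j" "dom j = U" "cod j = V \<boxtimes> E" for j E
    by (simp add: Cv_def comp_reassoc[OF right_unitor_tensor] comp_reassoc[OF ru_nat])
  have "\<phi> \<star> ru D = ru D' \<star> P"
    by (simp add: \<phi>_def)
  then have "(Id V \<boxdot> \<phi>) \<star> (Id V \<boxdot> ru D) = (Id V \<boxdot> ru D') \<star> (Id V \<boxdot> P)"
    by (simp add: whisker_left[symmetric])
  then have "((Id V \<boxdot> \<phi>) \<star> (Id V \<boxdot> ru D)) \<star> Cv i V D U = ((Id V \<boxdot> ru D') \<star> (Id V \<boxdot> P)) \<star> Cv i V D U"
    by simp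
  then have "((Id V \<boxdot> \<phi>) \<star> i) \<star> (ru U \<star> li U) = i' \<star> (ru U \<star> li U)"
    by (simp add: PC ruC)
  then have i': "(Id V \<boxdot> \<phi>) \<star> i = i'"
    by (rule cancel_right[where k = "lu U \<star> ri U" and Y = U, rotated]) simp_all
  have "snake1 V D (e' \<star> (\<phi> \<boxdot> Id V)) i"
  proof -
    have "ru V \<star> (Id V \<boxdot> (e' \<star> (\<phi> \<boxdot> Id V))) \<star> as V D V \<star> (i \<boxdot> Id V) \<star> li V
        = ru V \<star> (Id V \<boxdot> e') \<star> ((Id V \<boxdot> (\<phi> \<boxdot> Id V)) \<star> as V D V) \<star> (i \<boxdot> Id V) \<star> li V"
      by (simp add: whisker_left)
    also have "\<dots> = ru V \<star> (Id V \<boxdot> e') \<star> as V D' V \<star> (((Id V \<boxdot> \<phi>) \<star> i) \<boxdot> Id V) \<star> li V"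
      by (simp add: as_nat2[symmetric] whisker_right)
    finally show ?thesis
      using s1' by (simp add: snake1_def i')
  qed
  then have "e' \<star> (\<phi> \<boxdot> Id V) = e"
    by (intro pairing_unique[OF _ _ _ _ _ _ _ _ _ _ _ s2]) simp_all
  then show thesis
    by (rule that[OF \<phi> i'])
qed

text \<open>Scalars enter only through this: the family \<open>c \<cdot> id\<^sub>X\<close> is natural and compatible with tensor
  products.\<close>

definition scalar_family :: "('x \<Rightarrow> 'a) \<Rightarrow> bool" where
  "scalar_family K \<longleftrightarrow>
    (\<forall>X. (ob X \<longrightarrow> ar (K X)) \<and> dom (K X) = X \<and> cod (K X) = X) \<and>
    (\<forall>f. ar f \<longrightarrow> K (cod f) \<star> f = f \<star> K (dom f)) \<and>
    (\<forall>X Y. ob X \<longrightarrow> ob Y \<longrightarrow> K X \<boxdot> Id Y = K (X \<boxtimes> Y) \<and> Id X \<boxdot> K Y = K (X \<boxtimes> Y))"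

end

section \<open>The monad of a Frobenius algebra\<close>

text \<open>The last assumption is \<open>\<Sum> \<theta>(x\<^sub>j) x\<^sup>j = \<kappa> 1\<close> with \<open>K\<close> the family of multiplications by \<open>\<kappa>\<close>.\<close>

locale traced_frobenius_algebra =
  monoidal_arrows ob ar dom cod Id cmp tob tar U as ai lu li ru ri
  for ob :: "'x \<Rightarrow> bool" and ar :: "'a \<Rightarrow> bool" and dom cod :: "'a \<Rightarrow> 'x"
    and Id :: "'x \<Rightarrow> 'a" and cmp :: "'a \<Rightarrow> 'a \<Rightarrow> 'a"  (infixr \<open>\<star>\<close> 60)
    and tob :: "'x \<Rightarrow> 'x \<Rightarrow> 'x"  (infixr \<open>\<boxtimes>\<close> 75)
    and tar :: "'a \<Rightarrow> 'a \<Rightarrow> 'a"  (infixr \<open>\<boxdot>\<close> 75)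
    and U :: 'x and as ai :: "'x \<Rightarrow> 'x \<Rightarrow> 'x \<Rightarrow> 'a" and lu li ru ri :: "'x \<Rightarrow> 'a" +
  fixes A :: 'x and \<mu> \<iota> \<epsilon> i \<theta> :: 'a and K L :: "'x \<Rightarrow> 'a"
  assumes A [simp]: "ob A"
    and \<mu> [simp]: "ar \<mu>" "dom \<mu> = A \<boxtimes> A" "cod \<mu> = A"
    and \<iota> [simp]: "ar \<iota>" "dom \<iota> = U" "cod \<iota> = A"
    and \<epsilon> [simp]: "ar \<epsilon>" "dom \<epsilon> = A" "cod \<epsilon> = U"
    and i [simp]: "ar i" "dom i = U" "cod i = A \<boxtimes> A"
    and \<theta> [simp]: "ar \<theta>" "dom \<theta> = A" "cod \<theta> = A"
    and \<mu>_assoc: "\<mu> \<star> (\<mu> \<boxdot> Id A) = \<mu> \<star> (Id A \<boxdot> \<mu>) \<star> as A A A"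
    and \<mu>_unit: "\<mu> \<star> (\<iota> \<boxdot> Id A) = lu A"
    and snake1: "snake1 A A (\<epsilon> \<star> \<mu>) i"
    and snake2: "snake2 A A (\<epsilon> \<star> \<mu>) i"
    and \<theta>_\<mu>: "\<theta> \<star> \<mu> = \<mu> \<star> (\<theta> \<boxdot> \<theta>)"
    and K: "scalar_family K" and L: "scalar_family L"
    and KL: "ob X \<Longrightarrow> K X \<star> L X = Id X"
    and trace: "\<mu> \<star> (\<theta> \<boxdot> Id A) \<star> i = \<iota> \<star> K U"
begin

definition mult_at :: "'x \<Rightarrow> 'a" where "mult_at X = (\<mu> \<boxdot> Id X) \<star> ai A A X"
definition unit_at :: "'x \<Rightarrow> 'a" where "unit_at X = (\<iota> \<boxdot> Id X) \<star> li X"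
definition counit_at :: "'x \<Rightarrow> 'a" where "counit_at X = lu X \<star> (\<epsilon> \<boxdot> Id X)"

lemma counit_mult_eq_Ev: "ob X \<Longrightarrow> counit_at X \<star> mult_at X = Ev (\<epsilon> \<star> \<mu>) A A X"
  by (simp add: mult_at_def counit_at_def Ev_def whisker_right)

lemma mult_at_nat: "ar f \<Longrightarrow> dom f = X \<Longrightarrow> cod f = Y \<Longrightarrow> mult_at Y \<star> (Id A \<boxdot> (Id A \<boxdot> f)) = (Id A \<boxdot> f) \<star> mult_at X"
proof -
  assume [simp]: "ar f" "dom f = X" "cod f = Y"
  have [simp]: "ob X" "ob Y" using ob_dom[of f] ob_cod[of f] by simp_all
  show ?thesis
    by (simp add: mult_at_def ai_nat3 comp_reassoc[OF interchange[of \<mu> f "A \<boxtimes> A" A X Y]])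
qed

lemma mult_at_assoc: "ob X \<Longrightarrow> mult_at X \<star> mult_at (A \<boxtimes> X) = mult_at X \<star> (Id A \<boxdot> mult_at X)"
proof -
  assume [simp]: "ob X"
  have "mult_at X \<star> (Id A \<boxdot> mult_at X)
      = (\<mu> \<boxdot> Id X) \<star> (ai A A X \<star> (Id A \<boxdot> (\<mu> \<boxdot> Id X))) \<star> (Id A \<boxdot> ai A A X)"
    by (simp add: mult_at_def whisker_left)
  also have "\<dots> = (\<mu> \<boxdot> Id X) \<star> ((Id A \<boxdot> \<mu>) \<boxdot> Id X) \<star> ai A (A \<boxtimes> A) X \<star> (Id A \<boxdot> ai A A X)"
    by (simp add: ai_nat2)
  also have "\<dots> = (\<mu> \<boxdot> Id X) \<star> ((Id A \<boxdot> \<mu>) \<boxdot> Id X) \<star> ai A (A \<boxtimes> A) X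
      \<star> ((Id A \<boxdot> ai A A X) \<star> as A A (A \<boxtimes> X)) \<star> ai A A (A \<boxtimes> X)"
    by simp
  also have "\<dots> = ((\<mu> \<star> (Id A \<boxdot> \<mu>) \<star> as A A A) \<boxdot> Id X) \<star> ai (A \<boxtimes> A) A X \<star> ai A A (A \<boxtimes> X)"
    by (simp only: pentagon_mixed A \<open>ob X\<close>) (simp add: whisker_right)
  also have "\<dots> = (\<mu> \<boxdot> Id X) \<star> (((\<mu> \<boxdot> Id A) \<boxdot> Id X) \<star> ai (A \<boxtimes> A) A X) \<star> ai A A (A \<boxtimes> X)"
    by (simp add: \<mu>_assoc[symmetric] whisker_right)
  also have "\<dots> = mult_at X \<star> mult_at (A \<boxtimes> X)"
    by (simp add: mult_at_def ai_nat1[symmetric])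
  finally show ?thesis by simp
qed

lemma unit_at_nat: "ar f \<Longrightarrow> dom f = X \<Longrightarrow> cod f = Y \<Longrightarrow> unit_at Y \<star> f = (Id A \<boxdot> f) \<star> unit_at X"
proof -
  assume [simp]: "ar f" "dom f = X" "cod f = Y"
  have [simp]: "ob X" "ob Y" using ob_dom[of f] ob_cod[of f] by simp_all
  show ?thesis
    by (simp add: unit_at_def li_nat comp_reassoc[OF interchange[of \<iota> f U A X Y]])
qed

lemma mult_at_unit: "ob X \<Longrightarrow> mult_at X \<star> unit_at (A \<boxtimes> X) = Id (A \<boxtimes> X)"
proof -
  assume [simp]: "ob X"
  have "mult_at X \<star> unit_at (A \<boxtimes> X) = (\<mu> \<boxdot> Id X) \<star> (ai A A X \<star> (\<iota> \<boxdot> Id (A \<boxtimes> X))) \<star> li (A \<boxtimes> X)"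
    by (simp add: mult_at_def unit_at_def)
  also have "\<dots> = ((\<mu> \<star> (\<iota> \<boxdot> Id A)) \<boxdot> Id X) \<star> (li A \<boxdot> Id X)"
    by (simp add: ai_nat1 ai_li whisker_right)
  also have "\<dots> = Id (A \<boxtimes> X)"
    by (simp add: \<mu>_unit whisker_right[symmetric])
  finally show ?thesis .
qed

lemma counit_at_nat: "ar f \<Longrightarrow> dom f = X \<Longrightarrow> cod f = Y \<Longrightarrow> counit_at Y \<star> (Id A \<boxdot> f) = f \<star> counit_at X"
proof -
  assume [simp]: "ar f" "dom f = X" "cod f = Y"
  have [simp]: "ob X" "ob Y" using ob_dom[of f] ob_cod[of f] by simp_all
  show ?thesis
    by (simp add: counit_at_def interchange[of \<epsilon> f A U X Y] comp_reassoc[OF lu_nat])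
qed

sublocale monad: frobenius_monad ob ar dom cod Id "(\<star>)" "\<lambda>X. A \<boxtimes> X" "\<lambda>f. Id A \<boxdot> f"
    mult_at unit_at counit_at "Cv i A A"
proof unfold_locales
  fix X assume X [simp]: "ob X"
  show "(Id A \<boxdot> (counit_at X \<star> mult_at X)) \<star> Cv i A A (A \<boxtimes> X) = Id (A \<boxtimes> X)"
    by (simp add: counit_mult_eq_Ev zigzag_left[OF _ _ _ _ _ _ _ _ snake1])
  show "counit_at (A \<boxtimes> X) \<star> mult_at (A \<boxtimes> X) \<star> (Id A \<boxdot> Cv i A A X) = Id (A \<boxtimes> X)"
  proof -
    have "counit_at (A \<boxtimes> X) \<star> mult_at (A \<boxtimes> X) \<star> (Id A \<boxdot> Cv i A A X)
        = (counit_at (A \<boxtimes> X) \<star> mult_at (A \<boxtimes> X)) \<star> (Id A \<boxdot> Cv i A A X)"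
      by (rule cmp_assoc[symmetric]) (simp_all add: mult_at_def counit_at_def)
    then show ?thesis
      by (simp add: counit_mult_eq_Ev zigzag_right[OF _ _ _ _ _ _ _ _ snake2])
  qed
qed (simp_all add: mult_at_nat mult_at_assoc unit_at_nat mult_at_unit counit_at_nat whisker_left Cv_nat,
    simp_all add: mult_at_def unit_at_def counit_at_def)

text \<open>The trace identity for the twist becomes one for the identity, because the twist acts trivially.\<close>

lemma special: "special_frobenius_monad ob ar dom cod Id (\<star>) (\<lambda>X. A \<boxtimes> X) (\<lambda>f. Id A \<boxdot> f)
    mult_at unit_at counit_at (Cv i A A) L"
proof -
  have K_type [simp]: "\<And>X. ob X \<Longrightarrow> ar (K X)" "\<And>X. dom (K X) = X" "\<And>X. cod (K X) = X"
    and K_nat: "\<And>f X Y. ar f \<Longrightarrow> dom f = X \<Longrightarrow> cod f = Y \<Longrightarrow> K Y \<star> f = f \<star> K X"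
    and K_tensor: "\<And>X Y. ob X \<Longrightarrow> ob Y \<Longrightarrow> K X \<boxdot> Id Y = K (X \<boxtimes> Y)"
      "\<And>X Y. ob X \<Longrightarrow> ob Y \<Longrightarrow> Id X \<boxdot> K Y = K (X \<boxtimes> Y)"
    using K by (auto simp: scalar_family_def)
  have L_type [simp]: "\<And>X. ob X \<Longrightarrow> ar (L X)" "\<And>X. dom (L X) = X" "\<And>X. cod (L X) = X"
    and L_nat: "\<And>f X Y. ar f \<Longrightarrow> dom f = X \<Longrightarrow> cod f = Y \<Longrightarrow> L Y \<star> f = f \<star> L X"
    and L_tensor: "\<And>X Y. ob X \<Longrightarrow> ob Y \<Longrightarrow> Id X \<boxdot> L Y = L (X \<boxtimes> Y)"
    using L by (auto simp: scalar_family_def)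
  have tr: "mult_at X \<star> (\<theta> \<boxdot> Id (A \<boxtimes> X)) \<star> Cv i A A X = unit_at X \<star> K X" if [simp]: "ob X" for X
  proof -
    have "mult_at X \<star> (\<theta> \<boxdot> Id (A \<boxtimes> X)) \<star> Cv i A A X
        = (\<mu> \<boxdot> Id X) \<star> (ai A A X \<star> (\<theta> \<boxdot> Id (A \<boxtimes> X))) \<star> as A A X \<star> (i \<boxdot> Id X) \<star> li X"
      by (simp add: mult_at_def Cv_def)
    also have "\<dots> = ((\<mu> \<star> (\<theta> \<boxdot> Id A) \<star> i) \<boxdot> Id X) \<star> li X"
      by (simp add: ai_nat1 whisker_right)
    also have "\<dots> = (\<iota> \<boxdot> Id X) \<star> (K U \<boxdot> Id X) \<star> li X"
      by (simp add: trace whisker_right)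
    also have "\<dots> = unit_at X \<star> K X"
      by (simp add: K_tensor K_nat unit_at_def)
    finally show ?thesis .
  qed
  have \<theta>_mm: "(\<theta> \<boxdot> Id X) \<star> mult_at X = mult_at X \<star> (\<theta> \<boxdot> Id (A \<boxtimes> X)) \<star> (Id A \<boxdot> (\<theta> \<boxdot> Id X))"
    if [simp]: "ob X" for X
  proof -
    have "mult_at X \<star> (\<theta> \<boxdot> Id (A \<boxtimes> X)) \<star> (Id A \<boxdot> (\<theta> \<boxdot> Id X))
        = (\<mu> \<boxdot> Id X) \<star> (ai A A X \<star> (\<theta> \<boxdot> (\<theta> \<boxdot> Id X)))"
      using tar_cmp[of "Id A" \<theta> "\<theta> \<boxdot> Id X" "Id (A \<boxtimes> X)"] by (simp add: mult_at_def)
    also have "\<dots> = ((\<mu> \<star> (\<theta> \<boxdot> \<theta>)) \<boxdot> Id X) \<star> ai A A X"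
      by (simp add: ai_nat[of \<theta> \<theta> "Id X" A A X A A X] whisker_right)
    also have "\<dots> = (\<theta> \<boxdot> Id X) \<star> mult_at X"
      by (simp add: \<theta>_\<mu>[symmetric] whisker_right mult_at_def)
    finally show ?thesis by simp
  qed
  have triv: "\<theta> \<boxdot> Id X = Id (A \<boxtimes> X)" if "ob X" for X
  proof (rule monad.twist_trivial[where \<Theta> = "\<lambda>X. \<theta> \<boxdot> Id X" and K = K and L = L])
    show "(\<theta> \<boxdot> Id Y) \<star> (Id A \<boxdot> f) = (Id A \<boxdot> f) \<star> (\<theta> \<boxdot> Id X)"
      if "ar f" "dom f = X" "cod f = Y" for f X Y
      using interchange[of \<theta> f A A X Y] that by simp
    show "K Y \<star> f = f \<star> K X" if "ar f" "dom f = X" "cod f = Y" for f X Y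
      using that by (rule K_nat)
  qed (use that in \<open>simp_all add: \<theta>_mm K_tensor KL tr\<close>)
  show "special_frobenius_monad ob ar dom cod Id (\<star>) (\<lambda>X. A \<boxtimes> X) (\<lambda>f. Id A \<boxdot> f)
    mult_at unit_at counit_at (Cv i A A) L"
  proof unfold_locales
    fix X assume X [simp]: "ob X"
    have "mult_at X \<star> Cv i A A X = unit_at X \<star> K X"
      using tr[OF X] by (simp add: triv)
    then show "mult_at X \<star> Cv i A A X \<star> L X = unit_at X"
      by (simp add: comp_reassoc KL)
  qed (simp_all add: L_nat L_tensor)
qed

end

section \<open>Typed arrows of a tensor category\<close>

text \<open>
  Hom sets of the base category may overlap, so arrows carry their source and target explicitly.
\<close>

datatype ('o, 'm) arrow = Arrow (src: 'o) (tgt: 'o) (mor: 'm)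

context tensor_category
begin

definition typed :: "('o, 'm) arrow \<Rightarrow> bool" where
  "typed f \<longleftrightarrow> src f \<in> Ob C \<and> tgt f \<in> Ob C \<and> mor f \<in> arr C (src f) (tgt f)"

definition ident_arrow :: "'o \<Rightarrow> ('o, 'm) arrow" where
  "ident_arrow X = Arrow X X (Ident C X)"

definition comp_arrow :: "('o, 'm) arrow \<Rightarrow> ('o, 'm) arrow \<Rightarrow> ('o, 'm) arrow"  (infixr \<open>\<star>\<close> 60) where
  "g \<star> f = Arrow (src f) (tgt g) (mor g \<cdot> mor f)"

definition tensor_arrow :: "('o, 'm) arrow \<Rightarrow> ('o, 'm) arrow \<Rightarrow> ('o, 'm) arrow"  (infixr \<open>\<boxdot>\<close> 75) where
  "f \<boxdot> g = Arrow (src f \<otimes>\<^sub>o src g) (tgt f \<otimes>\<^sub>o tgt g) (mor f \<otimes>\<^sub>m mor g)"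

definition assoc_arrow :: "'o \<Rightarrow> 'o \<Rightarrow> 'o \<Rightarrow> ('o, 'm) arrow" where
  "assoc_arrow X Y Z = Arrow ((X \<otimes>\<^sub>o Y) \<otimes>\<^sub>o Z) (X \<otimes>\<^sub>o (Y \<otimes>\<^sub>o Z)) (Assoc C X Y Z)"

definition lunit_arrow :: "'o \<Rightarrow> ('o, 'm) arrow" where
  "lunit_arrow X = Arrow (TUnit C \<otimes>\<^sub>o X) X (LUnit C X)"

definition runit_arrow :: "'o \<Rightarrow> ('o, 'm) arrow" where
  "runit_arrow X = Arrow (X \<otimes>\<^sub>o TUnit C) X (RUnit C X)"

definition inv_arrow :: "('o, 'm) arrow \<Rightarrow> ('o, 'm) arrow" where
  "inv_arrow f = Arrow (tgt f) (src f) (arr_inv C (src f) (tgt f) (mor f))"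

lemma inv_arrow:
  assumes "src f \<in> Ob C" "tgt f \<in> Ob C" "is_iso C (src f) (tgt f) (mor f)"
  shows "typed f" "typed (inv_arrow f)" "f \<star> inv_arrow f = ident_arrow (tgt f)"
    "inv_arrow f \<star> f = ident_arrow (src f)"
  using inverse_arr_arr_inv[OF assms] assms
  by (auto simp: inverse_arr_def typed_def inv_arrow_def comp_arrow_def ident_arrow_def)

lemma arrow_eqI: "src f = src g \<Longrightarrow> tgt f = tgt g \<Longrightarrow> mor f = mor g \<Longrightarrow> f = g"
  by (cases f; cases g) simp

sublocale typed: monoidal_arrows "\<lambda>X. X \<in> Ob C" typed src tgt ident_arrow comp_arrow "TObj C"
  tensor_arrow "TUnit C" assoc_arrow "\<lambda>X Y Z. inv_arrow (assoc_arrow X Y Z)"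
  lunit_arrow "\<lambda>X. inv_arrow (lunit_arrow X)" runit_arrow "\<lambda>X. inv_arrow (runit_arrow X)"
proof unfold_locales
  fix f g h :: "('o, 'm) arrow" and f' g' :: "('o, 'm) arrow"
    and W X Y Z X' Y' Z' :: 'o
  show "src f \<in> Ob C" "tgt f \<in> Ob C" if "typed f" using that by (simp_all add: typed_def)
  show "src (ident_arrow X) = X" "tgt (ident_arrow X) = X" by (simp_all add: ident_arrow_def)
  show "typed (ident_arrow X)" if "X \<in> Ob C"
    using that by (simp add: typed_def ident_arrow_def Ident_closed)
  show "src (g \<star> f) = src f" "tgt (g \<star> f) = tgt g" by (simp_all add: comp_arrow_def)
  show "typed (g \<star> f)" if "typed f" "typed g" "tgt f = src g"
    using that Comp_closed[of "src f" "src g" "tgt g"] by (simp add: typed_def comp_arrow_def)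
  show "ident_arrow Y \<star> f = f" if "typed f" "tgt f = Y"
    using that by (intro arrow_eqI) (auto simp: typed_def comp_arrow_def ident_arrow_def Comp_Ident_left)
  show "f \<star> ident_arrow X = f" if "typed f" "src f = X"
    using that by (intro arrow_eqI) (auto simp: typed_def comp_arrow_def ident_arrow_def Comp_Ident_right)
  show "(h \<star> g) \<star> f = h \<star> g \<star> f" if "typed f" "typed g" "typed h" "tgt f = src g" "tgt g = src h"
    using that Comp_assoc[of "src f" "src g" "src h" "tgt h" "mor f" "mor g" "mor h"]
    by (simp add: typed_def comp_arrow_def)
  show "X \<otimes>\<^sub>o Y \<in> Ob C" if "X \<in> Ob C" "Y \<in> Ob C" using that by (rule TObj_closed)
  show "typed (f \<boxdot> g)" if "typed f" "typed g"
    using that by (simp add: typed_def tensor_arrow_def TObj_closed TMor_closed)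
  show "src (f \<boxdot> g) = src f \<otimes>\<^sub>o src g" "tgt (f \<boxdot> g) = tgt f \<otimes>\<^sub>o tgt g"
    by (simp_all add: tensor_arrow_def)
  show "ident_arrow X \<boxdot> ident_arrow Y = ident_arrow (X \<otimes>\<^sub>o Y)" if "X \<in> Ob C" "Y \<in> Ob C"
    using that by (simp add: tensor_arrow_def ident_arrow_def TMor_Ident)
  show "(f' \<star> f) \<boxdot> (g' \<star> g) = (f' \<boxdot> g') \<star> (f \<boxdot> g)"
    if "typed f" "typed f'" "typed g" "typed g'" "tgt f = src f'" "tgt g = src g'"
    using that TMor_Comp[of "src f" "src f'" "tgt f'" "src g" "src g'" "tgt g'" "mor f" "mor f'" "mor g" "mor g'"]
    by (simp add: typed_def tensor_arrow_def comp_arrow_def)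
  show "TUnit C \<in> Ob C" by (rule TUnit_closed)
  {
    assume o: "X \<in> Ob C" "Y \<in> Ob C" "Z \<in> Ob C"
    have *: "src (assoc_arrow X Y Z) \<in> Ob C" "tgt (assoc_arrow X Y Z) \<in> Ob C"
      "is_iso C (src (assoc_arrow X Y Z)) (tgt (assoc_arrow X Y Z)) (mor (assoc_arrow X Y Z))"
      using o Assoc_iso[OF o] by (simp_all add: assoc_arrow_def TObj_closed)
    show "typed (assoc_arrow X Y Z)" "typed (inv_arrow (assoc_arrow X Y Z))"
      by (rule inv_arrow[OF *])+
    show "assoc_arrow X Y Z \<star> inv_arrow (assoc_arrow X Y Z) = ident_arrow (X \<otimes>\<^sub>o (Y \<otimes>\<^sub>o Z))"
      "inv_arrow (assoc_arrow X Y Z) \<star> assoc_arrow X Y Z = ident_arrow ((X \<otimes>\<^sub>o Y) \<otimes>\<^sub>o Z)"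
      using inv_arrow(3,4)[OF *] by (simp_all add: assoc_arrow_def)
  }
  {
    assume X: "X \<in> Ob C"
    have *: "src (lunit_arrow X) \<in> Ob C" "tgt (lunit_arrow X) \<in> Ob C"
      "is_iso C (src (lunit_arrow X)) (tgt (lunit_arrow X)) (mor (lunit_arrow X))"
      using X LUnit_iso[OF X] by (simp_all add: lunit_arrow_def TObj_closed TUnit_closed)
    show "typed (lunit_arrow X)" "typed (inv_arrow (lunit_arrow X))"
      by (rule inv_arrow[OF *])+
    show "lunit_arrow X \<star> inv_arrow (lunit_arrow X) = ident_arrow X"
      "inv_arrow (lunit_arrow X) \<star> lunit_arrow X = ident_arrow (TUnit C \<otimes>\<^sub>o X)"
      using inv_arrow(3,4)[OF *] by (simp_all add: lunit_arrow_def)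
    have *: "src (runit_arrow X) \<in> Ob C" "tgt (runit_arrow X) \<in> Ob C"
      "is_iso C (src (runit_arrow X)) (tgt (runit_arrow X)) (mor (runit_arrow X))"
      using X RUnit_iso[OF X] by (simp_all add: runit_arrow_def TObj_closed TUnit_closed)
    show "typed (runit_arrow X)" "typed (inv_arrow (runit_arrow X))"
      by (rule inv_arrow[OF *])+
    show "runit_arrow X \<star> inv_arrow (runit_arrow X) = ident_arrow X"
      "inv_arrow (runit_arrow X) \<star> runit_arrow X = ident_arrow (X \<otimes>\<^sub>o TUnit C)"
      using inv_arrow(3,4)[OF *] by (simp_all add: runit_arrow_def)
  }
  show "src (assoc_arrow X Y Z) = (X \<otimes>\<^sub>o Y) \<otimes>\<^sub>o Z" "tgt (assoc_arrow X Y Z) = X \<otimes>\<^sub>o (Y \<otimes>\<^sub>o Z)"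
    "src (inv_arrow (assoc_arrow X Y Z)) = X \<otimes>\<^sub>o (Y \<otimes>\<^sub>o Z)"
    "tgt (inv_arrow (assoc_arrow X Y Z)) = (X \<otimes>\<^sub>o Y) \<otimes>\<^sub>o Z"
    "src (lunit_arrow X) = TUnit C \<otimes>\<^sub>o X" "tgt (lunit_arrow X) = X"
    "src (inv_arrow (lunit_arrow X)) = X" "tgt (inv_arrow (lunit_arrow X)) = TUnit C \<otimes>\<^sub>o X"
    "src (runit_arrow X) = X \<otimes>\<^sub>o TUnit C" "tgt (runit_arrow X) = X"
    "src (inv_arrow (runit_arrow X)) = X" "tgt (inv_arrow (runit_arrow X)) = X \<otimes>\<^sub>o TUnit C"
    by (simp_all add: assoc_arrow_def lunit_arrow_def runit_arrow_def inv_arrow_def)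
  show "assoc_arrow X' Y' Z' \<star> (f \<boxdot> g) \<boxdot> h = f \<boxdot> g \<boxdot> h \<star> assoc_arrow X Y Z"
    if "typed f" "typed g" "typed h" "src f = X" "src g = Y" "src h = Z" "tgt f = X'" "tgt g = Y'" "tgt h = Z'"
    using that Assoc_natural[of X X' Y Y' Z Z' "mor f" "mor g" "mor h"]
    by (auto simp add: typed_def tensor_arrow_def comp_arrow_def assoc_arrow_def)
  show "lunit_arrow Y \<star> ident_arrow (TUnit C) \<boxdot> f = f \<star> lunit_arrow X"
    "runit_arrow Y \<star> f \<boxdot> ident_arrow (TUnit C) = f \<star> runit_arrow X"
    if "typed f" "src f = X" "tgt f = Y"
    using that LUnit_natural[of X Y "mor f"] RUnit_natural[of X Y "mor f"]
    by (auto simp add: typed_def tensor_arrow_def comp_arrow_def lunit_arrow_def runit_arrow_def ident_arrow_def)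
  show "ident_arrow W \<boxdot> assoc_arrow X Y Z \<star> assoc_arrow W (X \<otimes>\<^sub>o Y) Z \<star> assoc_arrow W X Y \<boxdot> ident_arrow Z
      = assoc_arrow W X (Y \<otimes>\<^sub>o Z) \<star> assoc_arrow (W \<otimes>\<^sub>o X) Y Z"
    if o: "W \<in> Ob C" "X \<in> Ob C" "Y \<in> Ob C" "Z \<in> Ob C"
  proof -
    have a: "Assoc C X Y Z \<in> arr C ((X \<otimes>\<^sub>o Y) \<otimes>\<^sub>o Z) (X \<otimes>\<^sub>o (Y \<otimes>\<^sub>o Z))"
      if "X \<in> Ob C" "Y \<in> Ob C" "Z \<in> Ob C" for X Y Z
      using Assoc_iso[OF that] by (auto simp: is_iso_def inverse_arr_def)
    show ?thesis
      using pentagon[OF o] Comp_assoc[of "((W \<otimes>\<^sub>o X) \<otimes>\<^sub>o Y) \<otimes>\<^sub>o Z" "(W \<otimes>\<^sub>o (X \<otimes>\<^sub>o Y)) \<otimes>\<^sub>o Z"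
          "W \<otimes>\<^sub>o ((X \<otimes>\<^sub>o Y) \<otimes>\<^sub>o Z)" "W \<otimes>\<^sub>o (X \<otimes>\<^sub>o (Y \<otimes>\<^sub>o Z))"
          "Assoc C W X Y \<otimes>\<^sub>m Ident C Z" "Assoc C W (X \<otimes>\<^sub>o Y) Z" "Ident C W \<otimes>\<^sub>m Assoc C X Y Z"]
      by (simp add: tensor_arrow_def comp_arrow_def assoc_arrow_def ident_arrow_def o a
          TObj_closed TMor_closed Ident_closed)
  qed
  show "ident_arrow X \<boxdot> lunit_arrow Y \<star> assoc_arrow X (TUnit C) Y = runit_arrow X \<boxdot> ident_arrow Y"
    if "X \<in> Ob C" "Y \<in> Ob C"
    using that triangle[of X Y]
    by (simp add: tensor_arrow_def comp_arrow_def assoc_arrow_def ident_arrow_def lunit_arrow_def runit_arrow_def)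
qed

end

section \<open>Quantum traces\<close>

context tensor_category
begin

lemma dual_pair_snakes:
  assumes d: "dual_pair C V D e i"
  defines "E \<equiv> Arrow (D \<otimes>\<^sub>o V) (TUnit C) e" and "J \<equiv> Arrow (TUnit C) (V \<otimes>\<^sub>o D) i"
  shows "V \<in> Ob C" "D \<in> Ob C" "typed E" "typed J" "typed.snake1 V D E J" "typed.snake2 V D E J"
proof -
  show [simp]: "V \<in> Ob C" "D \<in> Ob C" using d by (auto simp: dual_pair_def)
  show [simp]: "typed E" "typed J"
    using d by (auto simp: dual_pair_def typed_def E_def J_def TObj_closed TUnit_closed)
  have [simp]: "src E = D \<otimes>\<^sub>o V" "tgt E = TUnit C" "src J = TUnit C" "tgt J = V \<otimes>\<^sub>o D"
    by (simp_all add: E_def J_def)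
  have "(((runit_arrow V \<star> (ident_arrow V \<boxdot> E)) \<star> assoc_arrow V D V) \<star> (J \<boxdot> ident_arrow V))
      \<star> inv_arrow (lunit_arrow V) = ident_arrow V"
    using d by (simp add: dual_pair_def E_def J_def comp_arrow_def tensor_arrow_def runit_arrow_def
        lunit_arrow_def assoc_arrow_def inv_arrow_def ident_arrow_def)
  then show "typed.snake1 V D E J" by (simp add: typed.snake1_def)
  have "(((lunit_arrow D \<star> (E \<boxdot> ident_arrow D)) \<star> inv_arrow (assoc_arrow D V D)) \<star> (ident_arrow D \<boxdot> J))
      \<star> inv_arrow (runit_arrow D) = ident_arrow D"
    using d by (simp add: dual_pair_def E_def J_def comp_arrow_def tensor_arrow_def runit_arrow_def
        lunit_arrow_def assoc_arrow_def inv_arrow_def ident_arrow_def)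
  then show "typed.snake2 V D E J" by (simp add: typed.snake2_def)
qed

end

context balanced_tensor_category
begin

lemma Braid_arr: "X \<in> Ob C \<Longrightarrow> Y \<in> Ob C \<Longrightarrow> Braid C X Y \<in> arr C (X \<otimes>\<^sub>o Y) (Y \<otimes>\<^sub>o X)"
  using Braid_iso[of X Y] by (auto simp: is_iso_def inverse_arr_def)

lemma Twist_arr: "X \<in> Ob C \<Longrightarrow> Twist C X \<in> arr C X X"
  using Twist_iso[of X] by (auto simp: is_iso_def inverse_arr_def)

text \<open>The isomorphism between two duals moves through the twist by bifunctoriality and through the
  braiding by naturality. This makes the dimension, a definite description over all duals,
  computable from any of them.\<close>

lemma quantum_trace_unique:
  assumes d: "dual_pair C V D e i" and d': "dual_pair C V D' e' i'"
  shows "e' \<cdot> Braid C V D' \<cdot> (Twist C V \<otimes>\<^sub>m Ident C D') \<cdot> i'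
    = e \<cdot> Braid C V D \<cdot> (Twist C V \<otimes>\<^sub>m Ident C D) \<cdot> i"
proof -
  define E J where EJ: "E = Arrow (D \<otimes>\<^sub>o V) (TUnit C) e" "J = Arrow (TUnit C) (V \<otimes>\<^sub>o D) i"
  define E' J' where EJ': "E' = Arrow (D' \<otimes>\<^sub>o V) (TUnit C) e'" "J' = Arrow (TUnit C) (V \<otimes>\<^sub>o D') i'"
  define b where "b = Arrow (V \<otimes>\<^sub>o D) (D \<otimes>\<^sub>o V) (Braid C V D)"
  define b' where "b' = Arrow (V \<otimes>\<^sub>o D') (D' \<otimes>\<^sub>o V) (Braid C V D')"
  define t where "t = Arrow V V (Twist C V)"
  note s [simp] = dual_pair_snakes[OF d, folded EJ]
  note s' [simp] = dual_pair_snakes[OF d', folded EJ']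
  have [simp]: "src E = D \<otimes>\<^sub>o V" "tgt E = TUnit C" "src J = TUnit C" "tgt J = V \<otimes>\<^sub>o D"
    "src E' = D' \<otimes>\<^sub>o V" "tgt E' = TUnit C" "src J' = TUnit C" "tgt J' = V \<otimes>\<^sub>o D'"
    "src b = V \<otimes>\<^sub>o D" "tgt b = D \<otimes>\<^sub>o V" "src b' = V \<otimes>\<^sub>o D'" "tgt b' = D' \<otimes>\<^sub>o V"
    "src t = V" "tgt t = V"
    by (simp_all add: EJ EJ' b_def b'_def t_def)
  have [simp]: "typed b" "typed b'" "typed t"
    using s(1,2) s'(2) by (simp_all add: typed_def b_def b'_def t_def Braid_arr Twist_arr TObj_closed)
  obtain \<phi> where \<phi> [simp]: "typed \<phi>" "src \<phi> = D" "tgt \<phi> = D'"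
    and i': "(ident_arrow V \<boxdot> \<phi>) \<star> J = J'" and e: "E' \<star> (\<phi> \<boxdot> ident_arrow V) = E"
    by (rule typed.dual_unique[of V D E J D' E' J']) simp_all
  have "b' \<star> (ident_arrow V \<boxdot> \<phi>) = (\<phi> \<boxdot> ident_arrow V) \<star> b"
    using Braid_natural[of V V D D' "Ident C V" "mor \<phi>"] \<phi> s(1) Ident_closed[OF s(1)]
    by (simp add: typed_def b_def b'_def comp_arrow_def tensor_arrow_def ident_arrow_def)
  note b\<phi> = typed.comp_reassoc[OF this]
  note t\<phi> = typed.comp_reassoc[OF typed.interchange[of t \<phi> V V D D']]
  have "E' \<star> b' \<star> (t \<boxdot> ident_arrow D') \<star> J'
      = E' \<star> b' \<star> (t \<boxdot> ident_arrow D') \<star> (ident_arrow V \<boxdot> \<phi>) \<star> J"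
    by (simp only: i')
  also have "\<dots> = E' \<star> (\<phi> \<boxdot> ident_arrow V) \<star> b \<star> (t \<boxdot> ident_arrow D) \<star> J"
    by (simp add: t\<phi> b\<phi>)
  also have "\<dots> = E \<star> b \<star> (t \<boxdot> ident_arrow D) \<star> J"
    by (simp add: typed.comp_reassoc[OF e])
  finally have "((E' \<star> b') \<star> (t \<boxdot> ident_arrow D')) \<star> J' = ((E \<star> b) \<star> (t \<boxdot> ident_arrow D)) \<star> J"
    by simp
  then show ?thesis
    by (simp add: EJ EJ' b_def b'_def t_def comp_arrow_def tensor_arrow_def ident_arrow_def)
qed

lemma cat_dim_eq:
  assumes "dual_pair C V D e i"
  shows "cat_dim C V = e \<cdot> Braid C V D \<cdot> (Twist C V \<otimes>\<^sub>m Ident C D) \<cdot> i"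
  unfolding cat_dim_def using assms quantum_trace_unique by (intro the_equality) blast+

end

section \<open>Rigid algebras\<close>

locale rigid_algebra = rigid_semisimple_tensor_category C
  for C :: "('o, 'm, 'e) tensorcat_scheme" (structure) +
  fixes A :: "('o, 'm) calgebra"
  assumes rigid: "rigid_C_algebra C A"
begin

abbreviation "\<A> \<equiv> AObj A"
abbreviation "\<mu> \<equiv> AMult A"
abbreviation "\<iota> \<equiv> AUnit A"
abbreviation "\<I> \<equiv> TUnit C"
abbreviation "\<epsilon> \<equiv> counit C A"

lemma algebra_ob: "\<A> \<in> Ob C"
  and mult_arr: "\<mu> \<in> arr C (\<A> \<otimes>\<^sub>o \<A>) \<A>"
  and unit_mono: "is_mono C \<I> \<A> \<iota>"
  and mult_assoc: "\<mu> \<cdot> (\<mu> \<otimes>\<^sub>m Ident C \<A>) = \<mu> \<cdot> (Ident C \<A> \<otimes>\<^sub>m \<mu>) \<cdot> Assoc C \<A> \<A> \<A>"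
  and mult_comm: "\<mu> \<cdot> Braid C \<A> \<A> = \<mu>"
  and mult_unit: "\<mu> \<cdot> (\<iota> \<otimes>\<^sub>m Ident C \<A>) = LUnit C \<A>"
  and dim_points: "vectorspace.dim class_ring (Hom C \<I> \<A>) = 1"
  and dim_nonzero: "cat_dim C \<A> \<noteq> \<zero>\<^bsub>Hom C \<I> \<I>\<^esub>"
  using rigid by (auto simp: rigid_C_algebra_def C_algebra_def)

lemma unit_arr: "\<iota> \<in> arr C \<I> \<A>"
  using unit_mono by (simp add: is_mono_def)

lemma Ident_unit_nonzero: "Ident C \<I> \<noteq> \<zero>\<^bsub>Hom C \<I> \<I>\<^esub>"
  using TUnit_simple zero_object_iff[OF TUnit_closed] by (simp add: simple_object_def)

lemma unit_nonzero: "\<iota> \<noteq> \<zero>\<^bsub>Hom C \<I> \<A>\<^esub>"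
proof
  note U = TUnit_closed
  assume "\<iota> = \<zero>\<^bsub>Hom C \<I> \<A>\<^esub>"
  then have "\<iota> \<cdot> Ident C \<I> = \<iota> \<cdot> \<zero>\<^bsub>Hom C \<I> \<I>\<^esub>"
    using Comp_zero_right[OF U U algebra_ob unit_arr] Comp_Ident_right[OF U algebra_ob unit_arr] by simp
  then show False
    using unit_mono U Ident_closed[OF U] zero_arr[OF U U] Ident_unit_nonzero unfolding is_mono_def by blast
qed

lemma points_are_multiples_of_unit:
  assumes "f \<in> arr C \<I> \<A>"
  obtains c where "f = c \<odot>\<^bsub>Hom C \<I> \<A>\<^esub> \<iota>"
  using vectorspace.dim_one_multiple[OF Hom_vectorspace[OF TUnit_closed algebra_ob]
      Hom_fin_dim[OF TUnit_closed algebra_ob] dim_points unit_arr unit_nonzero assms] by blast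

text \<open>The unit has a quasi-inverse \<open>g\<close>, which is a retraction since the unit is a monomorphism. The
  difference \<open>d\<close> of two retractions vanishes on the unit, hence on every point of \<open>A\<close>; a
  quasi-inverse \<open>k : 1 \<rightarrow> A\<close> of \<open>d\<close> is a point, so \<open>d k = 0\<close> and \<open>d = d k d = 0\<close>.\<close>

lemma counit_arr: "\<epsilon> \<in> arr C \<A> \<I>" and counit_unit: "\<epsilon> \<cdot> \<iota> = Ident C \<I>"
proof -
  note U = TUnit_closed and A = algebra_ob
  obtain g where g: "g \<in> arr C \<A> \<I>" "\<iota> \<cdot> (g \<cdot> \<iota>) = \<iota>"
    using regular_semisimple[OF U A unit_arr] by (auto simp: regular_def)
  have g1: "g \<cdot> \<iota> = Ident C \<I>" by (rule regular_mono_retract[OF U A unit_mono g])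
  have unique: "h = g" if h: "h \<in> arr C \<A> \<I>" and h1: "h \<cdot> \<iota> = Ident C \<I>" for h
  proof -
    define d where "d = h \<ominus>\<^bsub>Hom C \<A> \<I>\<^esub> g"
    have d: "d \<in> arr C \<A> \<I>" unfolding d_def by (rule minus_arr[OF A U h g(1)])
    have d0: "d \<cdot> \<iota> = \<zero>\<^bsub>Hom C \<I> \<I>\<^esub>"
      unfolding d_def Comp_minus_left[OF U A U unit_arr h g(1)] h1 g1
      by (rule minus_self[OF U U Ident_closed[OF U]])
    obtain k where k: "k \<in> arr C \<I> \<A>" "d \<cdot> (k \<cdot> d) = d"
      using regular_semisimple[OF A U d] by (auto simp: regular_def)
    obtain c where c: "k = c \<odot>\<^bsub>Hom C \<I> \<A>\<^esub> \<iota>" by (rule points_are_multiples_of_unit[OF k(1)])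
    have "d \<cdot> k = \<zero>\<^bsub>Hom C \<I> \<I>\<^esub>"
      unfolding c Comp_smult_right[OF U A U unit_arr d] d0
      using module.smult_r_null[OF Hom_module[OF U U], of c] by simp
    then have "d = \<zero>\<^bsub>Hom C \<A> \<I>\<^esub>"
      using Comp_assoc[OF A U A U d k(1) d] k(2) Comp_zero_left[OF A U U d] by simp
    then show "h = g" unfolding d_def by (rule minus_eq_zero[OF A U h g(1)])
  qed
  have eq: "\<epsilon> = g"
    unfolding counit_def by (rule the_equality) (use g(1) g1 in blast, use unique in blast)
  show "\<epsilon> \<in> arr C \<A> \<I>" unfolding eq by (rule g(1))
  show "\<epsilon> \<cdot> \<iota> = Ident C \<I>" unfolding eq by (rule g1)
qed

text \<open>The double braiding in the balancing axiom is absorbed by the commutative multiplication.\<close>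

lemma Twist_mult: "Twist C \<A> \<cdot> \<mu> = \<mu> \<cdot> (Twist C \<A> \<otimes>\<^sub>m Twist C \<A>)"
proof -
  note A = algebra_ob
  note AA = TObj_closed[OF A A]
  note B = Braid_arr[OF A A] and t = Twist_arr[OF A]
  have tt: "Twist C \<A> \<otimes>\<^sub>m Twist C \<A> \<in> arr C (\<A> \<otimes>\<^sub>o \<A>) (\<A> \<otimes>\<^sub>o \<A>)"
    by (rule TMor_closed[OF A A A A t t])
  have "Twist C \<A> \<cdot> \<mu> = \<mu> \<cdot> Twist C (\<A> \<otimes>\<^sub>o \<A>)"
    by (rule Twist_natural[OF AA A mult_arr])
  also have "\<dots> = ((\<mu> \<cdot> Braid C \<A> \<A>) \<cdot> Braid C \<A> \<A>) \<cdot> (Twist C \<A> \<otimes>\<^sub>m Twist C \<A>)"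
    unfolding Twist_TObj[OF A A] Comp_assoc[OF AA AA AA A B B mult_arr]
    by (rule Comp_assoc[OF AA AA AA A tt Comp_closed[OF AA AA AA B B] mult_arr, symmetric])
  finally show ?thesis by (simp add: mult_comm)
qed

text \<open>The counit of the point \<open>\<Sum> \<theta>(x\<^sub>j) x\<^sup>j = c 1\<close> is the quantum trace that defines the dimension,
  the braiding being absorbed by the multiplication.\<close>

lemma trace_scalar:
  assumes d: "dual_pair C \<A> \<A> (\<epsilon> \<cdot> \<mu>) i"
  obtains c where "c \<noteq> 0" "\<mu> \<cdot> ((Twist C \<A> \<otimes>\<^sub>m Ident C \<A>) \<cdot> i) = c \<odot>\<^bsub>Hom C \<I> \<A>\<^esub> \<iota>"
proof -
  note A = algebra_ob and U = TUnit_closed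
  note AA = TObj_closed[OF A A]
  note B = Braid_arr[OF A A] and t = Twist_arr[OF A]
  have tI: "Twist C \<A> \<otimes>\<^sub>m Ident C \<A> \<in> arr C (\<A> \<otimes>\<^sub>o \<A>) (\<A> \<otimes>\<^sub>o \<A>)"
    by (rule TMor_closed[OF A A A A t Ident_closed[OF A]])
  have i: "i \<in> arr C \<I> (\<A> \<otimes>\<^sub>o \<A>)" using d by (simp add: dual_pair_def)
  have ti: "(Twist C \<A> \<otimes>\<^sub>m Ident C \<A>) \<cdot> i \<in> arr C \<I> (\<A> \<otimes>\<^sub>o \<A>)" by (rule Comp_closed[OF U AA AA i tI])
  define x where "x = \<mu> \<cdot> ((Twist C \<A> \<otimes>\<^sub>m Ident C \<A>) \<cdot> i)"
  have x: "x \<in> arr C \<I> \<A>" unfolding x_def by (rule Comp_closed[OF U AA A ti mult_arr])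
  obtain c where c: "x = c \<odot>\<^bsub>Hom C \<I> \<A>\<^esub> \<iota>" by (rule points_are_multiples_of_unit[OF x])
  have e: "\<epsilon> \<cdot> \<mu> \<in> arr C (\<A> \<otimes>\<^sub>o \<A>) \<I>" by (rule Comp_closed[OF AA A U mult_arr counit_arr])
  have "(\<epsilon> \<cdot> \<mu>) \<cdot> Braid C \<A> \<A> = \<epsilon> \<cdot> \<mu>"
    using Comp_assoc[OF AA AA A U B mult_arr counit_arr] mult_comm by simp
  then have "cat_dim C \<A> = (\<epsilon> \<cdot> \<mu>) \<cdot> (Twist C \<A> \<otimes>\<^sub>m Ident C \<A>) \<cdot> i"
    using cat_dim_eq[OF d] by simp
  also have "\<dots> = \<epsilon> \<cdot> x"
    unfolding x_def Comp_assoc[OF U AA AA U i tI e] by (rule Comp_assoc[OF U AA A U ti mult_arr counit_arr])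
  also have "\<dots> = c \<odot>\<^bsub>Hom C \<I> \<I>\<^esub> Ident C \<I>"
    unfolding c Comp_smult_right[OF U A U unit_arr counit_arr] counit_unit ..
  finally have "c \<noteq> 0"
    using dim_nonzero smult_zero[OF U U Ident_closed[OF U]] by auto
  then show thesis using that c unfolding x_def by blast
qed

definition scalar_arrow :: "complex \<Rightarrow> 'o \<Rightarrow> ('o, 'm) arrow" where
  "scalar_arrow c X = Arrow X X (c \<odot>\<^bsub>Hom C X X\<^esub> Ident C X)"

lemma scalar_arrow_family: "typed.scalar_family (scalar_arrow c)"
proof -
  have "typed (scalar_arrow c X)" if X: "X \<in> Ob C" for X
    using X smult_arr[OF X X Ident_closed[OF X]] by (simp add: typed_def scalar_arrow_def)
  moreover have "scalar_arrow c (tgt f) \<star> f = f \<star> scalar_arrow c (src f)" if f: "typed f" for f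
  proof -
    have o: "src f \<in> Ob C" "tgt f \<in> Ob C" "mor f \<in> arr C (src f) (tgt f)" using f unfolding typed_def by blast+
    show ?thesis
      unfolding scalar_arrow_def comp_arrow_def arrow.sel
        Comp_smult_left[OF o(1) o(2) o(2) o(3) Ident_closed[OF o(2)]]
        Comp_smult_right[OF o(1) o(1) o(2) Ident_closed[OF o(1)] o(3)]
        Comp_Ident_left[OF o] Comp_Ident_right[OF o] ..
  qed
  moreover have "scalar_arrow c X \<boxdot> ident_arrow Y = scalar_arrow c (X \<otimes>\<^sub>o Y)"
      "ident_arrow X \<boxdot> scalar_arrow c Y = scalar_arrow c (X \<otimes>\<^sub>o Y)"
    if X: "X \<in> Ob C" and Y: "Y \<in> Ob C" for X Y
    using TMor_smult_left[OF X X Y Y Ident_closed[OF X] Ident_closed[OF Y], of c]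
      TMor_smult_right[OF X X Y Y Ident_closed[OF X] Ident_closed[OF Y], of c] TMor_Ident[OF X Y]
    by (simp_all add: scalar_arrow_def tensor_arrow_def ident_arrow_def)
  ultimately show ?thesis
    unfolding typed.scalar_family_def by (auto simp: scalar_arrow_def)
qed

lemma scalar_arrow_inverse:
  assumes "c \<noteq> 0" and X: "X \<in> Ob C"
  shows "scalar_arrow c X \<star> scalar_arrow (inverse c) X = ident_arrow X"
proof -
  note I = Ident_closed[OF X]
  have "(c \<odot>\<^bsub>Hom C X X\<^esub> Ident C X) \<cdot> (inverse c \<odot>\<^bsub>Hom C X X\<^esub> Ident C X)
      = c \<odot>\<^bsub>Hom C X X\<^esub> (inverse c \<odot>\<^bsub>Hom C X X\<^esub> Ident C X)"
    using Comp_smult_left[OF X X X smult_arr[OF X X I] I] Comp_Ident_left[OF X X smult_arr[OF X X I]] by simp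
  also have "\<dots> = Ident C X"
    using module.smult_assoc1[OF Hom_module[OF X X], of c "inverse c" "Ident C X"]
      module.smult_one[OF Hom_module[OF X X] I] assms(1) I by simp
  finally show ?thesis by (simp add: scalar_arrow_def comp_arrow_def ident_arrow_def)
qed

text \<open>The averaging lemma for \<open>A \<otimes> -\<close>: the pairing of the rigid algebra makes this functor a Frobenius
  monad, and its nonzero dimension provides the invertible scalar.\<close>

lemma module_map_regular:
  assumes V: "V \<in> Ob C" and W: "W \<in> Ob C"
    and \<rho>: "\<rho> \<in> arr C (\<A> \<otimes>\<^sub>o V) V"
    and \<rho>_assoc: "\<rho> \<cdot> (\<mu> \<otimes>\<^sub>m Ident C V) = \<rho> \<cdot> (Ident C \<A> \<otimes>\<^sub>m \<rho>) \<cdot> Assoc C \<A> \<A> V"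
    and \<rho>_unit: "\<rho> \<cdot> (\<iota> \<otimes>\<^sub>m Ident C V) = LUnit C V"
    and \<sigma>: "\<sigma> \<in> arr C (\<A> \<otimes>\<^sub>o W) W"
    and \<sigma>_assoc: "\<sigma> \<cdot> (\<mu> \<otimes>\<^sub>m Ident C W) = \<sigma> \<cdot> (Ident C \<A> \<otimes>\<^sub>m \<sigma>) \<cdot> Assoc C \<A> \<A> W"
    and f: "f \<in> arr C V W" and f_lin: "f \<cdot> \<rho> = \<sigma> \<cdot> (Ident C \<A> \<otimes>\<^sub>m f)"
  obtains h where "h \<in> arr C W V" "h \<cdot> \<sigma> = \<rho> \<cdot> (Ident C \<A> \<otimes>\<^sub>m h)" "f \<cdot> (h \<cdot> f) = f"
proof -
  note A = algebra_ob and U = TUnit_closed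
  obtain i where d: "dual_pair C \<A> \<A> (\<epsilon> \<cdot> \<mu>) i"
    using rigid by (auto simp: rigid_C_algebra_def)
  obtain c where c: "c \<noteq> 0" "\<mu> \<cdot> ((Twist C \<A> \<otimes>\<^sub>m Ident C \<A>) \<cdot> i) = c \<odot>\<^bsub>Hom C \<I> \<A>\<^esub> \<iota>"
    by (rule trace_scalar[OF d])
  define m u e j t where "m = Arrow (\<A> \<otimes>\<^sub>o \<A>) \<A> \<mu>" and "u = Arrow \<I> \<A> \<iota>"
    and "e = Arrow \<A> \<I> \<epsilon>" and "j = Arrow \<I> (\<A> \<otimes>\<^sub>o \<A>) i" and "t = Arrow \<A> \<A> (Twist C \<A>)"
  note defs = m_def u_def e_def j_def t_def
  note arrow_defs = comp_arrow_def tensor_arrow_def ident_arrow_def assoc_arrow_def lunit_arrow_def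
  have [simp]: "typed j" using dual_pair_snakes(4)[OF d] by (simp add: j_def)
  have [simp]: "typed m" "typed u" "typed e" "typed t"
    using A U mult_arr unit_arr counit_arr Twist_arr[OF A] by (simp_all add: typed_def defs TObj_closed)
  have [simp]: "src m = \<A> \<otimes>\<^sub>o \<A>" "tgt m = \<A>" "src u = \<I>" "tgt u = \<A>" "src e = \<A>" "tgt e = \<I>"
    "src j = \<I>" "tgt j = \<A> \<otimes>\<^sub>o \<A>" "src t = \<A>" "tgt t = \<A>"
    by (simp_all add: defs)
  have em: "e \<star> m = Arrow (\<A> \<otimes>\<^sub>o \<A>) \<I> (\<epsilon> \<cdot> \<mu>)" by (simp add: defs comp_arrow_def)
  have "m \<star> (m \<boxdot> ident_arrow \<A>) = (m \<star> (ident_arrow \<A> \<boxdot> m)) \<star> assoc_arrow \<A> \<A> \<A>"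
    using mult_assoc by (simp add: defs arrow_defs)
  then have m_assoc: "m \<star> (m \<boxdot> ident_arrow \<A>) = m \<star> (ident_arrow \<A> \<boxdot> m) \<star> assoc_arrow \<A> \<A> \<A>"
    using A by simp
  have trace: "m \<star> (t \<boxdot> ident_arrow \<A>) \<star> j = u \<star> scalar_arrow c \<I>"
    using c(2) Comp_smult_right[OF U U A Ident_closed[OF U] unit_arr, of c] Comp_Ident_right[OF U A unit_arr]
    by (simp add: defs arrow_defs scalar_arrow_def)
  interpret F: traced_frobenius_algebra "\<lambda>X. X \<in> Ob C" typed src tgt ident_arrow comp_arrow "TObj C"
    tensor_arrow "\<I>" assoc_arrow "\<lambda>X Y Z. inv_arrow (assoc_arrow X Y Z)"
    lunit_arrow "\<lambda>X. inv_arrow (lunit_arrow X)" runit_arrow "\<lambda>X. inv_arrow (runit_arrow X)"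
    "\<A>" m u e j t "scalar_arrow c" "scalar_arrow (inverse c)"
  proof unfold_locales
    show "m \<star> (u \<boxdot> ident_arrow \<A>) = lunit_arrow \<A>"
      using mult_unit by (simp add: defs arrow_defs)
    show "t \<star> m = m \<star> (t \<boxdot> t)"
      using Twist_mult by (simp add: defs arrow_defs)
  qed (use A m_assoc trace dual_pair_snakes(5,6)[OF d] scalar_arrow_family scalar_arrow_inverse[OF c(1)]
      in \<open>simp_all add: em j_def[symmetric]\<close>)
  interpret S: special_frobenius_monad "\<lambda>X. X \<in> Ob C" typed src tgt ident_arrow comp_arrow
    "\<lambda>X. \<A> \<otimes>\<^sub>o X" "\<lambda>f. ident_arrow \<A> \<boxdot> f" F.mult_at F.unit_at F.counit_at "typed.Cv j \<A> \<A>" "scalar_arrow (inverse c)"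
    by (rule F.special)
  have action: "R \<star> F.mult_at Z = R \<star> (ident_arrow \<A> \<boxdot> R)"
    if Z: "Z \<in> Ob C" and r: "r \<in> arr C (\<A> \<otimes>\<^sub>o Z) Z" and R: "R = Arrow (\<A> \<otimes>\<^sub>o Z) Z r"
      and r_assoc: "r \<cdot> (\<mu> \<otimes>\<^sub>m Ident C Z) = r \<cdot> (Ident C \<A> \<otimes>\<^sub>m r) \<cdot> Assoc C \<A> \<A> Z" for Z r R
  proof -
    have [simp]: "typed R" "src R = \<A> \<otimes>\<^sub>o Z" "tgt R = Z"
      using A Z r by (simp_all add: R typed_def TObj_closed)
    have "R \<star> (m \<boxdot> ident_arrow Z) = (R \<star> (ident_arrow \<A> \<boxdot> R)) \<star> assoc_arrow \<A> \<A> Z"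
      using r_assoc by (simp add: R defs arrow_defs)
    from typed.comp_reassoc[OF this, of "inv_arrow (assoc_arrow \<A> \<A> Z)"] show ?thesis
      using A Z by (simp add: F.mult_at_def)
  qed
  define R T F where "R = Arrow (\<A> \<otimes>\<^sub>o V) V \<rho>" and "T = Arrow (\<A> \<otimes>\<^sub>o W) W \<sigma>" and "F = Arrow V W f"
  obtain g where g: "g \<in> arr C W V" "f \<cdot> (g \<cdot> f) = f"
    using regular_semisimple[OF V W f] by (auto simp: regular_def)
  have [simp]: "typed R" "typed T" "typed F" "src R = \<A> \<otimes>\<^sub>o V" "tgt R = V"
    "src T = \<A> \<otimes>\<^sub>o W" "tgt T = W" "src F = V" "tgt F = W"
    using A V W \<rho> \<sigma> f by (simp_all add: R_def T_def F_def typed_def TObj_closed)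
  have "R \<star> (u \<boxdot> ident_arrow V) = lunit_arrow V"
    using \<rho>_unit by (simp add: R_def defs arrow_defs)
  from typed.comp_reassoc[OF this, of "inv_arrow (lunit_arrow V)"]
  have R_unit: "R \<star> F.unit_at V = ident_arrow V"
    using V A by (simp add: F.unit_at_def)
  obtain H where H: "typed H" "src H = W" "tgt H = V" "H \<star> T = R \<star> (ident_arrow \<A> \<boxdot> H)" "F \<star> H \<star> F = F"
  proof (rule S.averaging[of R V T W F "Arrow W V g"])
    show "R \<star> F.mult_at V = R \<star> (ident_arrow \<A> \<boxdot> R)" by (rule action[OF V \<rho> R_def \<rho>_assoc])
    show "T \<star> F.mult_at W = T \<star> (ident_arrow \<A> \<boxdot> T)" by (rule action[OF W \<sigma> T_def \<sigma>_assoc])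
    show "F \<star> R = T \<star> (ident_arrow \<A> \<boxdot> F)"
      using f_lin by (simp add: R_def T_def F_def arrow_defs)
    show "F \<star> Arrow W V g \<star> F = F" using g by (simp add: F_def arrow_defs)
    show "typed (Arrow W V g)" using V W g by (simp add: typed_def)
  qed (simp_all add: R_unit)
  show thesis
  proof (rule that[of "mor H"])
    show "mor H \<in> arr C W V" using H(1) unfolding typed_def H(2,3) by blast
    show "mor H \<cdot> \<sigma> = \<rho> \<cdot> (Ident C \<A> \<otimes>\<^sub>m mor H)"
      using H(4) by (simp add: R_def T_def arrow_defs)
    show "f \<cdot> (mor H \<cdot> f) = f"
      using H(5) by (simp add: F_def arrow_defs)
  qed
qed

end

section \<open>Modules over a rigid algebra\<close>

context rigid_algebra
begin

abbreviation act :: "'m \<Rightarrow> 'm" where "act f \<equiv> Ident C \<A> \<otimes>\<^sub>m f"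

definition module_structure :: "'o \<Rightarrow> 'm \<Rightarrow> bool" where
  "module_structure V \<rho> \<longleftrightarrow> V \<in> Ob C \<and> \<rho> \<in> arr C (\<A> \<otimes>\<^sub>o V) V \<and>
    \<rho> \<cdot> (\<mu> \<otimes>\<^sub>m Ident C V) = \<rho> \<cdot> act \<rho> \<cdot> Assoc C \<A> \<A> V \<and>
    \<rho> \<cdot> (\<iota> \<otimes>\<^sub>m Ident C V) = LUnit C V"

lemma Rep_Ob: "(V, \<rho>) \<in> Ob (Rep C A) \<longleftrightarrow> module_structure V \<rho>"
  by (simp add: Rep_def module_structure_def)

lemma Rep_Hom: "Hom (Rep C A) (V, \<rho>) (W, \<sigma>) = (Hom C V W)\<lparr>carrier := {f \<in> arr C V W. f \<cdot> \<rho> = \<sigma> \<cdot> act f}\<rparr>"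
  by (simp add: Rep_def)

lemma Rep_arr: "f \<in> arr (Rep C A) (V, \<rho>) (W, \<sigma>) \<longleftrightarrow> f \<in> arr C V W \<and> f \<cdot> \<rho> = \<sigma> \<cdot> act f"
  by (simp add: Rep_def)

lemma Rep_ops [simp]:
  "Comp (Rep C A) = Comp C" "Ident (Rep C A) (V, \<rho>) = Ident C V"
  "zero (Hom (Rep C A) (V, \<rho>) (W, \<sigma>)) = zero (Hom C V W)"
  "add (Hom (Rep C A) (V, \<rho>) (W, \<sigma>)) = add (Hom C V W)"
  "module.smult (Hom (Rep C A) (V, \<rho>) (W, \<sigma>)) = module.smult (Hom C V W)"
  by (simp_all add: Rep_def)

lemma act_ob: "V \<in> Ob C \<Longrightarrow> \<A> \<otimes>\<^sub>o V \<in> Ob C"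
  by (rule TObj_closed[OF algebra_ob])

lemma act_arr: "V \<in> Ob C \<Longrightarrow> W \<in> Ob C \<Longrightarrow> f \<in> arr C V W \<Longrightarrow> act f \<in> arr C (\<A> \<otimes>\<^sub>o V) (\<A> \<otimes>\<^sub>o W)"
  by (rule TMor_closed[OF algebra_ob algebra_ob _ _ Ident_closed[OF algebra_ob]])

lemma act_Ident: "V \<in> Ob C \<Longrightarrow> act (Ident C V) = Ident C (\<A> \<otimes>\<^sub>o V)"
  by (rule TMor_Ident[OF algebra_ob])

lemma act_comp: "U \<in> Ob C \<Longrightarrow> V \<in> Ob C \<Longrightarrow> W \<in> Ob C \<Longrightarrow> f \<in> arr C U V \<Longrightarrow> g \<in> arr C V W
    \<Longrightarrow> act (g \<cdot> f) = act g \<cdot> act f"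
  using TMor_Comp[OF algebra_ob algebra_ob algebra_ob _ _ _ Ident_closed[OF algebra_ob]
      Ident_closed[OF algebra_ob], of U V W f g] Comp_Ident_left[OF algebra_ob algebra_ob Ident_closed[OF algebra_ob]]
  by simp

lemma act_add: "V \<in> Ob C \<Longrightarrow> W \<in> Ob C \<Longrightarrow> f \<in> arr C V W \<Longrightarrow> g \<in> arr C V W
    \<Longrightarrow> act (f \<oplus>\<^bsub>Hom C V W\<^esub> g) = act f \<oplus>\<^bsub>Hom C (\<A> \<otimes>\<^sub>o V) (\<A> \<otimes>\<^sub>o W)\<^esub> act g"
  by (rule TMor_add_right[OF algebra_ob algebra_ob _ _ Ident_closed[OF algebra_ob]])

lemma act_smult: "V \<in> Ob C \<Longrightarrow> W \<in> Ob C \<Longrightarrow> f \<in> arr C V W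
    \<Longrightarrow> act (c \<odot>\<^bsub>Hom C V W\<^esub> f) = c \<odot>\<^bsub>Hom C (\<A> \<otimes>\<^sub>o V) (\<A> \<otimes>\<^sub>o W)\<^esub> act f"
  by (rule TMor_smult_right[OF algebra_ob algebra_ob _ _ Ident_closed[OF algebra_ob]])

lemma act_zero:
  assumes V: "V \<in> Ob C" and W: "W \<in> Ob C"
  shows "act \<zero>\<^bsub>Hom C V W\<^esub> = \<zero>\<^bsub>Hom C (\<A> \<otimes>\<^sub>o V) (\<A> \<otimes>\<^sub>o W)\<^esub>"
proof -
  note z = zero_arr[OF V W]
  show ?thesis
    using act_smult[OF V W z, of 0] smult_zero[OF V W z]
      smult_zero[OF act_ob[OF V] act_ob[OF W] act_arr[OF V W z]] by simp
qed

lemma Rep_Hom_vectorspace: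
  assumes "module_structure V \<rho>" "module_structure W \<sigma>"
  shows "vectorspace class_ring (Hom (Rep C A) (V, \<rho>) (W, \<sigma>))"
proof -
  have V: "V \<in> Ob C" and W: "W \<in> Ob C" and \<rho>: "\<rho> \<in> arr C (\<A> \<otimes>\<^sub>o V) V" and \<sigma>: "\<sigma> \<in> arr C (\<A> \<otimes>\<^sub>o W) W"
    using assms by (auto simp: module_structure_def)
  note AV = act_ob[OF V] and AW = act_ob[OF W]
  have "submodule class_ring {f \<in> arr C V W. f \<cdot> \<rho> = \<sigma> \<cdot> act f} (Hom C V W)"
  proof (rule submodule.intro)
    show "Module.module class_ring (Hom C V W)" by (rule Hom_module[OF V W])
    show "\<zero>\<^bsub>Hom C V W\<^esub> \<in> {f \<in> arr C V W. f \<cdot> \<rho> = \<sigma> \<cdot> act f}"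
      using Comp_zero_left[OF AV V W \<rho>] Comp_zero_right[OF AV AW W \<sigma>] act_zero[OF V W] zero_arr[OF V W]
      by simp
    show "f \<oplus>\<^bsub>Hom C V W\<^esub> g \<in> {f \<in> arr C V W. f \<cdot> \<rho> = \<sigma> \<cdot> act f}"
      if "f \<in> {f \<in> arr C V W. f \<cdot> \<rho> = \<sigma> \<cdot> act f}" "g \<in> {f \<in> arr C V W. f \<cdot> \<rho> = \<sigma> \<cdot> act f}" for f g
    proof -
      have f: "f \<in> arr C V W" "f \<cdot> \<rho> = \<sigma> \<cdot> act f" and g: "g \<in> arr C V W" "g \<cdot> \<rho> = \<sigma> \<cdot> act g"
        using that by auto
      show ?thesis
        using add_arr[OF V W f(1) g(1)] Comp_add_left[OF AV V W \<rho> f(1) g(1)] act_add[OF V W f(1) g(1)]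
          Comp_add_right[OF AV AW W act_arr[OF V W f(1)] act_arr[OF V W g(1)] \<sigma>] f(2) g(2) by simp
    qed
    show "c \<odot>\<^bsub>Hom C V W\<^esub> f \<in> {f \<in> arr C V W. f \<cdot> \<rho> = \<sigma> \<cdot> act f}"
      if "f \<in> {f \<in> arr C V W. f \<cdot> \<rho> = \<sigma> \<cdot> act f}" for c f
    proof -
      have f: "f \<in> arr C V W" "f \<cdot> \<rho> = \<sigma> \<cdot> act f" using that by auto
      show ?thesis
        using smult_arr[OF V W f(1)] Comp_smult_left[OF AV V W \<rho> f(1)] act_smult[OF V W f(1)]
          Comp_smult_right[OF AV AW W act_arr[OF V W f(1)] \<sigma>] f(2) by simp
    qed
  qed auto
  then have "VectorSpace.subspace class_ring {f \<in> arr C V W. f \<cdot> \<rho> = \<sigma> \<cdot> act f} (Hom C V W)"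
    by (simp add: VectorSpace.subspace_def Hom_vectorspace[OF V W])
  then show ?thesis
    unfolding Rep_Hom by (rule vectorspace.subspace_is_vs[OF Hom_vectorspace[OF V W]])
qed

lemma Rep_linear: "linear_category (Rep C A)"
proof (rule linear_category.intro, goal_cases)
  case (1 X Y)
  then show ?case by (cases X; cases Y) (simp add: Rep_Ob Rep_Hom_vectorspace)
next
  case (2 X)
  then obtain V \<rho> where X: "X = (V, \<rho>)" and V: "V \<in> Ob C" and \<rho>: "\<rho> \<in> arr C (\<A> \<otimes>\<^sub>o V) V"
    by (cases X) (auto simp: Rep_Ob module_structure_def)
  show ?case
    using Ident_closed[OF V] Comp_Ident_left[OF act_ob[OF V] V \<rho>] Comp_Ident_right[OF act_ob[OF V] V \<rho>]
    by (simp add: X Rep_arr act_Ident[OF V])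
next
  case (3 X Y Z f g)
  obtain V \<rho> W \<sigma> U \<tau> where XYZ: "X = (V, \<rho>)" "Y = (W, \<sigma>)" "Z = (U, \<tau>)"
    by (cases X; cases Y; cases Z) auto
  have o: "V \<in> Ob C" "W \<in> Ob C" "U \<in> Ob C" and a: "\<rho> \<in> arr C (\<A> \<otimes>\<^sub>o V) V" "\<sigma> \<in> arr C (\<A> \<otimes>\<^sub>o W) W" "\<tau> \<in> arr C (\<A> \<otimes>\<^sub>o U) U"
    using 3 by (auto simp: XYZ Rep_Ob module_structure_def)
  have f: "f \<in> arr C V W" "f \<cdot> \<rho> = \<sigma> \<cdot> act f" and g: "g \<in> arr C W U" "g \<cdot> \<sigma> = \<tau> \<cdot> act g"
    using 3 by (auto simp: XYZ Rep_arr)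
  note ao = act_ob[OF o(1)] act_ob[OF o(2)] act_ob[OF o(3)]
  note aa = act_arr[OF o(1,2) f(1)] act_arr[OF o(2,3) g(1)]
  have "(g \<cdot> f) \<cdot> \<rho> = g \<cdot> (\<sigma> \<cdot> act f)"
    unfolding f(2)[symmetric] by (rule Comp_assoc[OF ao(1) o(1,2,3) a(1) f(1) g(1)])
  also have "\<dots> = (\<tau> \<cdot> act g) \<cdot> act f"
    unfolding g(2)[symmetric] by (rule Comp_assoc[OF ao(1,2) o(2,3) aa(1) a(2) g(1), symmetric])
  also have "\<dots> = \<tau> \<cdot> act (g \<cdot> f)"
    unfolding act_comp[OF o f(1) g(1)] by (rule Comp_assoc[OF ao o(3) aa a(3)])
  finally show ?case
    using Comp_closed[OF o f(1) g(1)] by (simp add: XYZ Rep_arr)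
next
  case (4 X Y f)
  then show ?case
    by (cases X; cases Y) (auto simp: Rep_Ob Rep_arr module_structure_def intro: Comp_Ident_left)
next
  case (5 X Y f)
  then show ?case
    by (cases X; cases Y) (auto simp: Rep_Ob Rep_arr module_structure_def intro: Comp_Ident_right)
next
  case (6 W X Y Z f g h)
  then show ?case
    by (cases W; cases X; cases Y; cases Z) (auto simp: Rep_Ob Rep_arr module_structure_def intro: Comp_assoc)
next
  case (7 X Y Z f g h)
  then show ?case
    by (cases X; cases Y; cases Z) (auto simp: Rep_Ob Rep_arr module_structure_def intro: Comp_add_left)
next
  case (8 X Y Z f g h)
  then show ?case
    by (cases X; cases Y; cases Z) (auto simp: Rep_Ob Rep_arr module_structure_def intro: Comp_add_right)
next
  case (9 X Y Z f g c)
  then show ?case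
    by (cases X; cases Y; cases Z) (auto simp: Rep_Ob Rep_arr module_structure_def intro: Comp_smult_left)
next
  case (10 X Y Z f g c)
  then show ?case
    by (cases X; cases Y; cases Z) (auto simp: Rep_Ob Rep_arr module_structure_def intro: Comp_smult_right)
qed

text \<open>A map that intertwines a candidate action with a module action equalizes the two sides of
  each module axiom.\<close>

lemma module_axioms_after_linear_map:
  assumes mod: "module_structure V \<rho>" and K: "K \<in> Ob C" and \<kappa>: "\<kappa> \<in> arr C (\<A> \<otimes>\<^sub>o K) K"
    and h: "h \<in> arr C K V" and lin: "h \<cdot> \<kappa> = \<rho> \<cdot> act h"
  shows "h \<cdot> (\<kappa> \<cdot> (\<mu> \<otimes>\<^sub>m Ident C K)) = h \<cdot> (\<kappa> \<cdot> act \<kappa> \<cdot> Assoc C \<A> \<A> K)"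
    and "h \<cdot> (\<kappa> \<cdot> (\<iota> \<otimes>\<^sub>m Ident C K)) = h \<cdot> LUnit C K"
proof -
  note A [simp] = algebra_ob and U [simp] = TUnit_closed and K [simp]
  have V [simp]: "V \<in> Ob C" and \<rho>: "\<rho> \<in> arr C (\<A> \<otimes>\<^sub>o V) V"
    and \<rho>_assoc: "\<rho> \<cdot> (\<mu> \<otimes>\<^sub>m Ident C V) = \<rho> \<cdot> act \<rho> \<cdot> Assoc C \<A> \<A> V"
    and \<rho>_unit: "\<rho> \<cdot> (\<iota> \<otimes>\<^sub>m Ident C V) = LUnit C V"
    using mod by (auto simp: module_structure_def)
  define m u R k H where "m = Arrow (\<A> \<otimes>\<^sub>o \<A>) \<A> \<mu>" and "u = Arrow \<I> \<A> \<iota>"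
    and "R = Arrow (\<A> \<otimes>\<^sub>o V) V \<rho>" and "k = Arrow (\<A> \<otimes>\<^sub>o K) K \<kappa>" and "H = Arrow K V h"
  note defs = m_def u_def R_def k_def H_def
  note arrow_defs = comp_arrow_def tensor_arrow_def ident_arrow_def assoc_arrow_def lunit_arrow_def
  let ?a = "ident_arrow \<A>"
  have [simp]: "typed m" "typed u" "typed R" "typed k" "typed H"
    using mult_arr unit_arr \<rho> \<kappa> h by (simp_all add: typed_def defs TObj_closed)
  have [simp]: "src m = \<A> \<otimes>\<^sub>o \<A>" "tgt m = \<A>" "src u = \<I>" "tgt u = \<A>" "src R = \<A> \<otimes>\<^sub>o V" "tgt R = V"
    "src k = \<A> \<otimes>\<^sub>o K" "tgt k = K" "src H = K" "tgt H = V"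
    by (simp_all add: defs)
  have "R \<star> (m \<boxdot> ident_arrow V) = (R \<star> (?a \<boxdot> R)) \<star> assoc_arrow \<A> \<A> V"
    using \<rho>_assoc by (simp add: defs arrow_defs)
  then have R_assoc: "R \<star> (m \<boxdot> ident_arrow V) = R \<star> (?a \<boxdot> R) \<star> assoc_arrow \<A> \<A> V"
    by simp
  have R_unit: "R \<star> (u \<boxdot> ident_arrow V) = lunit_arrow V"
    using \<rho>_unit by (simp add: defs arrow_defs)
  have lin': "H \<star> k = R \<star> (?a \<boxdot> H)"
    using lin by (simp add: defs arrow_defs)
  have "H \<star> k \<star> (m \<boxdot> ident_arrow K) = R \<star> (?a \<boxdot> H) \<star> (m \<boxdot> ident_arrow K)"
    by (simp add: typed.comp_reassoc[OF lin'])
  also have "\<dots> = R \<star> (m \<boxdot> ident_arrow V) \<star> (ident_arrow (\<A> \<otimes>\<^sub>o \<A>) \<boxdot> H)"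
    by (simp add: typed.interchange[of m H "\<A> \<otimes>\<^sub>o \<A>" \<A> K V])
  also have "\<dots> = R \<star> (?a \<boxdot> R) \<star> (?a \<boxdot> (?a \<boxdot> H)) \<star> assoc_arrow \<A> \<A> K"
    by (simp add: typed.comp_reassoc[OF R_assoc] typed.as_nat3)
  also have "\<dots> = R \<star> (?a \<boxdot> (R \<star> (?a \<boxdot> H))) \<star> assoc_arrow \<A> \<A> K"
    by (simp add: typed.whisker_left)
  also have "\<dots> = R \<star> (?a \<boxdot> (H \<star> k)) \<star> assoc_arrow \<A> \<A> K"
    by (simp only: lin')
  also have "\<dots> = H \<star> k \<star> (?a \<boxdot> k) \<star> assoc_arrow \<A> \<A> K"
    by (simp add: typed.whisker_left typed.comp_reassoc[OF lin'])
  finally have "H \<star> (k \<star> (m \<boxdot> ident_arrow K)) = H \<star> ((k \<star> (?a \<boxdot> k)) \<star> assoc_arrow \<A> \<A> K)"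
    by simp
  then show "h \<cdot> (\<kappa> \<cdot> (\<mu> \<otimes>\<^sub>m Ident C K)) = h \<cdot> (\<kappa> \<cdot> act \<kappa> \<cdot> Assoc C \<A> \<A> K)"
    by (simp add: defs arrow_defs)
  have "H \<star> k \<star> (u \<boxdot> ident_arrow K) = R \<star> (?a \<boxdot> H) \<star> (u \<boxdot> ident_arrow K)"
    by (simp add: typed.comp_reassoc[OF lin'])
  also have "\<dots> = R \<star> (u \<boxdot> ident_arrow V) \<star> (ident_arrow \<I> \<boxdot> H)"
    by (simp add: typed.interchange[of u H \<I> \<A> K V])
  also have "\<dots> = H \<star> lunit_arrow K"
    by (simp add: typed.comp_reassoc[OF R_unit] typed.lu_nat)
  finally have "H \<star> (k \<star> (u \<boxdot> ident_arrow K)) = H \<star> lunit_arrow K" .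
  then show "h \<cdot> (\<kappa> \<cdot> (\<iota> \<otimes>\<^sub>m Ident C K)) = h \<cdot> LUnit C K"
    by (simp add: defs arrow_defs)
qed

text \<open>Jointly monic linear maps into modules detect the module axioms. Applied with one inclusion to
  retracts, with two projections to biproducts and with no map at all to the zero object.\<close>

lemma module_structure_detect:
  assumes K: "K \<in> Ob C" and \<kappa>: "\<kappa> \<in> arr C (\<A> \<otimes>\<^sub>o K) K"
    and maps: "\<And>V \<rho> h. (V, \<rho>, h) \<in> F \<Longrightarrow> module_structure V \<rho> \<and> h \<in> arr C K V \<and> h \<cdot> \<kappa> = \<rho> \<cdot> act h"
    and monic: "\<And>W x y. W \<in> Ob C \<Longrightarrow> x \<in> arr C W K \<Longrightarrow> y \<in> arr C W K
      \<Longrightarrow> (\<And>V \<rho> h. (V, \<rho>, h) \<in> F \<Longrightarrow> h \<cdot> x = h \<cdot> y) \<Longrightarrow> x = y"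
  shows "module_structure K \<kappa>"
proof -
  note A = algebra_ob and U = TUnit_closed
  note AK = act_ob[OF K] and AA = TObj_closed[OF A A] and UK = TObj_closed[OF U K]
  note AAK = TObj_closed[OF AA K] and A_AK = act_ob[OF AK]
  have \<mu>K: "\<mu> \<otimes>\<^sub>m Ident C K \<in> arr C ((\<A> \<otimes>\<^sub>o \<A>) \<otimes>\<^sub>o K) (\<A> \<otimes>\<^sub>o K)"
    by (rule TMor_closed[OF AA A K K mult_arr Ident_closed[OF K]])
  have \<iota>K: "\<iota> \<otimes>\<^sub>m Ident C K \<in> arr C (\<I> \<otimes>\<^sub>o K) (\<A> \<otimes>\<^sub>o K)"
    by (rule TMor_closed[OF U A K K unit_arr Ident_closed[OF K]])
  have a: "Assoc C \<A> \<A> K \<in> arr C ((\<A> \<otimes>\<^sub>o \<A>) \<otimes>\<^sub>o K) (\<A> \<otimes>\<^sub>o (\<A> \<otimes>\<^sub>o K))"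
    using Assoc_iso[OF A A K] by (auto simp: is_iso_def inverse_arr_def)
  have l: "LUnit C K \<in> arr C (\<I> \<otimes>\<^sub>o K) K"
    using LUnit_iso[OF K] by (auto simp: is_iso_def inverse_arr_def)
  have \<kappa>\<kappa>: "\<kappa> \<cdot> act \<kappa> \<in> arr C (\<A> \<otimes>\<^sub>o (\<A> \<otimes>\<^sub>o K)) K"
    by (rule Comp_closed[OF A_AK AK K act_arr[OF AK K \<kappa>] \<kappa>])
  have "\<kappa> \<cdot> (\<mu> \<otimes>\<^sub>m Ident C K) = \<kappa> \<cdot> act \<kappa> \<cdot> Assoc C \<A> \<A> K"
    using module_axioms_after_linear_map(1)[OF _ K \<kappa>] maps
    by (intro monic[OF AAK Comp_closed[OF AAK AK K \<mu>K \<kappa>] Comp_closed[OF AAK A_AK K a \<kappa>\<kappa>]]) blast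
  moreover have "\<kappa> \<cdot> (\<iota> \<otimes>\<^sub>m Ident C K) = LUnit C K"
    using module_axioms_after_linear_map(2)[OF _ K \<kappa>] maps
    by (intro monic[OF UK Comp_closed[OF UK AK K \<iota>K \<kappa>] l]) blast
  ultimately show ?thesis using K \<kappa> by (simp add: module_structure_def)
qed

text \<open>The image \<open>K\<close> of \<open>e = i p\<close> carries the action \<open>A \<otimes> K \<rightarrow> A \<otimes> V \<rightarrow> V \<rightarrow> K\<close>; as \<open>e\<close> is linear, so are \<open>i\<close>
  and \<open>p\<close>.\<close>

lemma Rep_idem_splits:
  assumes mod: "module_structure V \<rho>" and e: "e \<in> arr C V V" "e \<cdot> \<rho> = \<rho> \<cdot> act e" "e \<cdot> e = e"
  shows "linear_category.idem_splits (Rep C A) (V, \<rho>) e"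
proof -
  have V: "V \<in> Ob C" and \<rho>: "\<rho> \<in> arr C (\<A> \<otimes>\<^sub>o V) V" using mod by (auto simp: module_structure_def)
  obtain K i p where K: "K \<in> Ob C" and i: "i \<in> arr C K V" and p: "p \<in> arr C V K"
    and pi: "p \<cdot> i = Ident C K" and ip: "i \<cdot> p = e"
    using idem_splits_abelian[OF V e(1,3)] by (auto simp: idem_splits_def)
  note AV = act_ob[OF V] and AK = act_ob[OF K]
  note ai = act_arr[OF K V i] and ap = act_arr[OF V K p] and ae = act_arr[OF V V e(1)]
  have ei: "e \<cdot> i = i"
    unfolding ip[symmetric] Comp_assoc[OF K V K V i p i] pi by (rule Comp_Ident_right[OF K V i])
  have pe: "p \<cdot> e = p"
    unfolding ip[symmetric] Comp_assoc[OF V K V K p i p, symmetric] pi by (rule Comp_Ident_left[OF V K p])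
  have \<rho>i: "\<rho> \<cdot> act i \<in> arr C (\<A> \<otimes>\<^sub>o K) V" by (rule Comp_closed[OF AK AV V ai \<rho>])
  define \<kappa> where "\<kappa> = p \<cdot> (\<rho> \<cdot> act i)"
  have \<kappa>: "\<kappa> \<in> arr C (\<A> \<otimes>\<^sub>o K) K" unfolding \<kappa>_def by (rule Comp_closed[OF AK V K \<rho>i p])
  have "i \<cdot> \<kappa> = e \<cdot> (\<rho> \<cdot> act i)"
    unfolding \<kappa>_def ip[symmetric] by (rule Comp_assoc[OF AK V K V \<rho>i p i, symmetric])
  also have "\<dots> = (\<rho> \<cdot> act e) \<cdot> act i"
    unfolding e(2)[symmetric] by (rule Comp_assoc[OF AK AV V V ai \<rho> e(1), symmetric])
  also have "\<dots> = \<rho> \<cdot> act (e \<cdot> i)"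
    unfolding act_comp[OF K V V i e(1)] by (rule Comp_assoc[OF AK AV AV V ai ae \<rho>])
  finally have i_lin: "i \<cdot> \<kappa> = \<rho> \<cdot> act i" unfolding ei .
  have "\<kappa> \<cdot> act p = p \<cdot> (\<rho> \<cdot> act (i \<cdot> p))"
    unfolding \<kappa>_def act_comp[OF V K V p i] Comp_assoc[OF AV AK V K ap \<rho>i p]
      Comp_assoc[OF AV AK AV V ap ai \<rho>] ..
  also have "\<dots> = (p \<cdot> e) \<cdot> \<rho>"
    unfolding ip e(2)[symmetric] by (rule Comp_assoc[OF AV V V K \<rho> e(1) p, symmetric])
  finally have p_lin: "p \<cdot> \<rho> = \<kappa> \<cdot> act p" unfolding pe by (rule sym)
  have "module_structure K \<kappa>"
  proof (rule module_structure_detect[OF K \<kappa>, where F = "{(V, \<rho>, i)}"])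
    show "x = y" if "W \<in> Ob C" "x \<in> arr C W K" "y \<in> arr C W K"
      "\<And>V' \<rho>' h. (V', \<rho>', h) \<in> {(V, \<rho>, i)} \<Longrightarrow> h \<cdot> x = h \<cdot> y" for W x y
      using retract_is_mono[OF K V i p pi that(1-3)] that(4) by blast
  qed (use mod i i_lin in auto)
  then show ?thesis
    unfolding linear_category.idem_splits_def[OF Rep_linear]
    using i p i_lin p_lin pi ip
    by (intro bexI[of _ "(K, \<kappa>)"] bexI[of _ i] bexI[of _ p]) (simp_all add: Rep_Ob Rep_arr)
qed

lemma Rep_biproduct:
  assumes modV: "module_structure V \<rho>" and modW: "module_structure W \<sigma>"
  shows "\<exists>S. direct_sum (Rep C A) [(V, \<rho>), (W, \<sigma>)] S"
proof -
  interpret R: linear_category "Rep C A" by (rule Rep_linear)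
  have \<rho>: "\<rho> \<in> arr C (\<A> \<otimes>\<^sub>o V) V" and \<sigma>: "\<sigma> \<in> arr C (\<A> \<otimes>\<^sub>o W) W" and VW: "V \<in> Ob C" "W \<in> Ob C"
    using modV modW by (auto simp: module_structure_def)
  obtain S' where "direct_sum C [V, W] S'" using ex_direct_sum[OF VW] by blast
  then obtain S a b c d where V: "V \<in> Ob C" and W: "W \<in> Ob C" and S: "S \<in> Ob C"
    and a: "a \<in> arr C V S" and b: "b \<in> arr C S V" and c: "c \<in> arr C W S" and d: "d \<in> arr C S W"
    and ba: "b \<cdot> a = Ident C V" and dc: "d \<cdot> c = Ident C W" and bc: "b \<cdot> c = \<zero>\<^bsub>Hom C W V\<^esub>"
    and da: "d \<cdot> a = \<zero>\<^bsub>Hom C V W\<^esub>" and sum: "(a \<cdot> b) \<oplus>\<^bsub>Hom C S S\<^esub> (c \<cdot> d) = Ident C S"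
    by (rule direct_sum_pairE)
  note AV = act_ob[OF V] and AW = act_ob[OF W] and AS = act_ob[OF S]
  note aa = act_arr[OF V S a] and ab = act_arr[OF S V b] and ac = act_arr[OF W S c] and ad = act_arr[OF S W d]
  have \<rho>b: "\<rho> \<cdot> act b \<in> arr C (\<A> \<otimes>\<^sub>o S) V" by (rule Comp_closed[OF AS AV V ab \<rho>])
  have \<sigma>d: "\<sigma> \<cdot> act d \<in> arr C (\<A> \<otimes>\<^sub>o S) W" by (rule Comp_closed[OF AS AW W ad \<sigma>])
  have x: "a \<cdot> (\<rho> \<cdot> act b) \<in> arr C (\<A> \<otimes>\<^sub>o S) S" by (rule Comp_closed[OF AS V S \<rho>b a])
  have y: "c \<cdot> (\<sigma> \<cdot> act d) \<in> arr C (\<A> \<otimes>\<^sub>o S) S" by (rule Comp_closed[OF AS W S \<sigma>d c])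
  define \<kappa> where "\<kappa> = a \<cdot> (\<rho> \<cdot> act b) \<oplus>\<^bsub>Hom C (\<A> \<otimes>\<^sub>o S) S\<^esub> c \<cdot> (\<sigma> \<cdot> act d)"
  have \<kappa>: "\<kappa> \<in> arr C (\<A> \<otimes>\<^sub>o S) S" unfolding \<kappa>_def by (rule add_arr[OF AS S x y])
  have rz: "f \<oplus>\<^bsub>Hom C X Y\<^esub> \<zero>\<^bsub>Hom C X Y\<^esub> = f" "\<zero>\<^bsub>Hom C X Y\<^esub> \<oplus>\<^bsub>Hom C X Y\<^esub> f = f"
    if "X \<in> Ob C" "Y \<in> Ob C" "f \<in> arr C X Y" for X Y f
    using abelian_monoid.r_zero[OF abelian_group.axioms(1)[OF Hom_group[OF that(1,2)]] that(3)]
      abelian_monoid.l_zero[OF abelian_group.axioms(1)[OF Hom_group[OF that(1,2)]] that(3)] by auto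
  have b_lin: "b \<cdot> \<kappa> = \<rho> \<cdot> act b"
    unfolding \<kappa>_def Comp_add_right[OF AS S V x y b] Comp_assoc[OF AS V S V \<rho>b a b, symmetric]
      Comp_assoc[OF AS W S V \<sigma>d c b, symmetric] ba bc Comp_Ident_left[OF AS V \<rho>b]
      Comp_zero_left[OF AS W V \<sigma>d] by (rule rz(1)[OF AS V \<rho>b])
  have d_lin: "d \<cdot> \<kappa> = \<sigma> \<cdot> act d"
    unfolding \<kappa>_def Comp_add_right[OF AS S W x y d] Comp_assoc[OF AS V S W \<rho>b a d, symmetric]
      Comp_assoc[OF AS W S W \<sigma>d c d, symmetric] dc da Comp_Ident_left[OF AS W \<sigma>d]
      Comp_zero_left[OF AS V W \<rho>b] by (rule rz(2)[OF AS W \<sigma>d])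
  have a_lin: "a \<cdot> \<rho> = \<kappa> \<cdot> act a"
  proof -
    have "(a \<cdot> (\<rho> \<cdot> act b)) \<cdot> act a = a \<cdot> (\<rho> \<cdot> act (b \<cdot> a))"
      unfolding Comp_assoc[OF AV AS V S aa \<rho>b a] Comp_assoc[OF AV AS AV V aa ab \<rho>] act_comp[OF V S V a b] ..
    also have "\<dots> = a \<cdot> \<rho>"
      unfolding ba act_Ident[OF V] Comp_Ident_right[OF AV V \<rho>] ..
    finally have 1: "(a \<cdot> (\<rho> \<cdot> act b)) \<cdot> act a = a \<cdot> \<rho>" .
    have "(c \<cdot> (\<sigma> \<cdot> act d)) \<cdot> act a = c \<cdot> (\<sigma> \<cdot> act (d \<cdot> a))"
      unfolding Comp_assoc[OF AV AS W S aa \<sigma>d c] Comp_assoc[OF AV AS AW W aa ad \<sigma>] act_comp[OF V S W a d] ..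
    also have "\<dots> = \<zero>\<^bsub>Hom C (\<A> \<otimes>\<^sub>o V) S\<^esub>"
      unfolding da act_zero[OF V W] Comp_zero_right[OF AV AW W \<sigma>] by (rule Comp_zero_right[OF AV W S c])
    finally have 2: "(c \<cdot> (\<sigma> \<cdot> act d)) \<cdot> act a = \<zero>\<^bsub>Hom C (\<A> \<otimes>\<^sub>o V) S\<^esub>" .
    show ?thesis
      unfolding \<kappa>_def Comp_add_left[OF AV AS S aa x y] 1 2
      by (rule rz(1)[OF AV S Comp_closed[OF AV V S \<rho> a], symmetric])
  qed
  have c_lin: "c \<cdot> \<sigma> = \<kappa> \<cdot> act c"
  proof -
    have "(c \<cdot> (\<sigma> \<cdot> act d)) \<cdot> act c = c \<cdot> (\<sigma> \<cdot> act (d \<cdot> c))"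
      unfolding Comp_assoc[OF AW AS W S ac \<sigma>d c] Comp_assoc[OF AW AS AW W ac ad \<sigma>] act_comp[OF W S W c d] ..
    also have "\<dots> = c \<cdot> \<sigma>"
      unfolding dc act_Ident[OF W] Comp_Ident_right[OF AW W \<sigma>] ..
    finally have 1: "(c \<cdot> (\<sigma> \<cdot> act d)) \<cdot> act c = c \<cdot> \<sigma>" .
    have "(a \<cdot> (\<rho> \<cdot> act b)) \<cdot> act c = a \<cdot> (\<rho> \<cdot> act (b \<cdot> c))"
      unfolding Comp_assoc[OF AW AS V S ac \<rho>b a] Comp_assoc[OF AW AS AV V ac ab \<rho>] act_comp[OF W S V c b] ..
    also have "\<dots> = \<zero>\<^bsub>Hom C (\<A> \<otimes>\<^sub>o W) S\<^esub>"
      unfolding bc act_zero[OF W V] Comp_zero_right[OF AW AV V \<rho>] by (rule Comp_zero_right[OF AW V S a])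
    finally have 2: "(a \<cdot> (\<rho> \<cdot> act b)) \<cdot> act c = \<zero>\<^bsub>Hom C (\<A> \<otimes>\<^sub>o W) S\<^esub>" .
    show ?thesis
      unfolding \<kappa>_def Comp_add_left[OF AW AS S ac x y] 1 2
      by (rule rz(2)[OF AW S Comp_closed[OF AW W S \<sigma> c], symmetric])
  qed
  have modS: "module_structure S \<kappa>"
  proof (rule module_structure_detect[OF S \<kappa>, where F = "{(V, \<rho>, b), (W, \<sigma>, d)}"])
    show "x = y" if X: "X \<in> Ob C" and x: "x \<in> arr C X S" and y: "y \<in> arr C X S"
      and eq: "\<And>V' \<rho>' h. (V', \<rho>', h) \<in> {(V, \<rho>, b), (W, \<sigma>, d)} \<Longrightarrow> h \<cdot> x = h \<cdot> y" for X x y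
    proof -
      have "z = a \<cdot> (b \<cdot> z) \<oplus>\<^bsub>Hom C X S\<^esub> c \<cdot> (d \<cdot> z)" if z: "z \<in> arr C X S" for z
        unfolding Comp_assoc[OF X S V S z b a, symmetric] Comp_assoc[OF X S W S z d c, symmetric]
          Comp_add_left[OF X S S z Comp_closed[OF S V S b a] Comp_closed[OF S W S d c], symmetric] sum
        by (rule Comp_Ident_left[OF X S z, symmetric])
      from this[OF x] this[OF y] show "x = y"
        using eq[of V \<rho> b] eq[of W \<sigma> d] by simp
    qed
  qed (use modV modW b d b_lin d_lin in auto)
  have "direct_sum (Rep C A) ([(V, \<rho>)] @ [(W, \<sigma>)]) (S, \<kappa>)"
    by (rule R.direct_sum_append[OF R.direct_sum_single R.direct_sum_single, of "(V, \<rho>)" "(W, \<sigma>)" "(S, \<kappa>)" a b c d])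
      (simp_all add: Rep_Ob Rep_arr modV modW modS a b c d a_lin b_lin c_lin d_lin ba dc bc da sum)
  then show ?thesis by auto
qed

lemma Rep_zero: "\<exists>Z. zero_object (Rep C A) Z"
proof -
  interpret R: linear_category "Rep C A" by (rule Rep_linear)
  obtain Z where z: "zero_object C Z" using ex_zero_object by blast
  then have Z: "Z \<in> Ob C" by (simp add: zero_object_def)
  have "module_structure Z \<zero>\<^bsub>Hom C (\<A> \<otimes>\<^sub>o Z) Z\<^esub>"
  proof (rule module_structure_detect[where F = "{}"])
    show "x = y" if "W \<in> Ob C" "x \<in> arr C W Z" "y \<in> arr C W Z" for W x y
      using z that unfolding zero_object_def by blast
  qed (use Z zero_arr[OF act_ob[OF Z] Z] in auto)
  then show ?thesis
    using R.zero_object_iff[of "(Z, \<zero>\<^bsub>Hom C (\<A> \<otimes>\<^sub>o Z) Z\<^esub>)"] zero_object_iff[OF Z] z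
    by (auto simp: Rep_Ob)
qed

text \<open>The size of a module is the dimension of the endomorphism space of its underlying object: a
  proper retract of modules is a proper retract of underlying objects.\<close>

lemma Rep_regular_linear_category:
  "regular_linear_category (Rep C A) (\<lambda>X. vectorspace.dim class_ring (Hom C (fst X) (fst X)))"
proof -
  interpret R: linear_category "Rep C A" by (rule Rep_linear)
  show ?thesis
  proof unfold_locales
    show "\<exists>Z. zero_object (Rep C A) Z" by (rule Rep_zero)
  next
    fix X Y assume XY: "X \<in> Ob (Rep C A)" "Y \<in> Ob (Rep C A)"
    obtain V \<rho> W \<sigma> where eq: "X = (V, \<rho>)" "Y = (W, \<sigma>)" by (cases X; cases Y) auto
    show "\<exists>S. direct_sum (Rep C A) [X, Y] S"
      using XY unfolding eq Rep_Ob by (rule Rep_biproduct)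
  next
    fix X e assume "X \<in> Ob (Rep C A)" "e \<in> arr (Rep C A) X X" "e \<cdot>\<^bsub>Rep C A\<^esub> e = e"
    then show "R.idem_splits X e"
      by (cases X) (simp add: Rep_Ob Rep_arr Rep_idem_splits)
  next
    fix X Y f assume XY: "X \<in> Ob (Rep C A)" "Y \<in> Ob (Rep C A)" and f: "f \<in> arr (Rep C A) X Y"
    obtain V \<rho> W \<sigma> where eq: "X = (V, \<rho>)" "Y = (W, \<sigma>)" by (cases X; cases Y) auto
    have V: "module_structure V \<rho>" and W: "module_structure W \<sigma>" using XY by (auto simp: eq Rep_Ob)
    obtain h where "h \<in> arr C W V" "h \<cdot> \<sigma> = \<rho> \<cdot> act h" "f \<cdot> (h \<cdot> f) = f"
      by (rule module_map_regular[of V W \<rho> \<sigma> f])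
        (use V W f in \<open>auto simp: module_structure_def eq Rep_arr\<close>)
    then show "R.regular X Y f"
      unfolding R.regular_def eq by (intro bexI[of _ h]) (simp_all add: Rep_arr)
  next
    fix X Y i p assume XY: "X \<in> Ob (Rep C A)" "Y \<in> Ob (Rep C A)" and i: "i \<in> arr (Rep C A) Y X"
      and p: "p \<in> arr (Rep C A) X Y" and pi: "p \<cdot>\<^bsub>Rep C A\<^esub> i = Ident (Rep C A) Y"
      and ip: "i \<cdot>\<^bsub>Rep C A\<^esub> p \<noteq> Ident (Rep C A) X"
    obtain V \<rho> W \<sigma> where eq: "X = (V, \<rho>)" "Y = (W, \<sigma>)" by (cases X; cases Y) auto
    show "vectorspace.dim class_ring (Hom C (fst Y) (fst Y)) < vectorspace.dim class_ring (Hom C (fst X) (fst X))"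
      using XY i p pi ip Hom_fin_dim
      by (intro dim_End_less[of "fst X" "fst Y" i p]) (auto simp: eq Rep_Ob Rep_arr module_structure_def)
  qed
qed

end

section \<open>Semisimplicity\<close>

theorem theorem3p3:
  fixes C :: "('o, 'm, 'e) tensorcat_scheme" and A :: "('o, 'm) calgebra"
  assumes "rigid_semisimple_tensor_category C"
    and "rigid_C_algebra C A"
  shows "semisimple_algebra C A"
proof -
  interpret rigid_semisimple_tensor_category C by (rule assms(1))
  interpret rigid_algebra C A by unfold_locales (rule assms(2))
  show ?thesis
    unfolding semisimple_algebra_def
    by (rule regular_linear_category.semisimple_category[OF Rep_regular_linear_category])
qed

end
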